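(* Let $A$ be a finite dimensional non-nilpotent associative algebra with a generalized $H$-action over an algebraically closed field $F$ of characteristic $0$, where $H$ is a finite dimensional associative algebra with $1$ acting on $A$ in such a way that the Jacobson radical $J:=J(A)$ is $H$-invariant and $A=B\oplus J$ (direct sum of $H$-submodules), where $B$ is a subalgebra and $B=B_1\oplus\dots\oplus B_q$ (direct sum of $H$-invariant ideals of $B$) with $B_i$ being $H$-simple semisimple algebras. Let $$d(A):=\max\bigl\{\dim(B_{i_1}\oplus B_{i_2}\oplus\dots\oplus B_{i_r})\ \big|\ B_{i_1}JB_{i_2}J\cdots JB_{i_r}\neq0,\ 1\leqslant i_k\leqslant q,\ 1\leqslant k\leqslant r;\ 0\leqslant r\leqslant q\bigr\}.$$ Then $\lim_{n\to\infty}\sqrt[n]{c_n^H(A)}$ exists and $$\mathrm{PIexp}^H(A):=\lim_{n\to\infty}\sqrt[n]{c_n^H(A)}=d(A).$$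
   Context: In the definition of $d(A)$ the indices $i_1,\dots,i_r$ are pairwise distinct (the sum is direct), and $r=0$ contributes the value $0$. Algebras acted upon are not assumed to be unital. Let $H$ be an associative algebra with $1$. An associative algebra $A$ is an algebra with a generalized $H$-action if it is endowed with a homomorphism of algebras with $1$, $H\to\mathrm{End}_F(A)$, and for every $h\in H$ there exist (finitely many) $h'_i,h''_i,h'''_i,h''''_i\in H$ such that $$h(ab)=\sum_i\bigl((h'_ia)(h''_ib)+(h'''_ib)(h''''_ia)\bigr)\quad\text{for all } a,b\in A.$$ An $H$-simple algebra is a nonzero algebra with such an action having no $H$-invariant two-sided ideals except $0$ and itself. Let $(\gamma_\beta)_{\beta\in\Lambda}$ be a basis of $H$. $F\langle X|H\rangle$ is the free associative algebra over $F$ with free formal generators $x_i^{\gamma_\beta}$, $\beta\in\Lambda$, $i\in\mathbb{N}$; for $h=\sum_\beta\alpha_\beta\gamma_\beta$ put $x_i^h:=\sum_\beta\alpha_\beta x_i^{\gamma_\beta}$, and $x_i:=x_i^1$. Its elements are called $H$-polynomials. An $H$-polynomial $f(x_1,\dots,x_n)$ is evaluated at $a_1,\dots,a_n\in A$ by substituting $ha_i$ for $x_i^h$. It is an $H$-identity of $A$ if $f(a_1,\dots,a_n)=0$ for all $a_i\in A$; $\mathrm{Id}^H(A)$ is the set of $H$-identities. Let $$P_n^H=\langle x^{h_1}_{\sigma(1)}x^{h_2}_{\sigma(2)}\cdots x^{h_n}_{\sigma(n)}\mid h_i\in H,\ \sigma\in S_n\rangle_F\subset F\langle X|H\rangle.$$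 The $n$th $H$-codimension of $A$ is $c_n^H(A):=\dim\bigl(P_n^H/(P_n^H\cap\mathrm{Id}^H(A))\bigr)$. $A$ is nilpotent if all products of $p$ elements of $A$ vanish for some $p\in\mathbb{N}$. *)

theory Defs
  imports
    Complex_Main
    "HOL-Library.Poly_Mapping"
    "HOL-Computational_Algebra.Polynomial"
    "HOL-Combinatorics.Permutations"
begin

section \<open>Algebras over a field, ideals, Jacobson radical\<close>

locale assoc_algebra = vector_space scale
  for scale :: "'f::field \<Rightarrow> 'a::ring \<Rightarrow> 'a" +
  assumes scale_mult_left: "scale c (x * y) = scale c x * y"
    and scale_mult_right: "scale c (x * y) = x * scale c y"

definition is_subalgebra :: "('f::field \<Rightarrow> 'a::ring \<Rightarrow> 'a) \<Rightarrow> 'a set \<Rightarrow> bool" where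
  "is_subalgebra s R \<longleftrightarrow> module.subspace s R \<and> (\<forall>x\<in>R. \<forall>y\<in>R. x * y \<in> R)"

text \<open>In what follows \<open>R\<close> is a subalgebra, regarded as an algebra in its own right (in general
  without a unit); ideals of an algebra are required to be subspaces.\<close>

definition left_ideal :: "('f::field \<Rightarrow> 'a::ring \<Rightarrow> 'a) \<Rightarrow> 'a set \<Rightarrow> 'a set \<Rightarrow> bool" where
  "left_ideal s R L \<longleftrightarrow>
     module.subspace s L \<and> L \<subseteq> R \<and> (\<forall>r\<in>R. \<forall>x\<in>L. r * x \<in> L)"

definition two_sided_ideal :: "('f::field \<Rightarrow> 'a::ring \<Rightarrow> 'a) \<Rightarrow> 'a set \<Rightarrow> 'a set \<Rightarrow> bool" where
  "two_sided_ideal s R I \<longleftrightarrow>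
     module.subspace s I \<and> I \<subseteq> R \<and> (\<forall>r\<in>R. \<forall>x\<in>I. r * x \<in> I \<and> x * r \<in> I)"

text \<open>For algebras without a unit the Jacobson radical is the intersection of the maximal left
  ideals that are modular (also called regular), and the whole algebra if there are none.\<close>

definition modular_left_ideal :: "('f::field \<Rightarrow> 'a::ring \<Rightarrow> 'a) \<Rightarrow> 'a set \<Rightarrow> 'a set \<Rightarrow> bool" where
  "modular_left_ideal s R L \<longleftrightarrow> left_ideal s R L \<and> (\<exists>e\<in>R. \<forall>x\<in>R. x - x * e \<in> L)"

definition maximal_left_ideal :: "('f::field \<Rightarrow> 'a::ring \<Rightarrow> 'a) \<Rightarrow> 'a set \<Rightarrow> 'a set \<Rightarrow> bool" where
  "maximal_left_ideal s R L \<longleftrightarrow> left_ideal s R L \<and> L \<noteq> R \<and>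
     (\<forall>L'. left_ideal s R L' \<longrightarrow> L \<subseteq> L' \<longrightarrow> L' = L \<or> L' = R)"

definition jacobson_radical :: "('f::field \<Rightarrow> 'a::ring \<Rightarrow> 'a) \<Rightarrow> 'a set \<Rightarrow> 'a set" where
  "jacobson_radical s R =
     R \<inter> \<Inter> {L. modular_left_ideal s R L \<and> maximal_left_ideal s R L}"

text \<open>Used for finite dimensional \<open>R\<close> only.\<close>

definition semisimple_algebra :: "('f::field \<Rightarrow> 'a::ring \<Rightarrow> 'a) \<Rightarrow> 'a set \<Rightarrow> bool" where
  "semisimple_algebra s R \<longleftrightarrow> jacobson_radical s R = {0}"

text \<open>Products in an algebra without a unit. The value at the empty list is a dummy.\<close>

fun nonunital_prod :: "'a::ring list \<Rightarrow> 'a" where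
  "nonunital_prod [] = 0"
| "nonunital_prod [x] = x"
| "nonunital_prod (x # y # ys) = x * nonunital_prod (y # ys)"

definition nilpotent_algebra :: "'a::ring set \<Rightarrow> bool" where
  "nilpotent_algebra R \<longleftrightarrow>
     (\<exists>p>0. \<forall>xs. length xs = p \<longrightarrow> set xs \<subseteq> R \<longrightarrow> nonunital_prod xs = 0)"

definition internal_direct_sum :: "'i set \<Rightarrow> ('i \<Rightarrow> 'a::ab_group_add set) \<Rightarrow> 'a set \<Rightarrow> bool" where
  "internal_direct_sum I V W \<longleftrightarrow>
     W = {\<Sum>i\<in>I. v i | v. \<forall>i\<in>I. v i \<in> V i} \<and>
     (\<forall>v. (\<forall>i\<in>I. v i \<in> V i) \<longrightarrow> (\<Sum>i\<in>I. v i) = 0 \<longrightarrow> (\<forall>i\<in>I. v i = 0))"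


section \<open>Generalized \<open>H\<close>-actions\<close>

text \<open>\<open>H\<close> and \<open>A\<close> are the carrier types of \<open>sH\<close> and \<open>sA\<close>.\<close>

locale generalized_action =
  H: assoc_algebra sH + A: assoc_algebra sA
  for sH :: "'f::field \<Rightarrow> 'h::ring_1 \<Rightarrow> 'h"
    and sA :: "'f \<Rightarrow> 'a::ring \<Rightarrow> 'a" +
  fixes act :: "'h \<Rightarrow> 'a \<Rightarrow> 'a"
  assumes act_linear: "Vector_Spaces.linear sA sA (act h)"
    and act_add: "act (h + k) a = act h a + act k a"
    and act_scale: "act (sH c h) a = sA c (act h a)"
    and act_mult: "act (h * k) a = act h (act k a)"
    and act_one: "act 1 a = a"
    and act_prod: "\<exists>hs. \<forall>a b. act h (a * b) =
      (\<Sum>(h1, h2, h3, h4)\<leftarrow>hs. act h1 a * act h2 b + act h3 b * act h4 a)"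

definition H_invariant :: "('h \<Rightarrow> 'a \<Rightarrow> 'a) \<Rightarrow> 'a set \<Rightarrow> bool" where
  "H_invariant act V \<longleftrightarrow> (\<forall>h. \<forall>v\<in>V. act h v \<in> V)"

definition H_simple ::
  "('f::field \<Rightarrow> 'a::ring \<Rightarrow> 'a) \<Rightarrow> ('h \<Rightarrow> 'a \<Rightarrow> 'a) \<Rightarrow> 'a set \<Rightarrow> bool" where
  "H_simple sA act R \<longleftrightarrow> is_subalgebra sA R \<and> H_invariant act R \<and> R \<noteq> {0} \<and>
     (\<forall>I. two_sided_ideal sA R I \<longrightarrow> H_invariant act I \<longrightarrow> I = {0} \<or> I = R)"


section \<open>\<open>H\<close>-polynomials\<close>

text \<open>The free monoid; its monoid algebra \<open>'x free_monoid \<Rightarrow>\<^sub>0 'f\<close> is the free unital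
  algebra over \<open>'f\<close> on \<open>'x\<close>, with the multiplication of \<^theory>\<open>HOL-Library.Poly_Mapping\<close>.\<close>

datatype 'x free_monoid = Word (letters: "'x list")

instantiation free_monoid :: (type) monoid_add
begin

definition zero_free_monoid :: "'a free_monoid" where
  "0 = Word []"

definition plus_free_monoid :: "'a free_monoid \<Rightarrow> 'a free_monoid \<Rightarrow> 'a free_monoid" where
  "u + v = Word (letters u @ letters v)"

instance
  by standard (simp_all add: zero_free_monoid_def plus_free_monoid_def)

end

text \<open>The letter \<open>(i, \<gamma>)\<close> stands for the generator \<open>x\<^sub>i\<^sup>\<gamma>\<close>.\<close>

type_synonym ('f, 'h) hpoly = "(nat \<times> 'h) free_monoid \<Rightarrow>\<^sub>0 'f"

definition hpoly_scale :: "'f::field \<Rightarrow> ('f, 'h) hpoly \<Rightarrow> ('f, 'h) hpoly" where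
  "hpoly_scale c f = Poly_Mapping.single 0 c * f"

text \<open>\<open>F\<langle>X|H\<rangle>\<close> for the basis \<open>\<Gamma>\<close> of \<open>H\<close>. Its elements are substituted into algebras without
  a unit, so constant terms are excluded.\<close>

definition H_polynomials :: "'h set \<Rightarrow> ('f::field, 'h) hpoly set" where
  "H_polynomials \<Gamma> =
     {f. \<forall>w\<in>Poly_Mapping.keys f. letters w \<noteq> [] \<and> set (letters w) \<subseteq> UNIV \<times> \<Gamma>}"

definition hvar ::
  "('f::field \<Rightarrow> 'h::ring_1 \<Rightarrow> 'h) \<Rightarrow> 'h set \<Rightarrow> nat \<Rightarrow> 'h \<Rightarrow> ('f, 'h) hpoly" where
  "hvar sH \<Gamma> i h = (\<Sum>\<gamma> | module.representation sH \<Gamma> h \<gamma> \<noteq> 0.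
     hpoly_scale (module.representation sH \<Gamma> h \<gamma>) (Poly_Mapping.single (Word [(i, \<gamma>)]) 1))"

definition hpoly_eval ::
  "('f::field \<Rightarrow> 'a::ring \<Rightarrow> 'a) \<Rightarrow> ('h \<Rightarrow> 'a \<Rightarrow> 'a) \<Rightarrow> (nat \<Rightarrow> 'a) \<Rightarrow> ('f, 'h) hpoly \<Rightarrow> 'a" where
  "hpoly_eval sA act a f = (\<Sum>w\<in>Poly_Mapping.keys f.
     sA (Poly_Mapping.lookup f w) (nonunital_prod (map (\<lambda>(i, \<gamma>). act \<gamma> (a i)) (letters w))))"

definition H_identities ::
  "('f::field \<Rightarrow> 'a::ring \<Rightarrow> 'a) \<Rightarrow> ('h \<Rightarrow> 'a \<Rightarrow> 'a) \<Rightarrow> 'h set \<Rightarrow> ('f, 'h) hpoly set" where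
  "H_identities sA act \<Gamma> = {f \<in> H_polynomials \<Gamma>. \<forall>a. hpoly_eval sA act a f = 0}"

definition multilinear_H_polynomials ::
  "('f::field \<Rightarrow> 'h::ring_1 \<Rightarrow> 'h) \<Rightarrow> 'h set \<Rightarrow> nat \<Rightarrow> ('f, 'h) hpoly set" where
  "multilinear_H_polynomials sH \<Gamma> n = module.span hpoly_scale
     {prod_list (map (\<lambda>k. hvar sH \<Gamma> (\<sigma> k) (h k)) [1..<Suc n]) | \<sigma> h. \<sigma> permutes {1..n}}"


section \<open>Codimensions and the PI-exponent\<close>

text \<open>A basis of \<open>V/W\<close>, given by representatives in \<open>V\<close>.\<close>

definition quotient_basis ::
  "('f::field \<Rightarrow> 'v::ab_group_add \<Rightarrow> 'v) \<Rightarrow> 'v set \<Rightarrow> 'v set \<Rightarrow> 'v set \<Rightarrow> bool" where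
  "quotient_basis s V W S \<longleftrightarrow> S \<subseteq> V \<and>
     (\<forall>t u. finite t \<longrightarrow> t \<subseteq> S \<longrightarrow> (\<Sum>v\<in>t. s (u v) v) \<in> W \<longrightarrow> (\<forall>v\<in>t. u v = 0)) \<and>
     (\<forall>x\<in>V. \<exists>y\<in>module.span s S. x - y \<in> W)"

definition quotient_dim ::
  "('f::field \<Rightarrow> 'v::ab_group_add \<Rightarrow> 'v) \<Rightarrow> 'v set \<Rightarrow> 'v set \<Rightarrow> nat" where
  "quotient_dim s V W = card (SOME S. quotient_basis s V W S)"

definition H_codim ::
  "('f::field \<Rightarrow> 'h::ring_1 \<Rightarrow> 'h) \<Rightarrow> ('f \<Rightarrow> 'a::ring \<Rightarrow> 'a) \<Rightarrow> ('h \<Rightarrow> 'a \<Rightarrow> 'a) \<Rightarrow> 'h set \<Rightarrow> nat \<Rightarrow> nat"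
  where
  "H_codim sH sA act \<Gamma> n = quotient_dim hpoly_scale
     (multilinear_H_polynomials sH \<Gamma> n)
     (multilinear_H_polynomials sH \<Gamma> n \<inter> H_identities sA act \<Gamma>)"

definition PIexp_H ::
  "('f::field \<Rightarrow> 'h::ring_1 \<Rightarrow> 'h) \<Rightarrow> ('f \<Rightarrow> 'a::ring \<Rightarrow> 'a) \<Rightarrow> ('h \<Rightarrow> 'a \<Rightarrow> 'a) \<Rightarrow> 'h set \<Rightarrow> real" where
  "PIexp_H sH sA act \<Gamma> = lim (\<lambda>n. root n (real (H_codim sH sA act \<Gamma> n)))"


section \<open>The number \<open>d(A)\<close>\<close>

definition subspace_mult ::
  "('f::field \<Rightarrow> 'a::ring \<Rightarrow> 'a) \<Rightarrow> 'a set \<Rightarrow> 'a set \<Rightarrow> 'a set" where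
  "subspace_mult s U V = module.span s {u * v | u v. u \<in> U \<and> v \<in> V}"

text \<open>\<open>B\<^bsub>i\<^sub>1\<^esub> J B\<^bsub>i\<^sub>2\<^esub> J \<dots> J B\<^bsub>i\<^sub>r\<^esub>\<close> for a nonempty list of indices; the value at the empty list is
  a dummy, since the case \<open>r = 0\<close> is treated separately in \<open>d_number\<close>.\<close>

fun BJ_chain ::
  "('f::field \<Rightarrow> 'a::ring \<Rightarrow> 'a) \<Rightarrow> (nat \<Rightarrow> 'a set) \<Rightarrow> 'a set \<Rightarrow> nat list \<Rightarrow> 'a set" where
  "BJ_chain s B J [] = {0}"
| "BJ_chain s B J [i] = B i"
| "BJ_chain s B J (i # j # is) =
     subspace_mult s (B i) (subspace_mult s J (BJ_chain s B J (j # is)))"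

definition d_number ::
  "('f::field \<Rightarrow> 'a::ring \<Rightarrow> 'a) \<Rightarrow> nat \<Rightarrow> (nat \<Rightarrow> 'a set) \<Rightarrow> 'a set \<Rightarrow> nat" where
  "d_number s q B J = Max (insert 0
     {vector_space.dim s (module.span s (\<Union>i\<in>set is. B i)) | is.
        is \<noteq> [] \<and> length is \<le> q \<and> distinct is \<and> set is \<subseteq> {1..q} \<and> BJ_chain s B J is \<noteq> {0}})"

end

theory Submission
  imports Defs "HOL-Library.FuncSet"
begin

text \<open>
  The codimension \<open>c\<^sub>n\<close> is the dimension of the space of functions \<open>A\<^sup>n \<rightarrow> A\<close> spanned by the multilinear
  \<open>H\<close>-monomials (the predicate \<open>multilin\<close>; the passage from polynomials to functions is made in
  \<open>H_codim_le\<close> and \<open>H_codim_ge\<close>). Both bounds come from evaluating such functions at tuples taken from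
  a basis of \<open>A\<close> that is adapted to \<open>B\<^sub>1, \<dots>, B\<^sub>q, J\<close>.

  Upper bound. A multilinear function is determined by its values at tuples of basis elements. The
  radical is nilpotent, so a monomial vanishes at a tuple with many entries in \<open>J\<close>. Elements of
  different blocks annihilate each other, so in a nonzero product any two factors from different
  blocks are separated by a factor from \<open>J\<close>; hence the blocks met by the tuple, in a suitable order,
  have a nonzero product \<open>B\<^bsub>i\<^sub>1\<^esub> J B\<^bsub>i\<^sub>2\<^esub> \<dots> J B\<^bsub>i\<^sub>r\<^esub>\<close> (\<open>product_in_chain\<close>), and their dimensions add up to at most
  \<open>d = d(A)\<close>. All but boundedly many entries of a tuple are therefore chosen among \<open>d\<close> basis elements,
  which gives \<open>c\<^sub>n \<le> C (d + \<epsilon>)\<^sup>n\<close>.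

  Lower bound. Fix a nonzero product of blocks as above whose sum \<open>B'\<close> has dimension \<open>d\<close>, and let \<open>D\<close>
  be its basis. By the density theorem the operators generated on a block by \<open>H\<close> and by
  multiplications with elements of the block contain all matrix units (\<open>block_op_matrix_unit\<close>).
  Multiplied along the nonzero product, they yield a multilinear function of variables \<open>x\<^sub>e\<close>, \<open>e \<in> D\<close>,
  and of a fixed number of further variables which survives alternation in the \<open>x\<^sub>e\<close>
  (\<open>alternating_initial\<close>). Replacing \<open>x\<^sub>e\<close> by \<open>u v x\<^sub>e\<close> in an alternating function and summing over \<open>e\<close>
  multiplies it by the trace \<open>\<beta>(u, v)\<close> of \<open>x \<mapsto> u v x\<close> on \<open>B'\<close> (\<open>alternating_trace\<close>), and the variables
  \<open>x\<^sub>e\<close> remain available; so \<open>N\<close> trace factors cost just \<open>2N\<close> new variables, and all functions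
  \<open>\<Prod>\<^sub>i \<beta>(u\<^sub>i, v\<^bsub>\<pi>(i)\<^esub>)\<close>, multiplied by a fixed nonzero value, are obtained. The form \<open>\<beta>\<close> is nondegenerate
  because the blocks are semisimple and the characteristic is 0 (\<open>trace_fun_nondegenerate\<close>). If the
  \<open>u\<^sub>i\<close> run through \<open>D\<close> according to a word \<open>w\<close> and the \<open>v\<^sub>i\<close> through the dual basis according to a word
  \<open>w'\<close>, then the product is 1 if \<open>w = w' \<circ> \<pi>\<close> and 0 otherwise. It remains to find nearly \<open>d\<^bsup>2N\<^esup>\<close> pairs of
  words with permutations for which this 0-1 matrix is the identity matrix, and that is the
  combinatorial content of \<open>rigid_matchings\<close>.
\<close>

section \<open>Words in blocks and rigid matchings\<close>

text \<open>Pigeonhole: there are at most \<open>(L + 1)\<^sup>d\<close> vectors of letter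
  frequencies, so some class of words with the same frequencies contains all but a polynomial
  factor of the \<open>d\<^sup>L\<close> words.\<close>

lemma large_content_class:
  fixes d L :: nat
  obtains G c where "G \<subseteq> {..<L} \<rightarrow>\<^sub>E {..<d}"
    and "\<And>g i. g \<in> G \<Longrightarrow> card {x\<in>{..<L}. g x = i} = c i"
    and "d ^ L \<le> (L + 1) ^ d * card G"
proof -
  define W where "W = {..<L} \<rightarrow>\<^sub>E {..<d}"
  define \<kappa> where "\<kappa> g = (\<lambda>i\<in>{..<d}. card {x\<in>{..<L}. g x = i})" for g :: "nat \<Rightarrow> nat"
  have finW: "finite W" unfolding W_def by (intro finite_PiE) auto
  have cardW: "card W = d ^ L" unfolding W_def by (simp add: card_PiE)
  have card_le: "card {x\<in>{..<L}. g x = i} \<le> L" for g :: "nat \<Rightarrow> nat" and i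
    using card_mono[of "{..<L}" "{x\<in>{..<L}. g x = i}"] by auto
  have "\<kappa> g \<in> {..<d} \<rightarrow>\<^sub>E {..L}" for g
    using card_le unfolding \<kappa>_def by (intro restrict_PiE_iff[THEN iffD2]) simp
  then have "\<kappa> ` W \<subseteq> {..<d} \<rightarrow>\<^sub>E {..L}" by blast
  then have card_im: "card (\<kappa> ` W) \<le> (L + 1) ^ d"
    using card_mono[of "{..<d} \<rightarrow>\<^sub>E {..L}" "\<kappa> ` W"] by (simp add: card_PiE finite_PiE)
  show thesis
  proof (cases "W = {}")
    case True
    then show thesis using that[of "{}" "\<lambda>_. 0"] cardW by simp
  next
    case False
    have "\<exists>y\<in>\<kappa> ` W. d ^ L \<le> (L + 1) ^ d * card {g\<in>W. \<kappa> g = y}"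
    proof (rule ccontr)
      assume "\<not> ?thesis"
      then have lt: "(L + 1) ^ d * card {g\<in>W. \<kappa> g = y} < d ^ L" if "y \<in> \<kappa> ` W" for y
        using that by (meson not_le)
      have "card W = (\<Sum>y\<in>\<kappa> ` W. card {g\<in>W. \<kappa> g = y})"
        using sum.image_gen[OF finW, of "\<lambda>_. 1::nat" \<kappa>] by simp
      then have "(L + 1) ^ d * d ^ L = (\<Sum>y\<in>\<kappa> ` W. (L + 1) ^ d * card {g\<in>W. \<kappa> g = y})"
        by (simp add: cardW sum_distrib_left)
      also have "\<dots> < (\<Sum>y\<in>\<kappa> ` W. d ^ L)"
        using lt False finW by (intro sum_strict_mono) auto
      also have "\<dots> \<le> (L + 1) ^ d * d ^ L" using card_im by simp
      finally show False by simp
    qed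
    then obtain y where y: "d ^ L \<le> (L + 1) ^ d * card {g\<in>W. \<kappa> g = y}" by blast
    show thesis
    proof (rule that[of "{g\<in>W. \<kappa> g = y}" "\<lambda>i. if i < d then y i else 0"])
      fix g i assume g: "g \<in> {g\<in>W. \<kappa> g = y}"
      show "card {x\<in>{..<L}. g x = i} = (if i < d then y i else 0)"
      proof (cases "i < d")
        case True
        then show ?thesis using g by (auto simp: \<kappa>_def)
      next
        case False
        then have "{x\<in>{..<L}. g x = i} = {}" using g by (auto simp: W_def PiE_iff)
        then show ?thesis using False by simp
      qed
    qed (use y in \<open>auto simp: W_def\<close>)
  qed
qed

lemma block_card:
  fixes L t j :: nat
  assumes "j < t"
  shows "card {p\<in>{..<t*L}. p div L = j \<and> Q (p mod L)} = card {x\<in>{..<L}. Q x}"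
proof (rule bij_betw_same_card[symmetric])
  show "bij_betw (\<lambda>x. j * L + x) {x\<in>{..<L}. Q x} {p\<in>{..<t*L}. p div L = j \<and> Q (p mod L)}"
  proof (rule bij_betw_byWitness[where f' = "\<lambda>p. p mod L"])
    have "j * L + x < t * L" if "x < L" for x
    proof -
      have "j * L + x < (j + 1) * L" using that by simp
      also have "\<dots> \<le> t * L" using assms by (intro mult_right_mono) auto
      finally show ?thesis .
    qed
    then show "(\<lambda>x. j * L + x) ` {x\<in>{..<L}. Q x} \<subseteq> {p\<in>{..<t*L}. p div L = j \<and> Q (p mod L)}"
      by auto
    show "(\<lambda>p. p mod L) ` {p\<in>{..<t*L}. p div L = j \<and> Q (p mod L)} \<subseteq> {x\<in>{..<L}. Q x}"
      by (cases "L = 0") auto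
  qed (auto simp: mult.commute)
qed

lemma permutes_matching_labels:
  assumes "finite A" and "\<And>l. card {x\<in>A. f x = l} = card {x\<in>A. g x = l}"
  obtains p where "p permutes A" and "\<And>x. x \<in> A \<Longrightarrow> g (p x) = f x"
proof -
  have "{x \<in> A. l = h x} = {x \<in> A. h x = l}" for l and h :: "'a \<Rightarrow> 'b" by auto
  then have "image_mset f (mset_set A) = image_mset g (mset_set A)"
    using assms by (intro multiset_eqI) (simp add: count_image_mset_eq_card_vimage)
  with image_mset_eq_implies_permutes[OF assms(1)] that show thesis by metis
qed

text \<open>Words of length \<open>t L\<close> are cut into \<open>t\<close> blocks of length
  \<open>L\<close>. The vector \<open>c\<close> prescribes how often each letter occurs in every
  single block.\<close>

locale block_words =
  fixes d L t :: nat and c :: "nat \<Rightarrow> nat"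
begin

definition content_word :: "(nat \<Rightarrow> nat) \<Rightarrow> bool" where
  "content_word w \<longleftrightarrow> (\<forall>p<t*L. w p < d) \<and>
     (\<forall>j<t. \<forall>i. card {p\<in>{..<t*L}. p div L = j \<and> w p = i} = c i)"

text \<open>A position with letter \<open>i\<close> in block \<open>j\<close> of \<open>w\<close>
  is matched with a position with the same letter in block \<open>j + i\<close> (modulo
  \<open>t\<close>) of \<open>v\<close>. The shift by the letter itself is what makes the matching
  remember the words.\<close>

definition shift_matching :: "(nat \<Rightarrow> nat) \<Rightarrow> (nat \<Rightarrow> nat) \<Rightarrow> (nat \<Rightarrow> nat) \<Rightarrow> bool" where
  "shift_matching w v p \<longleftrightarrow> p permutes {..<t*L} \<and>
     (\<forall>x<t*L. p x div L = (x div L + w x) mod t \<and> v (p x) = w x)"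

lemma shift_matching_exists:
  assumes w: "content_word w" and v: "content_word v" and dt: "d \<le> t"
  shows "\<exists>p. shift_matching w v p"
proof -
  define f where "f x = ((x div L + w x) mod t, w x)" for x
  define g where "g x = (x div L, v x)" for x
  have divlt: "x div L < t" if "x < t * L" for x
    using that by (simp add: less_mult_imp_div_less)
  have card_eq: "card {x\<in>{..<t*L}. f x = l} = card {x\<in>{..<t*L}. g x = l}" for l
  proof -
    obtain b i where l: "l = (b, i)" by force
    show ?thesis
    proof (cases "b < t \<and> i < d")
      case True
      define j where "j = (b + t - i) mod t"
      have jt: "j < t" unfolding j_def using True by (intro mod_less_divisor) auto
      have shift: "(k + i) mod t = b \<longleftrightarrow> k = j" if "k < t" for k
      proof
        assume "(k + i) mod t = b"
        show "k = j"
        proof (cases "k + i < t")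
          case True
          then show ?thesis using \<open>(k + i) mod t = b\<close> that by (auto simp: j_def)
        next
          case False
          moreover have "k + i - t < t" using that \<open>b < t \<and> i < d\<close> dt by linarith
          ultimately have "(k + i) mod t = k + i - t" by (simp add: le_mod_geq)
          then show ?thesis using False \<open>(k + i) mod t = b\<close> that by (auto simp: j_def)
        qed
      next
        assume k: "k = j"
        have "(k + i) mod t = (b + t - i + i) mod t" unfolding k j_def by (rule mod_add_left_eq)
        also have "b + t - i + i = b + t" using True dt by simp
        finally show "(k + i) mod t = b" using True by simp
      qed
      have "{x\<in>{..<t*L}. f x = l} = {x\<in>{..<t*L}. x div L = j \<and> w x = i}"
        using shift divlt by (auto simp: f_def l)
      moreover have "{x\<in>{..<t*L}. g x = l} = {x\<in>{..<t*L}. x div L = b \<and> v x = i}"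
        by (auto simp: g_def l)
      ultimately show ?thesis using w v True jt by (simp add: content_word_def)
    next
      case False
      have "{x\<in>{..<t*L}. f x = l} = {}"
        using False w by (auto simp: f_def l content_word_def)
          (metis less_nat_zero_code mod_less_divisor mult_eq_0_iff neq0_conv)
      moreover have "{x\<in>{..<t*L}. g x = l} = {}"
        using False v divlt by (auto simp: g_def l content_word_def)
      ultimately show ?thesis by (simp only:)
    qed
  qed
  obtain p where p: "p permutes {..<t*L}" "\<And>x. x \<in> {..<t*L} \<Longrightarrow> g (p x) = f x"
    using permutes_matching_labels[OF _ card_eq] by auto
  then have "shift_matching w v p"
    by (auto simp: shift_matching_def f_def g_def)
  then show ?thesis by blast
qed

text \<open>The matching of \<open>w\<close> and \<open>v\<close> fits no other pair \<open>z,
  y\<close> with the same beginning. By induction on the block \<open>j\<close> and then on the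
  letter \<open>i\<close> of \<open>w\<close>, the letter \<open>k\<close> of \<open>z\<close> at
  a position of block \<open>j\<close> is \<open>i\<close>: a smaller \<open>k\<close> is already
  used up in block \<open>j\<close> of \<open>z\<close>, and a larger \<open>k\<close> is already
  used up in block \<open>j + i\<close> of \<open>y\<close> by the partners of the positions in
  block \<open>j + i - k < j\<close>. Fixing the first \<open>d\<close> blocks starts the
  induction and rules out that this earlier block index becomes negative.\<close>

lemma shift_matching_rigid:
  assumes w: "content_word w" and v: "content_word v" and p: "shift_matching w v p"
    and z: "content_word z" and y: "content_word y"
    and first: "\<And>x. x < t * L \<Longrightarrow> x div L < d \<Longrightarrow> z x = w x"
    and fit: "\<And>x. x < t * L \<Longrightarrow> y (p x) = z x"
  shows "x < t * L \<Longrightarrow> z x = w x"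
proof (induction "x div L * d + w x" arbitrary: x rule: less_induct)
  case less
  have perm: "p permutes {..<t*L}" using p by (simp add: shift_matching_def)
  define j i k where "j = x div L" and "i = w x" and "k = z x"
  have id: "i < d" "k < d" using w z less.prems by (auto simp: i_def k_def content_word_def)
  have jt: "j < t" using less.prems by (simp add: j_def less_mult_imp_div_less)
  show ?case
  proof (cases "j < d")
    case True
    then show ?thesis using first less.prems by (simp add: j_def)
  next
    case False
    consider "k < i" | "k = i" | "i < k" by linarith
    then show ?thesis
    proof cases
      case 1
      let ?S = "{x'\<in>{..<t*L}. x' div L = j \<and> w x' = k}"
      let ?T = "{x'\<in>{..<t*L}. x' div L = j \<and> z x' = k}"
      have "z x' = k" if "x' \<in> ?S" for x'
        using less.hyps[of x'] that 1 by (auto simp: j_def i_def)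
      then have "?S \<subseteq> ?T" by auto
      moreover have "card ?S = card ?T" using w z jt by (simp add: content_word_def)
      ultimately have "?S = ?T" by (intro card_subset_eq) auto
      moreover have "x \<in> ?T" using less.prems by (simp add: j_def k_def)
      ultimately have "w x = k" by blast
      then show ?thesis by (simp add: k_def)
    next
      case 2
      then show ?thesis by (simp add: k_def i_def)
    next
      case 3
      define b j' where "b = (j + i) mod t" and "j' = j + i - k"
      have j': "j' < j" "j' + k = j + i" using 3 False id by (auto simp: j'_def)
      have bt: "b < t" unfolding b_def using jt by simp
      let ?S = "{x'\<in>{..<t*L}. x' div L = j' \<and> w x' = k}"
      let ?T = "{x'\<in>{..<t*L}. x' div L = b \<and> y x' = k}"
      have small: "j' * d + k < j * d + i"
      proof -
        have "j' * d + k < (j' + 1) * d" using id by simp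
        also have "\<dots> \<le> j * d" using j' by (intro mult_right_mono) auto
        finally show ?thesis by simp
      qed
      have zS: "z x' = k" if "x' \<in> ?S" for x'
        using less.hyps[of x'] that small by (auto simp: j_def i_def)
      have plt: "p x' < t * L" if "x' < t * L" for x'
        using permutes_in_image[OF perm, of x'] that by simp
      have "p ` ?S \<subseteq> ?T"
        using zS fit plt p j' by (auto simp: shift_matching_def b_def)
      moreover have "card (p ` ?S) = card ?T"
      proof -
        have "card (p ` ?S) = card ?S"
          using permutes_inj[OF perm] by (intro card_image) (auto simp: inj_on_def)
        then show ?thesis using w y bt jt j' by (simp add: content_word_def)
      qed
      ultimately have "p ` ?S = ?T" by (intro card_subset_eq) auto
      moreover have "p x \<in> ?T"
        using less.prems p fit plt by (auto simp: shift_matching_def b_def j_def i_def k_def)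
      ultimately have "p x \<in> p ` ?S" by simp
      then have "x \<in> ?S" using permutes_inj[OF perm] by (auto simp: inj_on_def)
      then show ?thesis by (simp add: k_def)
    qed
  qed
qed

end

text \<open>The combinatorial input of the lower bound. The words \<open>w s\<close> have their
  first \<open>d\<close> blocks fixed and all other blocks free in \<open>G\<close>, the words
  \<open>v s\<close> have all blocks free, which accounts for \<open>2t - d\<close> free blocks;
  positions from \<open>t L\<close> on carry the letter 0 and are fixed by the permutations.\<close>

lemma rigid_matchings:
  fixes d L t N :: nat
  assumes d: "d \<ge> 1" and dt: "d \<le> t" and N: "t * L \<le> N"
    and G: "G \<subseteq> {..<L} \<rightarrow>\<^sub>E {..<d}"
    and content: "\<And>g i. g \<in> G \<Longrightarrow> card {x\<in>{..<L}. g x = i} = c i"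
  obtains S :: "((nat \<Rightarrow> nat \<Rightarrow> nat) \<times> (nat \<Rightarrow> nat \<Rightarrow> nat)) set" and w v p where
    "finite S" "card G ^ (2 * t - d) \<le> card S"
    "\<And>s. s \<in> S \<Longrightarrow> p s permutes {..<N}"
    "\<And>s i. s \<in> S \<Longrightarrow> i < N \<Longrightarrow> w s i < d \<and> v s i < d"
    "\<And>s r. s \<in> S \<Longrightarrow> r \<in> S \<Longrightarrow> (\<forall>i<N. v r (p s i) = w r i) \<longleftrightarrow> r = s"
proof (cases "G = {}")
  case True
  have "2 * t - d > 0" using d dt by simp
  then show thesis using that[of "{}"] True by (simp add: power_0_left)
next
  case False
  then obtain g0 where g0: "g0 \<in> G" by blast
  interpret block_words d L t c .
  define U where "U = PiE {..<t} (\<lambda>j. if j < d then {g0} else G)"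
  define V where "V = PiE {..<t} (\<lambda>_. G)"
  define word where "word u i = (if i < t * L then u (i div L) (i mod L) else (0::nat))"
    for u :: "nat \<Rightarrow> nat \<Rightarrow> nat" and i
  have finG: "finite G" using G finite_subset finite_PiE by (metis finite_lessThan)
  have UG: "u j \<in> G" if "u \<in> U" "j < t" for u j
    using that g0 by (auto simp: U_def PiE_iff split: if_splits)
  have Ufix: "u j = g0" if "u \<in> U" "j < d" "j < t" for u j
    using PiE_mem[OF that(1)[unfolded U_def], of j] that by simp
  have VG: "u j \<in> G" if "u \<in> V" "j < t" for u j
    using that by (auto simp: V_def PiE_iff)
  have cw: "content_word (word u)" if u: "\<And>j. j < t \<Longrightarrow> u j \<in> G" for u
  proof -
    have "u (p div L) (p mod L) < d" if p: "p < t * L" for p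
    proof -
      have "p div L < t" using p by (simp add: less_mult_imp_div_less)
      moreover have "p mod L < L" using p by (cases "L = 0") auto
      ultimately show ?thesis using u[of "p div L"] G by (auto simp: PiE_iff)
    qed
    moreover have "card {p\<in>{..<t*L}. p div L = j \<and> word u p = i} = c i" if j: "j < t" for i j
    proof -
      have "{p\<in>{..<t*L}. p div L = j \<and> word u p = i} = {p\<in>{..<t*L}. p div L = j \<and> u j (p mod L) = i}"
        by (auto simp: word_def)
      then show ?thesis using block_card[OF j, of L "\<lambda>x. u j x = i"] content[OF u[OF j]] by simp
    qed
    ultimately show ?thesis by (auto simp: content_word_def word_def)
  qed
  have cwU: "content_word (word u)" if "u \<in> U" for u using cw UG that by blast
  have cwV: "content_word (word u)" if "u \<in> V" for u using cw VG that by blast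
  have word_eq: "u = u'" if eq: "\<And>x. x < t * L \<Longrightarrow> word u x = word u' x"
    and u: "\<And>j. j < t \<Longrightarrow> u j \<in> G" "\<And>j. j < t \<Longrightarrow> u' j \<in> G"
    and ext: "u \<in> extensional {..<t}" "u' \<in> extensional {..<t}" for u u'
  proof (rule extensionalityI[OF ext])
    fix j assume j: "j \<in> {..<t}"
    show "u j = u' j"
    proof (rule extensionalityI)
      show "u j \<in> extensional {..<L}" "u' j \<in> extensional {..<L}"
        using u[of j] j G by (auto simp: PiE_def)
      fix x assume x: "x \<in> {..<L}"
      have "j * L + x < (j + 1) * L" using x by simp
      also have "\<dots> \<le> t * L" using j by (intro mult_right_mono) auto
      finally have "j * L + x < t * L" .
      from eq[OF this] show "u j x = u' j x" using x \<open>j * L + x < t * L\<close> by (simp add: word_def)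
    qed
  qed
  define S where "S = U \<times> V"
  define p where "p s = (SOME \<pi>. shift_matching (word (fst s)) (word (snd s)) \<pi>)" for s
  have p: "shift_matching (word (fst s)) (word (snd s)) (p s)" if "s \<in> S" for s
  proof -
    have "\<exists>\<pi>. shift_matching (word (fst s)) (word (snd s)) \<pi>"
      using that by (intro shift_matching_exists dt cwU cwV) (simp_all add: S_def mem_Times_iff)
    then show ?thesis unfolding p_def by (rule someI_ex)
  qed
  show thesis
  proof (rule that[of S p "\<lambda>s. word (fst s)" "\<lambda>s. word (snd s)"])
    show "finite S" unfolding S_def U_def V_def using finG by (auto intro!: finite_PiE)
    have "card U = (\<Prod>j<t. if j < d then 1 else card G)"
      unfolding U_def by (subst card_PiE) (auto intro!: prod.cong)
    also have "\<dots> = (\<Prod>j\<in>{d..<t}. card G)"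
      using dt by (intro prod.mono_neutral_cong_right) auto
    finally have "card U = card G ^ (t - d)" by simp
    moreover have "card V = card G ^ t" unfolding V_def by (subst card_PiE) auto
    ultimately show "card G ^ (2 * t - d) \<le> card S"
      using dt by (simp add: S_def card_cartesian_product power_add[symmetric] mult_2)
    show perm: "p s permutes {..<N}" if "s \<in> S" for s
      using p[OF that] N by (auto simp: shift_matching_def intro: permutes_subset)
    show "word (fst s) i < d \<and> word (snd s) i < d" if "s \<in> S" "i < N" for s i
      using that cwU[of "fst s"] cwV[of "snd s"] d
      by (cases "i < t * L") (auto simp: S_def content_word_def word_def)
    fix s r assume s: "s \<in> S" and r: "r \<in> S"
    show "(\<forall>i<N. word (snd r) (p s i) = word (fst r) i) \<longleftrightarrow> r = s"
    proof
      assume eq: "\<forall>i<N. word (snd r) (p s i) = word (fst r) i"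
      have perm: "p s permutes {..<t*L}" using p[OF s] by (simp add: shift_matching_def)
      have first: "word (fst r) x = word (fst s) x" if x: "x < t * L" "x div L < d" for x
      proof -
        have "x div L < t" using x by (simp add: less_mult_imp_div_less)
        then have "fst r (x div L) = g0" "fst s (x div L) = g0"
          using Ufix[OF _ x(2)] r s by (simp_all add: S_def mem_Times_iff)
        then show ?thesis by (simp add: word_def)
      qed
      have fits: "word (snd r) (p s x) = word (fst r) x" if "x < t * L" for x
        using eq that N by auto
      have 1: "word (fst r) x = word (fst s) x" if "x < t * L" for x
      proof (rule shift_matching_rigid[OF _ _ p[OF s] _ _ first fits that])
        show "content_word (word (fst s))" "content_word (word (snd s))"
          "content_word (word (fst r))" "content_word (word (snd r))"
          using s r cwU cwV by (simp_all add: S_def mem_Times_iff)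
      qed
      have 2: "word (snd r) x = word (snd s) x" if x: "x < t * L" for x
      proof -
        define x' where "x' = inv (p s) x"
        have x': "x' < t * L" "x = p s x'"
          using permutes_in_image[OF permutes_inv[OF perm], of x] x permutes_inverses[OF perm]
          by (auto simp: x'_def)
        have "word (snd s) x = word (fst s) x'"
          using p[OF s] x' by (auto simp: shift_matching_def)
        then show ?thesis using fits[OF x'(1)] 1[OF x'(1)] x'(2) by simp
      qed
      have mem: "fst r \<in> U" "fst s \<in> U" "snd r \<in> V" "snd s \<in> V"
        using r s by (simp_all add: S_def mem_Times_iff)
      then have ext: "fst r \<in> extensional {..<t}" "fst s \<in> extensional {..<t}"
          "snd r \<in> extensional {..<t}" "snd s \<in> extensional {..<t}"
        by (simp_all add: U_def V_def PiE_def)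
      have "fst r = fst s" using word_eq[of "fst r" "fst s"] 1 UG ext mem by blast
      moreover have "snd r = snd s" using word_eq[of "snd r" "snd s"] 2 VG ext mem by blast
      ultimately show "r = s" by (simp add: prod_eq_iff)
    next
      assume rs: "r = s"
      show "\<forall>i<N. word (snd r) (p s i) = word (fst r) i"
      proof (intro allI impI)
        fix i assume "i < N"
        show "word (snd r) (p s i) = word (fst r) i"
        proof (cases "i < t * L")
          case True
          then show ?thesis using p[OF s] rs by (simp add: shift_matching_def)
        next
          case False
          then have "p s i = i" using p[OF s] by (auto simp: shift_matching_def permutes_def)
          then show ?thesis using False by (simp add: word_def)
        qed
      qed
    qed
  qed
qed

section \<open>Nilpotence, idempotents and traces in finite dimension\<close>

text \<open>A homogeneous linear system with more unknowns than equations, by elimination of one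
  unknown at a time.\<close>

lemma nontrivial_solution:
  fixes g :: "'s \<Rightarrow> 'x \<Rightarrow> 'f::field"
  assumes "finite X" "finite T" "card X < card T"
  shows "\<exists>u. (\<exists>s\<in>T. u s \<noteq> 0) \<and> (\<forall>x\<in>X. (\<Sum>s\<in>T. u s * g s x) = 0)"
  using assms
proof (induction X arbitrary: T g rule: finite_induct)
  case empty
  then have "T \<noteq> {}" by auto
  then show ?case by (intro exI[of _ "\<lambda>_. 1"]) auto
next
  case (insert x X)
  show ?case
  proof (cases "\<forall>s\<in>T. g s x = 0")
    case True
    obtain u where "\<exists>s\<in>T. u s \<noteq> 0" "\<forall>y\<in>X. (\<Sum>s\<in>T. u s * g s y) = 0"
      using insert.IH[of T g] insert.prems insert.hyps by auto
    then show ?thesis using True by (intro exI[of _ u]) auto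
  next
    case False
    then obtain s0 where s0: "s0 \<in> T" "g s0 x \<noteq> 0" by blast
    define T' where "T' = T - {s0}"
    have T: "T = insert s0 T'" "s0 \<notin> T'" "finite T'" using s0 insert.prems by (auto simp: T'_def)
    have "card X < card T'" using insert.prems insert.hyps T by simp
    from insert.IH[OF T(3) this, of "\<lambda>s y. g s y - g s x / g s0 x * g s0 y"]
    obtain u where u: "\<exists>s\<in>T'. u s \<noteq> 0"
      "\<And>y. y \<in> X \<Longrightarrow> (\<Sum>s\<in>T'. u s * (g s y - g s x / g s0 x * g s0 y)) = 0" by blast
    define v where "v = u(s0 := - (\<Sum>s\<in>T'. u s * g s x) / g s0 x)"
    have v: "(\<Sum>s\<in>T. v s * g s y) = (\<Sum>s\<in>T'. u s * g s y) + v s0 * g s0 y" for y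
    proof -
      have "(\<Sum>s\<in>T'. v s * g s y) = (\<Sum>s\<in>T'. u s * g s y)"
        using T(2) by (intro sum.cong) (auto simp: v_def)
      then show ?thesis using T by simp
    qed
    have "(\<Sum>s\<in>T. v s * g s x) = 0" using s0 by (simp add: v, simp add: v_def)
    moreover have "(\<Sum>s\<in>T. v s * g s y) = 0" if "y \<in> X" for y
    proof -
      have "0 = (\<Sum>s\<in>T'. u s * g s y - u s * g s x * (g s0 y / g s0 x))"
        using u(2)[OF that] by (simp add: algebra_simps)
      also have "\<dots> = (\<Sum>s\<in>T'. u s * g s y) - (\<Sum>s\<in>T'. u s * g s x) * (g s0 y / g s0 x)"
        by (simp only: sum_subtractf sum_distrib_right)
      also have "\<dots> = (\<Sum>s\<in>T. v s * g s y)" by (simp add: v) (simp add: v_def)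
      finally show ?thesis by simp
    qed
    moreover have "\<exists>s\<in>T. v s \<noteq> 0" using u(1) T by (auto simp: v_def)
    ultimately show ?thesis by blast
  qed
qed

lemma card_le_if_coordinates_independent:
  fixes g :: "'s \<Rightarrow> 'x \<Rightarrow> 'f::field"
  assumes X: "finite X"
    and ind: "\<And>T u. finite T \<Longrightarrow> T \<subseteq> S \<Longrightarrow> (\<And>x. x \<in> X \<Longrightarrow> (\<Sum>s\<in>T. u s * g s x) = 0) \<Longrightarrow> \<forall>s\<in>T. u s = 0"
  shows "finite S \<and> card S \<le> card X"
proof (rule ccontr)
  assume "\<not> ?thesis"
  then obtain T where T: "T \<subseteq> S" "finite T" "card X < card T"
    by (metis infinite_arbitrarily_large lessI not_less order_refl)
  from nontrivial_solution[OF X T(2,3), of g] ind[OF T(2,1)] show False by metis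
qed

lemma nonunital_prod_Cons: "xs \<noteq> [] \<Longrightarrow> nonunital_prod (x # xs) = x * nonunital_prod xs"
  by (cases xs) auto

lemma nonunital_prod_append:
  "xs \<noteq> [] \<Longrightarrow> ys \<noteq> [] \<Longrightarrow> nonunital_prod (xs @ ys) = nonunital_prod xs * nonunital_prod ys"
proof (induction xs)
  case (Cons x xs)
  then show ?case by (cases "xs = []") (auto simp: nonunital_prod_Cons mult.assoc)
qed simp

text \<open>The \<open>(n + 1)\<close>-st power; the shift avoids a unit.\<close>

primrec pow1 :: "'a::ring \<Rightarrow> nat \<Rightarrow> 'a" where
  "pow1 x 0 = x"
| "pow1 x (Suc n) = x * pow1 x n"

lemma pow1_mult: "pow1 x m * pow1 x n = pow1 x (Suc (m + n))"
  by (induction m) (auto simp: mult.assoc)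

lemma pow1_commute: "pow1 x m * pow1 x n = pow1 x n * pow1 x m"
  by (simp add: pow1_mult add.commute)

lemma pow1_mult_swap: "pow1 (x * y) (Suc n) = x * pow1 (y * x) n * y"
  by (induction n) (auto simp: mult.assoc)

locale fd_algebra = assoc_algebra scale + finite_dimensional_vector_space scale Basis
  for scale :: "'f::field \<Rightarrow> 'a::ring \<Rightarrow> 'a" and Basis :: "'a set"
begin

subsection \<open>Coordinates\<close>

definition coord :: "'a \<Rightarrow> 'a \<Rightarrow> 'f" where
  "coord x e = representation Basis x e"

lemma coord_add: "coord (x + y) e = coord x e + coord y e"
  by (simp add: coord_def representation_add[OF independent_Basis] span_Basis)

lemma coord_scale: "coord (scale c x) e = c * coord x e"
  by (simp add: coord_def representation_scale[OF independent_Basis] span_Basis)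

lemma coord_zero [simp]: "coord 0 e = 0"
  by (simp add: coord_def representation_zero)

lemma coord_sum: "coord (\<Sum>i\<in>I. f i) e = (\<Sum>i\<in>I. coord (f i) e)"
  by (induction I rule: infinite_finite_induct) (auto simp: coord_add)

lemma coord_basis: "b \<in> Basis \<Longrightarrow> coord b e = (if e = b then 1 else 0)"
  by (simp add: coord_def representation_basis[OF independent_Basis])

lemma coord_outside: 
  assumes "D \<subseteq> Basis" "x \<in> span D" "e \<notin> D"
  shows "coord x e = 0"
  using assms(2)
proof (induction rule: span_induct_alt)
  case (step c y z)
  have "coord y e = 0" using step(1) assms by (auto simp: coord_basis)
  then show ?case using step by (simp add: coord_add coord_scale)
qed simp

lemma coord_expand:
  assumes "D \<subseteq> Basis" "x \<in> span D"
  shows "x = (\<Sum>e\<in>D. scale (coord x e) e)"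
proof -
  have "x = (\<Sum>e\<in>Basis. scale (coord x e) e)"
    unfolding coord_def
    by (rule sum_representation_eq[OF independent_Basis, symmetric]) (auto simp: span_Basis finite_Basis)
  also have "\<dots> = (\<Sum>e\<in>D. scale (coord x e) e)"
    using coord_outside[OF assms] assms(1) finite_Basis by (intro sum.mono_neutral_right) auto
  finally show ?thesis .
qed

lemma coord_eqI: "(\<And>e. e \<in> Basis \<Longrightarrow> coord x e = coord y e) \<Longrightarrow> x = y"
  using coord_expand[of Basis x] coord_expand[of Basis y] span_Basis by auto

lemma linear_mult_left: "Vector_Spaces.linear scale scale (\<lambda>x. a * x)"
  by unfold_locales (auto simp: distrib_left scale_mult_right scale_right_distrib scale_left_distrib)

lemma linear_mult_right: "Vector_Spaces.linear scale scale (\<lambda>x. x * a)"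
  by unfold_locales (auto simp: distrib_right scale_mult_left scale_right_distrib scale_left_distrib)

lemma linear_expand:
  assumes "Vector_Spaces.linear scale scale T" "D \<subseteq> Basis" "x \<in> span D"
  shows "T x = (\<Sum>e\<in>D. scale (coord x e) (T e))"
proof -
  interpret T: Vector_Spaces.linear scale scale T by fact
  show ?thesis
    by (subst coord_expand[OF assms(2,3)]) (simp add: T.sum T.scale)
qed

subsection \<open>Traces\<close>

definition trace_on :: "'a set \<Rightarrow> ('a \<Rightarrow> 'a) \<Rightarrow> 'f" where
  "trace_on D T = (\<Sum>e\<in>D. coord (T e) e)"

lemma trace_on_comp_commute:
  assumes D: "D \<subseteq> Basis" and S: "Vector_Spaces.linear scale scale S" "S ` span D \<subseteq> span D"
    and T: "Vector_Spaces.linear scale scale T" "T ` span D \<subseteq> span D"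
  shows "trace_on D (\<lambda>x. S (T x)) = trace_on D (\<lambda>x. T (S x))"
proof -
  have "trace_on D (\<lambda>x. S (T x)) = (\<Sum>e\<in>D. \<Sum>c\<in>D. coord (T e) c * coord (S c) e)"
    if "Vector_Spaces.linear scale scale S" "T ` span D \<subseteq> span D" for S T
    unfolding trace_on_def
  proof (rule sum.cong[OF refl])
    fix e assume "e \<in> D"
    then have "T e \<in> span D" using that by (auto intro: span_base)
    then show "coord (S (T e)) e = (\<Sum>c\<in>D. coord (T e) c * coord (S c) e)"
      by (subst linear_expand[OF that(1) D]) (auto simp: coord_sum coord_scale)
  qed
  note expand = this
  show ?thesis
    by (subst expand[OF S(1) T(2)], subst expand[OF T(1) S(2)], subst sum.swap)
      (simp add: mult.commute)
qed

text \<open>In a basis that extends a basis \<open>C\<close> of the image, the diagonal entries of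
  \<open>P\<close> are 1 on \<open>C\<close> and 0 elsewhere.\<close>

lemma trace_on_idempotent:
  assumes D: "D \<subseteq> Basis" and P: "Vector_Spaces.linear scale scale P" "P ` span D \<subseteq> span D"
    and idem: "\<And>x. x \<in> span D \<Longrightarrow> P (P x) = P x"
  shows "trace_on D P = of_nat (dim (P ` span D))"
proof -
  interpret P: Vector_Spaces.linear scale scale P by fact
  obtain C where C: "C \<subseteq> P ` span D" "independent C" "P ` span D \<subseteq> span C" "card C = dim (P ` span D)"
    using basis_exists by metis
  have "C \<subseteq> span D" using C P by blast
  then obtain C' where C': "C \<subseteq> C'" "C' \<subseteq> span D" "independent C'" "span D \<subseteq> span C'"
    using maximal_independent_subset_extend[OF _ C(2)] by metis
  have finC': "finite C'" using C' finiteI_independent by blast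
  have finD: "finite D" using D finite_Basis finite_subset by blast
  define r where "r x c = representation C' x c" for x c
  have rsum: "r (\<Sum>i\<in>D. scale (f i) i) c = (\<Sum>i\<in>D. f i * r i c)" for f c
  proof -
    have in_span: "i \<in> span C'" if "i \<in> D" for i using that C' span_base by blast
    have "I \<subseteq> D \<Longrightarrow> r (\<Sum>i\<in>I. scale (f i) i) c = (\<Sum>i\<in>I. f i * r i c)" for I
    proof (induction I rule: infinite_finite_induct)
      case (insert i I)
      then show ?case unfolding r_def
        by (subst sum.insert, simp, simp, subst representation_add[OF C'(3)])
          (auto simp: representation_scale[OF C'(3)] in_span intro!: span_scale span_sum)
    qed (auto simp: r_def representation_zero)
    then show ?thesis by blast
  qed
  have rexp: "x = (\<Sum>c\<in>C'. scale (r x c) c)" if "x \<in> span D" for x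
    unfolding r_def using that C'
    by (intro sum_representation_eq[OF C'(3), symmetric]) (auto simp: finC')
  have "trace_on D P = (\<Sum>e\<in>D. \<Sum>c\<in>C'. r e c * coord (P c) e)"
    unfolding trace_on_def
  proof (rule sum.cong[OF refl])
    fix e assume e: "e \<in> D"
    have "P e = P (\<Sum>c\<in>C'. scale (r e c) c)"
      using rexp[of e] e by (simp add: span_base)
    then have "P e = (\<Sum>c\<in>C'. scale (r e c) (P c))" by (simp add: P.sum P.scale)
    then show "coord (P e) e = (\<Sum>c\<in>C'. r e c * coord (P c) e)"
      by (simp add: coord_sum coord_scale)
  qed
  also have "\<dots> = (\<Sum>c\<in>C'. \<Sum>e\<in>D. coord (P c) e * r e c)"
    by (subst sum.swap) (simp add: mult.commute)
  also have "\<dots> = (\<Sum>c\<in>C'. r (P c) c)"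
  proof (rule sum.cong[OF refl])
    fix c assume "c \<in> C'"
    then have "P c \<in> span D" using C' P by blast
    from arg_cong[OF coord_expand[OF D this], of "\<lambda>x. r x c"]
    show "(\<Sum>e\<in>D. coord (P c) e * r e c) = r (P c) c"
      by (simp only: rsum)
  qed
  also have "\<dots> = (\<Sum>c\<in>C'. if c \<in> C then 1 else 0)"
  proof (rule sum.cong[OF refl])
    fix c assume c: "c \<in> C'"
    show "r (P c) c = (if c \<in> C then 1 else 0)"
    proof (cases "c \<in> C")
      case True
      then obtain x where "x \<in> span D" "c = P x" using C by blast
      then have "P c = c" using idem by simp
      then show ?thesis using True c by (simp add: r_def representation_basis[OF C'(3)])
    next
      case False
      have "P c \<in> span C" using c C' C by blast
      moreover have "x \<in> span C' \<and> representation C' x c = 0" if "x \<in> span C" for x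
        using that
      proof (induction rule: span_induct_alt)
        case (step a y z)
        have y: "y \<in> C'" "y \<noteq> c" using step(1) C'(1) False by auto
        then have "representation C' y c = 0" by (simp add: representation_basis[OF C'(3)])
        moreover have "y \<in> span C'" using y by (simp add: span_base)
        ultimately show ?case using step(2)
          by (simp add: representation_add[OF C'(3)] representation_scale[OF C'(3)] span_scale span_add)
      qed (simp add: representation_zero span_zero)
      ultimately show ?thesis using False by (simp add: r_def)
    qed
  qed
  also have "\<dots> = of_nat (card C)" using C'(1) finC' by (simp add: sum.If_cases Int_absorb1)
  finally show ?thesis using C(4) by simp
qed

subsection \<open>Nilpotence and the radical\<close>

lemma subspace_stable:
  fixes V :: "nat \<Rightarrow> 'a set"
  assumes "\<And>n. subspace (V n)" "\<And>n. V (Suc n) \<subseteq> V n"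
  obtains k where "\<And>n. n \<ge> k \<Longrightarrow> V n = V k"
proof -
  obtain k where k: "\<And>n. dim (V k) \<le> dim (V n)"
    using ex_has_least_nat[of "\<lambda>_. True" 0 "\<lambda>n. dim (V n)"] by auto
  have "V n \<subseteq> V k" if "n \<ge> k" for n
    using lift_Suc_antimono_le[of V] assms(2) that by blast
  then have "V n = V k" if "n \<ge> k" for n
    using subspace_dim_equal[OF assms(1) assms(1)] k that by blast
  then show thesis using that by blast
qed

text \<open>The spans \<open>V k\<close> of the powers with exponent above \<open>k\<close> become
  stationary. From then on multiplication by a power of \<open>u\<close> maps \<open>V k\<close>
  onto itself, and the element \<open>e\<close> that it maps to this power acts as a unit on
  \<open>V k\<close>.\<close>

lemma nonnilpotent_idempotent:
  assumes "\<And>n. pow1 u n \<noteq> 0"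
  obtains e w where "e * e = e" "e \<noteq> 0" "e = w * u" "e = u * w" "w \<in> span (range (pow1 u))"
proof -
  define V where "V k = span {pow1 u m | m. m \<ge> k}" for k
  have sub: "subspace (V n)" for n by (simp add: V_def)
  have "V (Suc n) \<subseteq> V n" for n unfolding V_def by (intro span_mono) auto
  then obtain k0 where k0: "\<And>n. n \<ge> k0 \<Longrightarrow> V n = V k0" using subspace_stable[of V, OF sub] by metis
  define k where "k = Suc k0"
  have Vk: "V n = V k" if "n \<ge> k" for n using k0[of n] k0[of k] that by (simp add: k_def)
  have mult: "x \<in> (\<lambda>y. pow1 u k * y) ` V k" if "x \<in> V (Suc (k + k))" for x
    using that unfolding V_def[of "Suc (k + k)"]
  proof (induction rule: span_induct_alt)
    case base
    then show ?case using subspace_0[OF sub] by (auto intro!: image_eqI[of _ _ 0])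
  next
    case (step c x y)
    then obtain m where m: "x = pow1 u m" "m \<ge> Suc (k + k)" by blast
    obtain y' where y': "y = pow1 u k * y'" "y' \<in> V k" using step by blast
    have "x = pow1 u k * pow1 u (m - Suc k)" using m by (simp add: pow1_mult)
    moreover have "pow1 u (m - Suc k) \<in> V k" unfolding V_def using m by (intro span_base) auto
    ultimately show ?case using y'
      by (intro image_eqI[of _ _ "scale c (pow1 u (m - Suc k)) + y'"])
        (auto simp: distrib_left scale_mult_right intro!: subspace_add[OF sub] subspace_scale[OF sub])
  qed
  have comm: "x * pow1 u n = pow1 u n * x" if "x \<in> V k" for x n
    using that unfolding V_def
  proof (induction rule: span_induct_alt)
    case (step c x y)
    then show ?case
      by (auto simp: distrib_left distrib_right scale_mult_left[symmetric] scale_mult_right[symmetric] pow1_commute)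
  qed simp
  have "pow1 u k \<in> V k" unfolding V_def by (intro span_base) auto
  then have "pow1 u k \<in> (\<lambda>y. pow1 u k * y) ` V k" using mult Vk[of "Suc (k + k)"] by simp
  then obtain e where e: "e \<in> V k" "pow1 u k = pow1 u k * e" by blast
  then have "e \<in> (\<lambda>y. pow1 u k * y) ` V k" using mult Vk[of "Suc (k + k)"] by simp
  then obtain e' where e': "e' \<in> V k" "e = pow1 u k * e'" by blast
  have "e * e = e' * pow1 u k * e" using comm[OF e'(1), of k] e'(2) by simp
  also have "\<dots> = e' * (pow1 u k * e)" by (simp add: mult.assoc)
  also have "\<dots> = e" using e(2) comm[OF e'(1), of k] e'(2) by simp
  finally have idem: "e * e = e" .
  have nz: "e \<noteq> 0" using e(2) assms[of k] by auto
  define w where "w = pow1 u k0 * e'"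
  have "e = u * w" by (simp add: w_def e'(2) k_def mult.assoc)
  moreover have "e = w * u"
  proof -
    have "w * u = pow1 u k0 * (pow1 u 0 * e')" using comm[OF e'(1), of 0] by (simp add: w_def mult.assoc)
    also have "\<dots> = pow1 u k * e'" using pow1_mult[of u k0 0] by (simp add: mult.assoc[symmetric] k_def)
    finally show ?thesis using e'(2) by simp
  qed
  moreover have "w \<in> span (range (pow1 u))"
  proof -
    have "pow1 u k0 * x \<in> span (range (pow1 u))" if "x \<in> V k" for x
      using that unfolding V_def
    proof (induction rule: span_induct_alt)
      case base
      then show ?case by (simp add: span_zero)
    next
      case (step c x y)
      then obtain m where "x = pow1 u m" by blast
      then have "pow1 u k0 * scale c x \<in> span (range (pow1 u))"
        by (simp add: scale_mult_right[symmetric] pow1_mult span_scale span_base del: pow1.simps)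
      then show ?case using step by (auto simp: distrib_left intro!: span_add)
    qed
    then show ?thesis using e'(1) by (simp add: w_def)
  qed
  ultimately show thesis using that idem nz by blast
qed

text \<open>If \<open>x\<close> were outside a maximal left ideal \<open>M\<close> with modular
  unit \<open>e\<close>, then \<open>e = l + m\<close> with \<open>l \<in> L\<close>. Modulo
  \<open>M\<close> the element \<open>l\<close> is congruent to all of its powers, hence to 0,
  which forces \<open>e \<in> M\<close>.\<close>

lemma nil_left_ideal_subset_radical:
  assumes R: "is_subalgebra scale R" and L: "left_ideal scale R L"
    and nil: "\<And>x. x \<in> L \<Longrightarrow> \<exists>n. pow1 x n = 0"
  shows "L \<subseteq> jacobson_radical scale R"
proof -
  have "x \<in> M" if x: "x \<in> L" and M: "modular_left_ideal scale R M" "maximal_left_ideal scale R M" for x M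
  proof (rule ccontr)
    assume xM: "x \<notin> M"
    obtain e where e: "e \<in> R" "\<And>x. x \<in> R \<Longrightarrow> x - x * e \<in> M"
      using M(1) by (auto simp: modular_left_ideal_def)
    have sM: "subspace M" and MR: "M \<subseteq> R" and mulM: "\<And>r x. r \<in> R \<Longrightarrow> x \<in> M \<Longrightarrow> r * x \<in> M"
      using M(1) by (auto simp: modular_left_ideal_def left_ideal_def)
    have sL: "subspace L" and LR: "L \<subseteq> R" and mulL: "\<And>r x. r \<in> R \<Longrightarrow> x \<in> L \<Longrightarrow> r * x \<in> L"
      using L by (auto simp: left_ideal_def)
    have sR: "subspace R" using R by (simp add: is_subalgebra_def)
    define LM where "LM = {l + m | l m. l \<in> L \<and> m \<in> M}"
    have "left_ideal scale R LM"
      unfolding left_ideal_def LM_def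
    proof (intro conjI ballI)
      show "subspace {l + m | l m. l \<in> L \<and> m \<in> M}" by (rule subspace_sums[OF sL sM])
      show "{l + m | l m. l \<in> L \<and> m \<in> M} \<subseteq> R" using LR MR subspace_add[OF sR] by auto
      fix r y assume "r \<in> R" "y \<in> {l + m | l m. l \<in> L \<and> m \<in> M}"
      then show "r * y \<in> {l + m | l m. l \<in> L \<and> m \<in> M}"
        using mulL mulM by (auto simp: distrib_left) blast
    qed
    moreover have "M \<subseteq> LM" using subspace_0[OF sL] by (force simp: LM_def)
    moreover have "x \<in> LM" using x subspace_0[OF sM] by (force simp: LM_def)
    ultimately have "LM = R" using M(2) xM by (auto simp: maximal_left_ideal_def)
    then obtain l m where lm: "e = l + m" "l \<in> L" "m \<in> M" using e(1) by (auto simp: LM_def)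
    have lR: "l \<in> R" using lm LR by blast
    have "l - l * l - l * m \<in> M" using e(2)[OF lR] by (simp add: lm(1) distrib_left algebra_simps)
    from subspace_add[OF sM this mulM[OF lR lm(3)]] have ll: "l - l * l \<in> M" by simp
    have "l - pow1 l n \<in> M" for n
    proof (induction n)
      case 0
      then show ?case using subspace_0[OF sM] by simp
    next
      case (Suc n)
      from subspace_add[OF sM ll mulM[OF lR Suc]] show ?case by (simp add: right_diff_distrib)
    qed
    moreover obtain n where "pow1 l n = 0" using nil[OF lm(2)] by blast
    ultimately have "l \<in> M" by (metis diff_zero)
    then have eM: "e \<in> M" using lm subspace_add[OF sM] by simp
    have "r \<in> M" if "r \<in> R" for r
      using subspace_add[OF sM e(2)[OF that] mulM[OF that eM]] by simp
    then have "M = R" using MR by blast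
    then show False using M(2) by (simp add: maximal_left_ideal_def)
  qed
  moreover have "L \<subseteq> R" using L by (simp add: left_ideal_def)
  ultimately show ?thesis by (auto simp: jacobson_radical_def)
qed

lemma subspace_UNIV': "subspace UNIV" by (simp add: subspace_def)

lemma radical_subspace: "subspace (jacobson_radical scale UNIV)"
  unfolding jacobson_radical_def
  by (auto simp: subspace_def modular_left_ideal_def left_ideal_def)

lemma radical_left: "x \<in> jacobson_radical scale UNIV \<Longrightarrow> a * x \<in> jacobson_radical scale UNIV"
  unfolding jacobson_radical_def
  by (auto simp: modular_left_ideal_def left_ideal_def)

text \<open>A non-nilpotent \<open>x\<close> in the radical would produce an idempotent \<open>e
  \<noteq> 0\<close> in the radical. But a left ideal of maximal dimension among those that
  contain all \<open>a - a e\<close> and omit \<open>e\<close> is a maximal modular left ideal.\<close>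

lemma radical_nil:
  assumes x: "x \<in> jacobson_radical scale UNIV"
  shows "\<exists>n. pow1 x n = 0"
proof (rule ccontr)
  assume "\<not> ?thesis"
  then obtain e w where e: "e * e = e" "e \<noteq> 0" "e = w * x"
    using nonnilpotent_idempotent[of x] by metis
  have eJ: "e \<in> jacobson_radical scale UNIV" using radical_left[OF x] e(3) by simp
  define L0 where "L0 = range (\<lambda>a. a - a * e)"
  define ok where "ok L \<longleftrightarrow> left_ideal scale UNIV L \<and> L0 \<subseteq> L \<and> e \<notin> L" for L
  have "left_ideal scale UNIV L0"
    unfolding left_ideal_def L0_def
  proof (intro conjI ballI)
    show "subspace (range (\<lambda>a. a - a * e))"
    proof (rule subspaceI)
      show "0 \<in> range (\<lambda>a. a - a * e)" by (auto intro!: image_eqI[of _ _ 0])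
      show "x + y \<in> range (\<lambda>a. a - a * e)" if "x \<in> range (\<lambda>a. a - a * e)" "y \<in> range (\<lambda>a. a - a * e)" for x y
      proof -
        from that obtain a b where "x = a - a * e" "y = b - b * e" by auto
        then have "x + y = (a + b) - (a + b) * e" by (simp add: distrib_right)
        then show ?thesis by blast
      qed
      show "scale c x \<in> range (\<lambda>a. a - a * e)" if "x \<in> range (\<lambda>a. a - a * e)" for c x
      proof -
        from that obtain a where "x = a - a * e" by auto
        then show ?thesis
          by (auto intro!: image_eqI[of _ _ "scale c a"] simp: scale_right_diff_distrib scale_mult_left)
      qed
    qed
    fix r y assume "y \<in> range (\<lambda>a. a - a * e)"
    then obtain a where "y = a - a * e" by auto
    then have "r * y = r * a - (r * a) * e" by (simp add: right_diff_distrib mult.assoc)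
    then show "r * y \<in> range (\<lambda>a. a - a * e)" by blast
  qed auto
  moreover have "e \<notin> L0"
  proof
    assume "e \<in> L0"
    then obtain a where "e = a - a * e" by (auto simp: L0_def)
    then have "e * e = (a - a * e) * e" by simp
    then have "e * e = 0" using e(1) by (simp add: left_diff_distrib mult.assoc)
    then show False using e by simp
  qed
  ultimately have "ok L0" by (simp add: ok_def)
  moreover have "\<forall>L. ok L \<longrightarrow> dim L < Suc (dim (UNIV :: 'a set))"
    by (metis dim_subset subset_UNIV le_imp_less_Suc)
  ultimately obtain M where M: "ok M" "\<And>L. ok L \<Longrightarrow> dim L \<le> dim M"
    using ex_has_greatest_nat[of ok L0 dim "Suc (dim (UNIV :: 'a set))"] by metis
  have Ml: "left_ideal scale UNIV M" and L0M: "L0 \<subseteq> M" and eM: "e \<notin> M" using M(1) by (auto simp: ok_def)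
  have mod: "modular_left_ideal scale UNIV M"
    using Ml L0M by (auto simp: modular_left_ideal_def L0_def)
  have "maximal_left_ideal scale UNIV M"
    unfolding maximal_left_ideal_def
  proof (intro conjI allI impI)
    show "M \<noteq> UNIV" using eM by blast
    fix L assume L: "left_ideal scale UNIV L" "M \<subseteq> L"
    show "L = M \<or> L = UNIV"
    proof (cases "e \<in> L")
      case True
      have "a \<in> L" for a
      proof -
        have "a - a * e \<in> L" using L L0M by (auto simp: L0_def)
        moreover have "a * e \<in> L" using True L by (auto simp: left_ideal_def)
        ultimately have "a - a * e + a * e \<in> L" using L by (meson left_ideal_def subspace_add)
        then show ?thesis by simp
      qed
      then show ?thesis by auto
    next
      case False
      then have "ok L" using L L0M by (auto simp: ok_def)
      then have "M = L" using subspace_dim_equal[of M L] L Ml M(2)[of L] by (auto simp: left_ideal_def)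
      then show ?thesis by simp
    qed
  qed (fact Ml)
  with mod have "e \<in> M" using eJ by (auto simp: jacobson_radical_def)
  then show False using eM by simp
qed

lemma UNIV_subalgebra: "is_subalgebra scale UNIV"
  by (simp add: is_subalgebra_def subspace_UNIV')

text \<open>The left ideal of all \<open>y a\<close> with \<open>y\<close> in the radical is nil,
  because \<open>a y\<close> is nilpotent.\<close>

lemma radical_right:
  assumes x: "x \<in> jacobson_radical scale UNIV"
  shows "x * a \<in> jacobson_radical scale UNIV"
proof -
  let ?J = "jacobson_radical scale UNIV"
  interpret R: Vector_Spaces.linear scale scale "\<lambda>y. y * a" by (rule linear_mult_right)
  have "left_ideal scale UNIV ((\<lambda>y. y * a) ` ?J)"
    unfolding left_ideal_def
  proof (intro conjI ballI)
    show "subspace ((\<lambda>y. y * a) ` ?J)" by (rule R.subspace_image[OF radical_subspace])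
    fix r y assume "y \<in> (\<lambda>y. y * a) ` ?J"
    then show "r * y \<in> (\<lambda>y. y * a) ` ?J" using radical_left by (auto simp: mult.assoc[symmetric])
  qed auto
  moreover have "\<exists>n. pow1 y n = 0" if "y \<in> (\<lambda>y. y * a) ` ?J" for y
  proof -
    from that obtain z where z: "y = z * a" "z \<in> ?J" by blast
    obtain n where "pow1 (a * z) n = 0" using radical_nil[OF radical_left[OF z(2)]] by blast
    then have "pow1 y (Suc n) = 0" unfolding z(1) pow1_mult_swap by simp
    then show ?thesis ..
  qed
  ultimately show ?thesis using nil_left_ideal_subset_radical[OF UNIV_subalgebra] x by blast
qed

text \<open>The step of Engel's theorem. In a minimal submodule \<open>I\<close> strictly above
  \<open>W\<close> pick \<open>a \<notin> W\<close>. If \<open>J a + W\<close> were all of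
  \<open>I\<close>, then \<open>a\<close> would be congruent to \<open>z a\<close> modulo
  \<open>W\<close> for some \<open>z \<in> J\<close>, hence to \<open>z\<^sup>n a = 0\<close>.\<close>

lemma nil_left_ideal_lowers:
  assumes J: "subspace J" "\<And>a x. x \<in> J \<Longrightarrow> a * x \<in> J"
    and nil: "\<And>x. x \<in> J \<Longrightarrow> \<exists>n. pow1 x n = 0"
    and W: "subspace W" "\<And>x w. x \<in> J \<Longrightarrow> w \<in> W \<Longrightarrow> x * w \<in> W" "W \<noteq> UNIV"
  obtains a where "a \<notin> W" "\<And>x. x \<in> J \<Longrightarrow> x * a \<in> W"
proof -
  define ok where "ok I \<longleftrightarrow> subspace I \<and> W \<subseteq> I \<and> W \<noteq> I \<and> (\<forall>x\<in>J. \<forall>w\<in>I. x * w \<in> I)" for I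
  have "ok UNIV" using W by (auto simp: ok_def subspace_UNIV')
  then obtain I where I: "ok I" "\<And>I'. ok I' \<Longrightarrow> dim I \<le> dim I'"
    using ex_has_least_nat[of ok UNIV dim] by blast
  then obtain a where a: "a \<in> I" "a \<notin> W" by (auto simp: ok_def)
  interpret R: Vector_Spaces.linear scale scale "\<lambda>y. y * a" by (rule linear_mult_right)
  define I' where "I' = {y + w | y w. y \<in> (\<lambda>x. x * a) ` J \<and> w \<in> W}"
  have sI': "subspace I'" unfolding I'_def by (intro subspace_sums R.subspace_image J W)
  have sI: "subspace I" using I by (simp add: ok_def)
  have JI: "x * y \<in> I'" if "x \<in> J" "y \<in> I'" for x y
  proof -
    from that obtain z w where "y = z * a + w" "z \<in> J" "w \<in> W" by (auto simp: I'_def)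
    then show ?thesis using that J W by (auto simp: I'_def distrib_left mult.assoc[symmetric]) blast
  qed
  have I'I: "I' \<subseteq> I" using I a subspace_add[OF sI] by (auto simp: I'_def ok_def)
  have WI': "W \<subseteq> I'" using subspace_0[OF J(1)] by (force simp: I'_def)
  have "a \<notin> I'"
  proof
    assume "a \<in> I'"
    then obtain y w where "a = y + w" "y \<in> (\<lambda>x. x * a) ` J" "w \<in> W" unfolding I'_def by blast
    moreover from this(2) obtain z where "z \<in> J" "y = z * a" by (elim imageE) auto
    ultimately have "\<exists>z w. a = z * a + w \<and> z \<in> J \<and> w \<in> W" by metis
    then obtain z w where zw: "a = z * a + w" "z \<in> J" "w \<in> W" by metis
    have 1: "a - z * a \<in> W" using zw by (metis add_diff_cancel_left')
    have "a - pow1 z n * a \<in> W" for n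
    proof (induction n)
      case 0
      then show ?case using 1 by simp
    next
      case (Suc n)
      from subspace_add[OF W(1) 1 W(2)[OF zw(2) Suc]] show ?case
        by (simp add: right_diff_distrib mult.assoc)
    qed
    moreover obtain n where "pow1 z n = 0" using nil[OF zw(2)] by blast
    ultimately have "a \<in> W" by (metis diff_zero mult_zero_left)
    then show False using a by simp
  qed
  then have "I' \<noteq> I" using a by blast
  then have "\<not> ok I'" using I(2)[of I'] subspace_dim_equal[OF sI' sI I'I] by blast
  then have "I' = W" using sI' WI' JI by (auto simp: ok_def)
  moreover have "x * a \<in> I'" if "x \<in> J" for x using that subspace_0[OF W(1)] by (force simp: I'_def)
  ultimately show thesis using that a by blast
qed

text \<open>Let \<open>W n\<close> be the space annihilated from the left by all products of
  \<open>n\<close> elements of \<open>J\<close>. By the previous lemma this chain grows strictly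
  until it is all of \<open>A\<close>, and left multiplication by an element of \<open>J\<close>
  lowers the index. The statement counts the factors from \<open>J\<close> wherever they stand in
  the product.\<close>

lemma radical_nilpotent:
  defines "J \<equiv> jacobson_radical scale UNIV"
  obtains p where "\<And>zs. p \<le> length (filter (\<lambda>z. z \<in> J) zs) \<Longrightarrow> nonunital_prod zs = 0"
proof -
  note J = radical_subspace radical_left radical_right radical_nil
  define W where "W n = ((\<lambda>V. {v. \<forall>x\<in>J. x * v \<in> V}) ^^ n) {0}" for n
  have W0: "W 0 = {0}" and WSuc: "W (Suc n) = {v. \<forall>x\<in>J. x * v \<in> W n}" for n
    by (auto simp: W_def)
  have sub: "subspace (W n)" for n
  proof (induction n)
    case (Suc n)
    then show ?case unfolding WSuc
      by (auto simp: subspace_def distrib_left scale_mult_right[symmetric])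
  qed (simp add: W0)
  have mult: "a * v \<in> W n" if "v \<in> W n" for a v n
    using that J(3) by (cases n) (auto simp: W0 WSuc mult.assoc[symmetric] J_def)
  have mono: "W n \<subseteq> W (Suc n)" for n using mult by (auto simp: WSuc)
  have grow: "\<exists>n. dim (W n) \<ge> k \<or> W n = UNIV" for k
  proof (induction k)
    case (Suc k)
    then obtain n where n: "dim (W n) \<ge> k \<or> W n = UNIV" by blast
    show ?case
    proof (cases "W n = UNIV")
      case False
      obtain a where "a \<notin> W n" "\<And>x. x \<in> J \<Longrightarrow> x * a \<in> W n"
        using nil_left_ideal_lowers[of J "W n"] J sub mult False unfolding J_def by metis
      then have "W n \<subset> W (Suc n)" using mono by (auto simp: WSuc)
      then have "dim (W n) < dim (W (Suc n))" using dim_psubset sub by (metis span_eq_iff)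
      then show ?thesis using n False by (intro exI[of _ "Suc n"]) auto
    qed auto
  qed auto
  obtain m where "dim (W m) \<ge> Suc (dim (UNIV :: 'a set)) \<or> W m = UNIV" using grow by blast
  moreover have "dim (W m) \<le> dim (UNIV :: 'a set)" by (intro dim_subset) auto
  ultimately have m: "W m = UNIV" by linarith
  have lower: "zs \<noteq> [] \<Longrightarrow> length (filter (\<lambda>z. z \<in> J) zs) \<le> Suc m \<Longrightarrow> 
      nonunital_prod zs \<in> W (Suc m - length (filter (\<lambda>z. z \<in> J) zs))" for zs
  proof (induction zs)
    case (Cons z zs)
    show ?case
    proof (cases "zs = []")
      case True
      have "z \<in> W (Suc m)" using mono[of m] m by auto
      then show ?thesis using True m by simp
    next
      case False
      have IH: "nonunital_prod zs \<in> W (Suc m - length (filter (\<lambda>z. z \<in> J) zs))"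
        using Cons False by (auto split: if_splits)
      show ?thesis
      proof (cases "z \<in> J")
        case True
        then obtain k where k: "Suc m - length (filter (\<lambda>z. z \<in> J) zs) = Suc k"
            "Suc m - length (filter (\<lambda>z. z \<in> J) (z # zs)) = k"
          using Cons.prems by (cases "Suc m - length (filter (\<lambda>z. z \<in> J) zs)") auto
        then show ?thesis using IH True False by (simp only: k) (auto simp: WSuc nonunital_prod_Cons)
      next
        case False
        then show ?thesis using IH \<open>zs \<noteq> []\<close> mult by (simp add: nonunital_prod_Cons)
      qed
    qed
  qed simp
  have "zs \<noteq> [] \<Longrightarrow> length (filter (\<lambda>z. z \<in> J) zs) \<ge> Suc m \<Longrightarrow> nonunital_prod zs = 0" for zs
  proof (induction zs)
    case (Cons z zs)
    show ?case
    proof (cases "length (filter (\<lambda>z. z \<in> J) (z # zs)) = Suc m")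
      case True
      then show ?thesis using lower[of "z # zs"] W0 by simp
    next
      case False
      then have "length (filter (\<lambda>z. z \<in> J) zs) \<ge> Suc m" using Cons.prems by (auto split: if_splits)
      moreover from this have "zs \<noteq> []" by auto
      ultimately show ?thesis using Cons.IH by (simp add: nonunital_prod_Cons)
    qed
  qed simp
  then show thesis using that[of "Suc m"] by (metis filter.simps(1) list.size(3) nonunital_prod.simps(1))
qed

end

section \<open>Multilinear functions and codimensions\<close>

text \<open>Updates \<open>a(i := x)\<close> are kept folded, so that multilinearity can be
  applied by rewriting.\<close>

declare fun_upd_apply [simp del] fun_upd_same [simp] fun_upd_other [simp]

context generalized_action
begin

definition monomial :: "('i \<times> 'h) list \<Rightarrow> ('i \<Rightarrow> 'a) \<Rightarrow> 'a" where
  "monomial ws a = nonunital_prod (map (\<lambda>(i, h). act h (a i)) ws)"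

text \<open>The span of the \<open>H\<close>-monomials in which each variable of \<open>I\<close>
  occurs exactly once, as functions of the values of the variables. The index type is arbitrary,
  so that variables of different origin can be kept apart by sum types.\<close>

inductive multilin :: "'i set \<Rightarrow> (('i \<Rightarrow> 'a) \<Rightarrow> 'a) \<Rightarrow> bool" for I where
  monomial: "ws \<noteq> [] \<Longrightarrow> distinct (map fst ws) \<Longrightarrow> set (map fst ws) = I \<Longrightarrow> multilin I (monomial ws)"
| zero: "multilin I (\<lambda>_. 0)"
| add: "multilin I f \<Longrightarrow> multilin I g \<Longrightarrow> multilin I (\<lambda>a. f a + g a)"
| scale: "multilin I f \<Longrightarrow> multilin I (\<lambda>a. sA c (f a))"

lemma act_plus: "act h (x + y) = act h x + act h y"
proof -
  interpret Vector_Spaces.linear sA sA "act h" by (rule act_linear)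
  show ?thesis by (rule add)
qed

lemma act_sA: "act h (sA c x) = sA c (act h x)"
proof -
  interpret Vector_Spaces.linear sA sA "act h" by (rule act_linear)
  show ?thesis by (rule scale)
qed

lemma act_0 [simp]: "act h 0 = 0"
  using act_sA[of h 0 0] by simp

lemma act_zero_left [simp]: "act 0 a = 0"
  using act_scale[of 0 0 a] by simp

lemma act_sum: "act (\<Sum>i\<in>I. f i) a = (\<Sum>i\<in>I. act (f i) a)"
  by (induction I rule: infinite_finite_induct) (auto simp: act_add)

lemma monomial_Cons: "ws \<noteq> [] \<Longrightarrow> monomial ((i, h) # ws) a = act h (a i) * monomial ws a"
  by (simp add: monomial_def nonunital_prod_Cons)

lemma monomial_single: "monomial [(i, h)] a = act h (a i)"
  by (simp add: monomial_def)

lemma monomial_append: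
  "ws \<noteq> [] \<Longrightarrow> vs \<noteq> [] \<Longrightarrow> monomial (ws @ vs) a = monomial ws a * monomial vs a"
  by (simp add: monomial_def nonunital_prod_append)

lemma monomial_cong: "(\<And>i. i \<in> set (map fst ws) \<Longrightarrow> a i = b i) \<Longrightarrow> monomial ws a = monomial ws b"
  unfolding monomial_def by (intro arg_cong[of _ _ nonunital_prod]) force

lemma multilin_var: "multilin {i} (\<lambda>a. act h (a i))"
  using multilin.monomial[of "[(i, h)]" "{i}"] by (simp add: monomial_single[abs_def])

lemma multilin_id: "multilin {i} (\<lambda>a. a i)"
  using multilin_var[of i 1] by (simp add: act_one)

lemma multilin_sum: "(\<And>s. s \<in> S \<Longrightarrow> multilin I (f s)) \<Longrightarrow> multilin I (\<lambda>a. \<Sum>s\<in>S. f s a)"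
  by (induction S rule: infinite_finite_induct) (auto intro: multilin.intros)

lemma multilin_sum_list: "(\<And>s. s \<in> set S \<Longrightarrow> multilin I (f s)) \<Longrightarrow> multilin I (\<lambda>a. \<Sum>s\<leftarrow>S. f s a)"
  by (induction S) (auto intro: multilin.intros)

lemma multilin_mult:
  assumes f: "multilin I f" and g: "multilin I' g" and disj: "I \<inter> I' = {}"
  shows "multilin (I \<union> I') (\<lambda>a. f a * g a)"
  using f
proof induction
  case (monomial ws)
  note ws = this
  show ?case using g
  proof induction
    case (monomial vs)
    then have "multilin (I \<union> I') (monomial (ws @ vs))"
      using ws disj by (intro multilin.monomial) auto
    moreover have "monomial (ws @ vs) = (\<lambda>a. monomial ws a * monomial vs a)"
      using ws monomial by (intro ext monomial_append) auto
    ultimately show ?case by simp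
  next
    case (add f g)
    then show ?case by (auto simp: distrib_left intro: multilin.add)
  qed (auto simp: A.scale_mult_right[symmetric] intro: multilin.intros)
next
  case (add f g)
  then show ?case by (auto simp: distrib_right intro: multilin.add)
qed (auto simp: A.scale_mult_left[symmetric] intro: multilin.intros)

text \<open>The generalized Leibniz rule moves an operator of \<open>H\<close> from a product to
  the factors, possibly interchanging them, which stays within multilinear monomials.\<close>

lemma multilin_act: "multilin I f \<Longrightarrow> multilin I (\<lambda>a. act h (f a))"
proof (induction rule: multilin.induct)
  case (monomial ws)
  show ?case using monomial
  proof (induction ws arbitrary: I h)
    case (Cons w ws)
    obtain i k where w: "w = (i, k)" by force
    show ?case
    proof (cases "ws = []")
      case True
      then have "I = {i}" using Cons.prems w by simp
      moreover have "act h (monomial (w # ws) a) = act (h * k) (a i)" for a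
        by (simp add: True w monomial_single act_mult)
      ultimately show ?thesis by (simp add: multilin_var)
    next
      case False
      obtain hs where hs: "\<And>x y. act h (x * y) =
          (\<Sum>(h1, h2, h3, h4)\<leftarrow>hs. act h1 x * act h2 y + act h3 y * act h4 x)"
        using act_prod[of h] by blast
      let ?I = "set (map fst ws)"
      have I: "I = insert i ?I" "i \<notin> ?I" "distinct (map fst ws)" using Cons.prems w by auto
      have IH: "multilin ?I (\<lambda>a. act h' (monomial ws a))" for h'
        using Cons.IH[of ?I h'] False I by simp
      have "multilin I (\<lambda>a. \<Sum>(h1, h2, h3, h4)\<leftarrow>hs. act (h1 * k) (a i) * act h2 (monomial ws a)
          + act h3 (monomial ws a) * act (h4 * k) (a i))"
        unfolding case_prod_beta
      proof (intro multilin_sum_list multilin.add)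
        fix q :: "'h \<times> 'h \<times> 'h \<times> 'h"
        show "multilin I (\<lambda>a. act (fst q * k) (a i) * act (fst (snd q)) (monomial ws a))"
          using multilin_mult[OF multilin_var IH, of i] I by (simp add: insert_commute)
        show "multilin I (\<lambda>a. act (fst (snd (snd q))) (monomial ws a) * act (snd (snd (snd q)) * k) (a i))"
          using multilin_mult[OF IH multilin_var, of i] I by simp
      qed
      then show ?thesis using False by (simp add: w monomial_Cons hs act_mult)
    qed
  qed simp
qed (auto simp: act_plus act_sA intro: multilin.intros)

lemma multilin_subst:
  assumes f: "multilin I f" and g: "multilin I' g" and disj: "(I - {i}) \<inter> I' = {}" and i: "i \<in> I"
  shows "multilin ((I - {i}) \<union> I') (\<lambda>a. f (a(i := g a)))"
  using f
proof induction
  case (monomial ws)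
  have "multilin ((set (map fst ws) - {i}) \<union> I') (\<lambda>a. monomial ws (a(i := g a)))"
    if "ws \<noteq> []" "distinct (map fst ws)" "(set (map fst ws) - {i}) \<inter> I' = {}" "i \<in> set (map fst ws)" for ws
    using that
  proof (induction ws)
    case (Cons w ws)
    obtain j h where w: "w = (j, h)" by force
    show ?case
    proof (cases "ws = []")
      case True
      then have "j = i" using Cons.prems w by simp
      then show ?thesis using True w multilin_act[OF g] by (simp add: monomial_single)
    next
      case False
      let ?I = "set (map fst ws)"
      have j: "j \<notin> ?I" "distinct (map fst ws)" using Cons.prems w by auto
      show ?thesis
      proof (cases "j = i")
        case True
        have "monomial ws (a(i := x)) = monomial ws a" for a x
          using j True by (intro monomial_cong) (auto simp: fun_upd_apply)
        moreover have "multilin (I' \<union> ?I) (\<lambda>a. act h (g a) * monomial ws a)"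
          using Cons.prems j False True w by (intro multilin_mult multilin_act g multilin.monomial) auto
        moreover have "(set (map fst (w # ws)) - {i}) \<union> I' = I' \<union> ?I" using j True w by auto
        ultimately show ?thesis using True False
          by (simp add: w monomial_Cons)
      next
        case ji: False
        have "multilin ({j} \<union> ((?I - {i}) \<union> I')) (\<lambda>a. act h (a j) * monomial ws (a(i := g a)))"
          using Cons ji w j False by (intro multilin_mult multilin_var) auto
        moreover have "(set (map fst (w # ws)) - {i}) \<union> I' = {j} \<union> ((?I - {i}) \<union> I')" using ji w by auto
        ultimately show ?thesis using ji False by (simp add: w monomial_Cons)
      qed
    qed
  qed simp
  then show ?case using monomial disj i by blast
qed (auto intro: multilin.intros)

lemma multilin_rename:
  assumes "multilin I f" "inj_on \<rho> I"
  shows "multilin (\<rho> ` I) (\<lambda>a. f (\<lambda>i. a (\<rho> i)))"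
  using assms(1)
proof induction
  case (monomial ws)
  have "monomial ws (\<lambda>i. a (\<rho> i)) = monomial (map (map_prod \<rho> id) ws) a" for a
    unfolding monomial_def by (intro arg_cong[of _ _ nonunital_prod]) auto
  moreover have "map fst (map (map_prod \<rho> id) ws) = map \<rho> (map fst ws)" by simp
  then have "multilin (\<rho> ` I) (monomial (map (map_prod \<rho> id) ws))"
    using monomial assms(2) by (intro multilin.monomial) (auto simp: distinct_map comp_inj_on image_image[symmetric])
  ultimately show ?case by simp
qed (auto intro: multilin.intros)

lemma multilin_cong: "multilin I f \<Longrightarrow> (\<And>i. i \<in> I \<Longrightarrow> a i = b i) \<Longrightarrow> f a = f b"
proof (induction rule: multilin.induct)
  case (monomial ws)
  then show ?case by (intro monomial_cong) simp
qed simp_all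

lemma multilin_linear:
  assumes "multilin I f" "i \<in> I"
  shows multilin_linear_add: "f (a(i := x + y)) = f (a(i := x)) + f (a(i := y))"
    and multilin_linear_scale: "f (a(i := sA c x)) = sA c (f (a(i := x)))"
proof -
  have "f (a(i := x + y)) = f (a(i := x)) + f (a(i := y)) \<and> f (a(i := sA c x)) = sA c (f (a(i := x)))"
    using assms(1)
  proof induction
    case (monomial ws)
    have "monomial ws (a(i := x + y)) = monomial ws (a(i := x)) + monomial ws (a(i := y)) \<and>
        monomial ws (a(i := sA c x)) = sA c (monomial ws (a(i := x)))"
      if "distinct (map fst ws)" "i \<in> set (map fst ws)" for ws
      using that
    proof (induction ws)
      case (Cons w ws)
      obtain j h where w: "w = (j, h)" by force
      show ?case
      proof (cases "ws = []")
        case True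
        then show ?thesis using Cons.prems w by (simp add: monomial_single act_plus act_sA)
      next
        case False
        show ?thesis
        proof (cases "j = i")
          case True
          then have i: "i \<notin> set (map fst ws)" using Cons.prems w by auto
          have "monomial ws (a(i := z)) = monomial ws a" for z
            using i by (intro monomial_cong) (auto simp: fun_upd_apply)
          then show ?thesis using True False w
            by (simp add: monomial_Cons act_plus act_sA distrib_right A.scale_mult_left)
        next
          case ji: False
          then have IH: "monomial ws (a(i := x + y)) = monomial ws (a(i := x)) + monomial ws (a(i := y))"
            "monomial ws (a(i := sA c x)) = sA c (monomial ws (a(i := x)))"
            using Cons w by auto
          show ?thesis using ji False w
            by (simp add: monomial_Cons IH distrib_left A.scale_mult_right)
        qed
      qed
    qed simp
    then show ?case using monomial assms(2) by blast
  qed (auto simp: A.scale_right_distrib mult.commute)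
  then show "f (a(i := x + y)) = f (a(i := x)) + f (a(i := y))" "f (a(i := sA c x)) = sA c (f (a(i := x)))"
    by auto
qed

lemma multilin_linear_sum:
  assumes "multilin I f" "i \<in> I"
  shows "f (a(i := (\<Sum>s\<in>S. sA (c s) (x s)))) = (\<Sum>s\<in>S. sA (c s) (f (a(i := x s))))"
proof (induction S rule: infinite_finite_induct)
  case (insert s S)
  then show ?case
    by (simp add: multilin_linear_add[OF assms] multilin_linear_scale[OF assms])
next
  case empty
  show ?case using multilin_linear_scale[OF assms, of a 0 0] by simp
next
  case (infinite S)
  then show ?case using multilin_linear_scale[OF assms, of a 0 0] by simp
qed

end

subsection \<open>Evaluation of \<open>H\<close>-polynomials\<close>

lemma hpoly_scale_single: "hpoly_scale c (Poly_Mapping.single w d) = Poly_Mapping.single w (c * d)"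
  by (simp add: hpoly_scale_def mult_single)

lemma hpoly_vector_space: "vector_space (hpoly_scale :: 'f::field \<Rightarrow> ('f, 'h) hpoly \<Rightarrow> _)"
proof
  fix a b :: 'f and x y :: "('f, 'h) hpoly"
  show "hpoly_scale a (x + y) = hpoly_scale a x + hpoly_scale a y"
    by (simp add: hpoly_scale_def distrib_left)
  show "hpoly_scale (a + b) x = hpoly_scale a x + hpoly_scale b x"
    by (simp add: hpoly_scale_def distrib_right single_add)
  show "hpoly_scale a (hpoly_scale b x) = hpoly_scale (a * b) x"
    by (simp add: hpoly_scale_def mult.assoc[symmetric] mult_single)
  show "hpoly_scale 1 x = x"
    by (simp add: hpoly_scale_def)
qed

lemma hpoly_expand:
  fixes f :: "('f::field, 'h) hpoly"
  shows "f = (\<Sum>w\<in>Poly_Mapping.keys f. Poly_Mapping.single w (Poly_Mapping.lookup f w))"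
  by (rule poly_mapping_eqI)
    (auto simp: lookup_sum lookup_single when_def in_keys_iff sum.delta)

locale fd_action = generalized_action sH sA act +
  HB: finite_dimensional_vector_space sH \<Gamma> +
  A: fd_algebra sA E
  for sH :: "'f::field \<Rightarrow> 'h::ring_1 \<Rightarrow> 'h"
    and sA :: "'f \<Rightarrow> 'a::ring \<Rightarrow> 'a"
    and act :: "'h \<Rightarrow> 'a \<Rightarrow> 'a" and \<Gamma> :: "'h set" and E :: "'a set"
begin

sublocale P: vector_space "hpoly_scale :: 'f \<Rightarrow> ('f, 'h) hpoly \<Rightarrow> ('f, 'h) hpoly"
  by (rule hpoly_vector_space)

abbreviation ev :: "(nat \<Rightarrow> 'a) \<Rightarrow> ('f, 'h) hpoly \<Rightarrow> 'a" where
  "ev a f \<equiv> hpoly_eval sA act a f"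

definition word_val :: "(nat \<Rightarrow> 'a) \<Rightarrow> (nat \<times> 'h) free_monoid \<Rightarrow> 'a" where
  "word_val a w = monomial (letters w) a"

lemma ev_superset:
  assumes "finite K" "Poly_Mapping.keys f \<subseteq> K"
  shows "ev a f = (\<Sum>w\<in>K. sA (Poly_Mapping.lookup f w) (word_val a w))"
  unfolding hpoly_eval_def word_val_def monomial_def
  by (rule sum.mono_neutral_left) (use assms in \<open>auto simp: in_keys_iff\<close>)

lemma ev_add: "ev a (f + g) = ev a f + ev a g"
proof -
  let ?K = "Poly_Mapping.keys f \<union> Poly_Mapping.keys g"
  have "ev a (f + g) = (\<Sum>w\<in>?K. sA (Poly_Mapping.lookup (f + g) w) (word_val a w))"
    by (rule ev_superset) (auto simp: keys_add)
  also have "\<dots> = ev a f + ev a g"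
    by (subst (1 2) ev_superset[of ?K]) (auto simp: lookup_add A.scale_left_distrib sum.distrib)
  finally show ?thesis .
qed

lemma ev_zero [simp]: "ev a 0 = 0"
  by (simp add: hpoly_eval_def)

lemma ev_sum: "ev a (\<Sum>i\<in>I. f i) = (\<Sum>i\<in>I. ev a (f i))"
  by (induction I rule: infinite_finite_induct) (auto simp: ev_add)

lemma ev_single: "ev a (Poly_Mapping.single w c) = sA c (word_val a w)"
  by (subst ev_superset[of "{w}"]) (auto simp: lookup_single)

lemma ev_scale: "ev a (hpoly_scale c f) = sA c (ev a f)"
proof -
  have "ev a (hpoly_scale c f) = ev a (\<Sum>w\<in>Poly_Mapping.keys f. Poly_Mapping.single w (c * Poly_Mapping.lookup f w))"
    by (subst hpoly_expand[of f]) (simp add: P.scale_sum_right hpoly_scale_single)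
  also have "\<dots> = sA c (ev a f)"
    by (subst (3) hpoly_expand[of f]) (simp add: ev_sum ev_single A.scale_sum_right)
  finally show ?thesis .
qed

text \<open>Only polynomials without constant term can be substituted into an algebra without
  unit, hence the conditions on the words.\<close>

lemma ev_mult:
  assumes f: "\<And>w. w \<in> Poly_Mapping.keys f \<Longrightarrow> letters w \<noteq> []"
    and g: "\<And>w. w \<in> Poly_Mapping.keys g \<Longrightarrow> letters w \<noteq> []"
  shows "ev a (f * g) = ev a f * ev a g"
proof -
  have "ev a (f * g) = ev a (\<Sum>w\<in>Poly_Mapping.keys f. \<Sum>v\<in>Poly_Mapping.keys g.
      Poly_Mapping.single (w + v) (Poly_Mapping.lookup f w * Poly_Mapping.lookup g v))"
    by (subst hpoly_expand[of f], subst hpoly_expand[of g]) (simp add: sum_product mult_single)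
  also have "\<dots> = (\<Sum>w\<in>Poly_Mapping.keys f. \<Sum>v\<in>Poly_Mapping.keys g.
      sA (Poly_Mapping.lookup f w) (word_val a w) * sA (Poly_Mapping.lookup g v) (word_val a v))"
    unfolding ev_sum ev_single
    using f g by (intro sum.cong refl)
      (simp add: word_val_def plus_free_monoid_def monomial_append
        A.scale_mult_left[symmetric] A.scale_mult_right[symmetric])
  also have "\<dots> = ev a f * ev a g"
    by (simp add: hpoly_eval_def word_val_def monomial_def sum_product)
  finally show ?thesis .
qed

lemma H_polynomials_subspace: "P.subspace (H_polynomials \<Gamma>)"
proof (rule P.subspaceI)
  fix c and f g :: "('f, 'h) hpoly"
  assume f: "f \<in> H_polynomials \<Gamma>"
  show "f + g \<in> H_polynomials \<Gamma>" if "g \<in> H_polynomials \<Gamma>"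
    using f that keys_add[of f g] by (fastforce simp: H_polynomials_def)
  have "Poly_Mapping.keys (hpoly_scale c f) \<subseteq> Poly_Mapping.keys f"
    unfolding hpoly_scale_def
    using keys_mult[of "Poly_Mapping.single 0 c" f] by (auto split: if_splits)
  then show "hpoly_scale c f \<in> H_polynomials \<Gamma>"
    using f by (auto simp: H_polynomials_def)
qed (simp add: H_polynomials_def)

lemma H_polynomials_mult:
  assumes "f \<in> H_polynomials \<Gamma>" "g \<in> H_polynomials \<Gamma>"
  shows "f * g \<in> H_polynomials \<Gamma>"
proof -
  have "\<exists>u v. w = u + v \<and> u \<in> Poly_Mapping.keys f \<and> v \<in> Poly_Mapping.keys g"
    if "w \<in> Poly_Mapping.keys (f * g)" for w
    using keys_mult[of f g] that by blast
  then show ?thesis using assms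
    by (fastforce simp: H_polynomials_def plus_free_monoid_def)
qed

lemma hvar_in: "hvar sH \<Gamma> i h \<in> H_polynomials \<Gamma>"
  unfolding hvar_def
proof (intro P.subspace_sum[OF H_polynomials_subspace])
  fix \<gamma> assume "\<gamma> \<in> {\<gamma>. H.representation \<Gamma> h \<gamma> \<noteq> 0}"
  then have "\<gamma> \<in> \<Gamma>" by (auto intro: H.representation_ne_zero)
  then show "hpoly_scale (H.representation \<Gamma> h \<gamma>) (Poly_Mapping.single (Word [(i, \<gamma>)]) 1) \<in> H_polynomials \<Gamma>"
    by (simp add: hpoly_scale_single H_polynomials_def)
qed

lemma ev_hvar: "ev a (hvar sH \<Gamma> i h) = act h (a i)"
proof -
  have "ev a (hvar sH \<Gamma> i h) = (\<Sum>\<gamma> | H.representation \<Gamma> h \<gamma> \<noteq> 0. sA (H.representation \<Gamma> h \<gamma>) (act \<gamma> (a i)))"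
    unfolding hvar_def by (simp add: ev_sum ev_single hpoly_scale_single word_val_def monomial_single)
  also have "\<dots> = act (\<Sum>\<gamma> | H.representation \<Gamma> h \<gamma> \<noteq> 0. sH (H.representation \<Gamma> h \<gamma>) \<gamma>) (a i)"
    by (simp add: act_sum act_scale)
  also have "(\<Sum>\<gamma> | H.representation \<Gamma> h \<gamma> \<noteq> 0. sH (H.representation \<Gamma> h \<gamma>) \<gamma>) = h"
    by (rule H.sum_nonzero_representation_eq[OF HB.independent_Basis]) (simp add: HB.span_Basis)
  finally show ?thesis .
qed

lemma hvar_product:
  assumes "ks \<noteq> []"
  shows "prod_list (map (\<lambda>k. hvar sH \<Gamma> (\<sigma> k) (h k)) ks) \<in> H_polynomials \<Gamma> \<and>
    ev a (prod_list (map (\<lambda>k. hvar sH \<Gamma> (\<sigma> k) (h k)) ks)) = monomial (map (\<lambda>k. (\<sigma> k, h k)) ks) a"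
  using assms
proof (induction ks)
  case (Cons k ks)
  show ?case
  proof (cases "ks = []")
    case True
    then show ?thesis by (simp add: hvar_in ev_hvar monomial_single)
  next
    case False
    then have IH: "prod_list (map (\<lambda>k. hvar sH \<Gamma> (\<sigma> k) (h k)) ks) \<in> H_polynomials \<Gamma>"
      "ev a (prod_list (map (\<lambda>k. hvar sH \<Gamma> (\<sigma> k) (h k)) ks)) = monomial (map (\<lambda>k. (\<sigma> k, h k)) ks) a"
      using Cons by auto
    have "ev a (hvar sH \<Gamma> (\<sigma> k) (h k) * prod_list (map (\<lambda>k. hvar sH \<Gamma> (\<sigma> k) (h k)) ks)) =
      ev a (hvar sH \<Gamma> (\<sigma> k) (h k)) * ev a (prod_list (map (\<lambda>k. hvar sH \<Gamma> (\<sigma> k) (h k)) ks))"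
      by (rule ev_mult) (use IH(1) hvar_in[of "\<sigma> k" "h k"] in \<open>auto simp: H_polynomials_def\<close>)
    then show ?thesis using False IH by (simp add: H_polynomials_mult hvar_in ev_hvar monomial_Cons)
  qed
qed simp

abbreviation Pn :: "nat \<Rightarrow> ('f, 'h) hpoly set" where
  "Pn n \<equiv> multilinear_H_polynomials sH \<Gamma> n"

lemma Pn_subspace: "P.subspace (Pn n)"
  by (simp add: multilinear_H_polynomials_def)

lemma Pn_eval:
  assumes "f \<in> Pn n" "n \<ge> 1"
  shows Pn_in: "f \<in> H_polynomials \<Gamma>" and Pn_mlf: "multilin {1..n} (\<lambda>a. ev a f)"
proof -
  have gen: "g \<in> H_polynomials \<Gamma> \<and> multilin {1..n} (\<lambda>a. ev a g)"
    if "g = prod_list (map (\<lambda>k. hvar sH \<Gamma> (\<sigma> k) (h k)) [1..<Suc n])" "\<sigma> permutes {1..n}" for g \<sigma> h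
  proof -
    have ne: "[1..<Suc n] \<noteq> []" using assms(2) by (auto simp: upt_conv_Cons)
    have set_eq: "set [1..<Suc n] = {1..n}" by auto
    have "distinct (map \<sigma> [1..<Suc n])" "set (map \<sigma> [1..<Suc n]) = {1..n}"
      using permutes_inj[OF that(2)] permutes_image[OF that(2)] set_eq
      unfolding set_map set_eq by (simp_all add: distinct_map inj_on_def)
    then have "multilin {1..n} (monomial (map (\<lambda>k. (\<sigma> k, h k)) [1..<Suc n]))"
      using ne by (intro multilin.monomial) (simp_all add: comp_def del: upt_Suc)
    then show ?thesis using hvar_product[OF ne, of \<sigma> h] that(1) by simp
  qed
  have "f \<in> H_polynomials \<Gamma> \<and> multilin {1..n} (\<lambda>a. ev a f)"
    using assms(1) unfolding multilinear_H_polynomials_def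
  proof (induction rule: P.span_induct_alt)
    case base
    then show ?case by (simp add: multilin.zero P.subspace_0[OF H_polynomials_subspace])
  next
    case (step c x y)
    then show ?case using gen
      by (auto simp: ev_add ev_scale intro!: multilin.add multilin.scale
         P.subspace_add[OF H_polynomials_subspace] P.subspace_scale[OF H_polynomials_subspace])
  qed
  then show "f \<in> H_polynomials \<Gamma>" "multilin {1..n} (\<lambda>a. ev a f)" by auto
qed

lemma multilin_is_Pn:
  assumes "multilin {1..n} F"
  shows "\<exists>f\<in>Pn n. \<forall>a. ev a f = F a"
  using assms
proof induction
  case (monomial ws)
  have len: "length ws = n"
    using monomial distinct_card[of "map fst ws"] by simp
  define \<sigma> where "\<sigma> k = (if k \<in> {1..n} then fst (ws ! (k - 1)) else k)" for k
  define h where "h k = snd (ws ! (k - 1))" for k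
  have ws: "ws = map (\<lambda>k. (\<sigma> k, h k)) [1..<Suc n]"
    by (rule nth_equalityI) (auto simp: len \<sigma>_def h_def simp del: upt_Suc)
  have "\<sigma> permutes {1..n}"
  proof (rule bij_imp_permutes)
    have "\<sigma> ` {1..n} = set (map \<sigma> [1..<Suc n])" by auto
    also have "map \<sigma> [1..<Suc n] = map fst ws" by (subst ws) (simp add: comp_def del: upt_Suc)
    finally have "\<sigma> ` {1..n} = {1..n}" using monomial by simp
    then show "bij_betw \<sigma> {1..n} {1..n}"
      by (auto simp: bij_betw_def intro: eq_card_imp_inj_on)
  qed (auto simp: \<sigma>_def)
  then have "prod_list (map (\<lambda>k. hvar sH \<Gamma> (\<sigma> k) (h k)) [1..<Suc n]) \<in> Pn n"
    unfolding multilinear_H_polynomials_def by (intro P.span_base) blast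
  moreover have "[1..<Suc n] \<noteq> []" using monomial(1) len by (cases n) (auto simp: upt_conv_Cons)
  ultimately show ?case
    using hvar_product[of "[1..<Suc n]" \<sigma> h] ws by (metis (no_types))
next
  case zero
  then show ?case using P.subspace_0[OF Pn_subspace] by (intro bexI[of _ 0]) auto
next
  case (add f g)
  then obtain p q where "p \<in> Pn n" "\<forall>a. ev a p = f a" "q \<in> Pn n" "\<forall>a. ev a q = g a" by blast
  then show ?case using P.subspace_add[OF Pn_subspace] by (intro bexI[of _ "p + q"]) (auto simp: ev_add)
next
  case (scale f c)
  then obtain p where "p \<in> Pn n" "\<forall>a. ev a p = f a" by blast
  then show ?case using P.subspace_scale[OF Pn_subspace]
    by (intro bexI[of _ "hpoly_scale c p"]) (auto simp: ev_scale)
qed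

abbreviation Idn :: "nat \<Rightarrow> ('f, 'h) hpoly set" where
  "Idn n \<equiv> Pn n \<inter> H_identities sA act \<Gamma>"

lemma Idn_iff: "n \<ge> 1 \<Longrightarrow> f \<in> Idn n \<longleftrightarrow> f \<in> Pn n \<and> (\<forall>a. ev a f = 0)"
  using Pn_in by (auto simp: H_identities_def)

definition test_set :: "nat \<Rightarrow> (nat \<Rightarrow> 'a) set \<Rightarrow> bool" where
  "test_set n T \<longleftrightarrow> (\<forall>F. multilin {1..n} F \<longrightarrow> (\<forall>\<tau>\<in>T. F \<tau> = 0) \<longrightarrow> (\<forall>a. F a = 0))"

definition indep_mod :: "nat \<Rightarrow> ('f, 'h) hpoly set \<Rightarrow> bool" where
  "indep_mod n S \<longleftrightarrow> S \<subseteq> Pn n \<and>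
    (\<forall>t u. finite t \<longrightarrow> t \<subseteq> S \<longrightarrow> (\<Sum>v\<in>t. hpoly_scale (u v) v) \<in> Idn n \<longrightarrow> (\<forall>v\<in>t. u v = 0))"

lemma quotient_basis_iff:
  "quotient_basis hpoly_scale (Pn n) (Idn n) S \<longleftrightarrow>
    indep_mod n S \<and> (\<forall>x\<in>Pn n. \<exists>y\<in>P.span S. x - y \<in> Idn n)"
  by (simp only: quotient_basis_def indep_mod_def conj_assoc)

lemma indep_mod_bound:
  assumes n: "n \<ge> 1" and T: "finite T" "test_set n T" and S: "indep_mod n S"
  shows "finite S \<and> card S \<le> card T * card E"
proof -
  have "finite S \<and> card S \<le> card (T \<times> E)"
  proof (rule card_le_if_coordinates_independent)
    show "finite (T \<times> E)" using T A.finite_Basis by simp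
    fix t u assume t: "finite t" "t \<subseteq> S"
      and z: "\<And>x. x \<in> T \<times> E \<Longrightarrow> (\<Sum>s\<in>t. u s * (\<lambda>s (\<tau>, e). A.coord (ev \<tau> s) e) s x) = 0"
    let ?f = "\<Sum>v\<in>t. hpoly_scale (u v) v"
    have fP: "?f \<in> Pn n" using t S Pn_subspace
      by (intro P.subspace_sum P.subspace_scale) (auto simp: indep_mod_def)
    have "ev \<tau> ?f = 0" if "\<tau> \<in> T" for \<tau>
    proof (rule A.coord_eqI)
      fix e assume "e \<in> E"
      then have "(\<Sum>s\<in>t. u s * A.coord (ev \<tau> s) e) = 0" using z[of "(\<tau>, e)"] that by simp
      then show "A.coord (ev \<tau> ?f) e = A.coord 0 e"
        by (simp add: ev_sum ev_scale A.coord_sum A.coord_scale)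
    qed
    then have "\<forall>a. ev a ?f = 0" using T(2) Pn_mlf[OF fP n] unfolding test_set_def by blast
    then have "?f \<in> Idn n" using fP n by (simp add: Idn_iff del: Int_iff)
    then show "\<forall>s\<in>t. u s = 0" using t S unfolding indep_mod_def by blast
  qed
  then show ?thesis by (simp add: card_cartesian_product)
qed

text \<open>The sizes of families that are independent modulo the identities are bounded, and a
  family of maximal size is a basis of the quotient.\<close>

lemma quotient_basis_exists:
  assumes n: "n \<ge> 1" and T: "finite T" "test_set n T"
  shows "\<exists>S. quotient_basis hpoly_scale (Pn n) (Idn n) S"
proof -
  have "indep_mod n {}" by (simp add: indep_mod_def)
  moreover have "\<forall>S. indep_mod n S \<longrightarrow> card S < Suc (card T * card E)"
    using indep_mod_bound[OF assms] by (simp add: less_Suc_eq_le)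
  ultimately obtain S where S: "indep_mod n S" "\<And>S'. indep_mod n S' \<Longrightarrow> card S' \<le> card S"
    using ex_has_greatest_nat[of "indep_mod n" "{}" card "Suc (card T * card E)"] by metis
  have finS: "finite S" using indep_mod_bound[OF assms S(1)] by simp
  have "\<exists>y\<in>P.span S. x - y \<in> Idn n" if x: "x \<in> Pn n" for x
  proof (cases "x \<in> S")
    case True
    have "x - x \<in> Idn n" using n by (simp add: Idn_iff P.subspace_0[OF Pn_subspace] del: Int_iff)
    then show ?thesis using True P.span_base by blast
  next
    case False
    then have "card (insert x S) > card S" using finS by simp
    then have "\<not> indep_mod n (insert x S)" using S(2) by (meson not_le)
    then obtain t u where t: "finite t" "t \<subseteq> insert x S" "(\<Sum>v\<in>t. hpoly_scale (u v) v) \<in> Idn n" "\<exists>v\<in>t. u v \<noteq> 0"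
      using x S(1) unfolding indep_mod_def by blast
    have "x \<in> t \<and> u x \<noteq> 0"
    proof (rule ccontr)
      assume no: "\<not> ?thesis"
      have "(\<Sum>v\<in>t - {x}. hpoly_scale (u v) v) = (\<Sum>v\<in>t. hpoly_scale (u v) v)"
        using no t(1) by (intro sum.mono_neutral_left) auto
      moreover have "t - {x} \<subseteq> S" using t by blast
      ultimately have "\<forall>v\<in>t - {x}. u v = 0" using t(1,3) S(1) unfolding indep_mod_def
        by (metis (no_types, lifting) finite_Diff)
      then show False using no t(4) by blast
    qed
    then have ux: "x \<in> t" "u x \<noteq> 0" by auto
    define y where "y = - hpoly_scale (1 / u x) (\<Sum>v\<in>t - {x}. hpoly_scale (u v) v)"
    have "y \<in> P.span S" unfolding y_def using t
      by (intro P.span_neg P.span_scale P.span_sum) (auto intro: P.span_base)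
    moreover have "x - y = hpoly_scale (1 / u x) (\<Sum>v\<in>t. hpoly_scale (u v) v)"
      using ux t(1) by (simp add: y_def sum.remove[of t x] P.scale_right_distrib)
    then have "x - y \<in> Idn n"
      using t(3) n P.subspace_scale[OF Pn_subspace] by (simp add: Idn_iff ev_scale del: Int_iff)
    ultimately show ?thesis by blast
  qed
  then have "quotient_basis hpoly_scale (Pn n) (Idn n) S"
    using S(1) by (simp only: quotient_basis_iff) blast
  then show ?thesis by blast
qed

lemma codim_basis:
  assumes n: "n \<ge> 1" and T: "finite T" "test_set n T"
  obtains S where "indep_mod n S" "finite S" "card S = H_codim sH sA act \<Gamma> n"
    "\<And>x. x \<in> Pn n \<Longrightarrow> \<exists>y\<in>P.span S. x - y \<in> Idn n"
proof -
  define S where "S = (SOME S. quotient_basis hpoly_scale (Pn n) (Idn n) S)"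
  have S: "quotient_basis hpoly_scale (Pn n) (Idn n) S"
    unfolding S_def by (rule someI_ex[OF quotient_basis_exists[OF assms]])
  then have ind: "indep_mod n S" by (simp only: quotient_basis_iff)
  show thesis
  proof (rule that[OF ind])
    show "finite S" using indep_mod_bound[OF assms ind] by simp
    show "card S = H_codim sH sA act \<Gamma> n" by (simp add: H_codim_def quotient_dim_def S_def)
    show "\<exists>y\<in>P.span S. x - y \<in> Idn n" if "x \<in> Pn n" for x
      using S that unfolding quotient_basis_iff by blast
  qed
qed

theorem H_codim_le:
  assumes "n \<ge> 1" "finite T" "test_set n T"
  shows "H_codim sH sA act \<Gamma> n \<le> card T * card E"
  using codim_basis[OF assms] indep_mod_bound[OF assms] by metis

lemma basis_tuples_test: "test_set n ({1..n} \<rightarrow>\<^sub>E E)"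
  unfolding test_set_def
proof (intro allI impI)
  fix F a assume F: "multilin {1..n} F" and z: "\<forall>\<tau>\<in>{1..n} \<rightarrow>\<^sub>E E. F \<tau> = 0"
  have "\<forall>i\<in>{1..n} - K. a i \<in> E \<Longrightarrow> F a = 0" if "finite K" "K \<subseteq> {1..n}" for K a
    using that
  proof (induction K arbitrary: a rule: finite_induct)
    case empty
    have "F a = F (restrict a {1..n})" by (rule multilin_cong[OF F]) simp
    then show ?case using z empty by (auto simp: PiE_iff)
  next
    case (insert k K)
    have "F a = F (a(k := (\<Sum>e\<in>E. sA (A.coord (a k) e) e)))"
      using A.coord_expand[of E "a k"] by (simp add: A.span_Basis)
    also have "\<dots> = (\<Sum>e\<in>E. sA (A.coord (a k) e) (F (a(k := e))))"
      using insert by (intro multilin_linear_sum[OF F]) auto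
    also have "\<dots> = (\<Sum>e\<in>E. 0)"
      using insert by (intro sum.cong refl) (auto intro!: insert.IH simp: fun_upd_apply)
    finally show ?case by simp
  qed
  from this[of "{1..n}" a] show "F a = 0" by simp
qed

text \<open>Functions \<open>F s\<close> and points \<open>pt s\<close> with a diagonal evaluation
  matrix are linearly independent modulo the identities.\<close>

theorem H_codim_ge:
  assumes n: "n \<ge> 1" and X: "finite X" "\<And>s. s \<in> X \<Longrightarrow> multilin {1..n} (F s)"
    and dual: "\<And>s r. s \<in> X \<Longrightarrow> r \<in> X \<Longrightarrow> F s (pt r) \<noteq> 0 \<longleftrightarrow> r = s"
  shows "card X \<le> H_codim sH sA act \<Gamma> n"
proof (rule ccontr)
  assume less: "\<not> ?thesis"
  have "finite ({1..n} \<rightarrow>\<^sub>E E)" by (intro finite_PiE) (auto simp: A.finite_Basis)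
  from codim_basis[OF n this basis_tuples_test] obtain S where S: "finite S"
    "card S = H_codim sH sA act \<Gamma> n" "\<And>x. x \<in> Pn n \<Longrightarrow> \<exists>y\<in>P.span S. x - y \<in> Idn n" by metis
  have "\<exists>c. \<forall>a. F s a = (\<Sum>v\<in>S. sA (c v) (ev a v))" if s: "s \<in> X" for s
  proof -
    obtain p where p: "p \<in> Pn n" "\<And>a. ev a p = F s a" using multilin_is_Pn[OF X(2)[OF s]] by blast
    obtain y where y: "y \<in> P.span S" "p - y \<in> Idn n" using S(3)[OF p(1)] by blast
    obtain c where c: "y = (\<Sum>v\<in>S. hpoly_scale (c v) v)"
      using y(1) P.span_finite[OF S(1)] by auto
    have "F s a = (\<Sum>v\<in>S. sA (c v) (ev a v))" for a
    proof -
      have "ev a (p - y) + ev a y = ev a p" by (simp add: ev_add[symmetric])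
      moreover have "ev a (p - y) = 0" using y(2) n by (simp add: Idn_iff del: Int_iff)
      ultimately have "F s a = ev a y" using p(2) by simp
      then show ?thesis by (simp add: c ev_sum ev_scale)
    qed
    then show ?thesis by blast
  qed
  then obtain c where c: "\<And>s a. s \<in> X \<Longrightarrow> F s a = (\<Sum>v\<in>S. sA (c s v) (ev a v))" by metis
  have "card S < card X" using less S(2) by simp
  from nontrivial_solution[OF S(1) X(1) this, of c] obtain u where
    u: "\<exists>s\<in>X. u s \<noteq> 0" "\<And>v. v \<in> S \<Longrightarrow> (\<Sum>s\<in>X. u s * c s v) = 0" by blast
  have "u r = 0" if r: "r \<in> X" for r
  proof -
    have "(\<Sum>s\<in>X. sA (u s) (F s (pt r))) = (\<Sum>s\<in>X. \<Sum>v\<in>S. sA (u s * c s v) (ev (pt r) v))"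
      by (intro sum.cong refl) (simp add: c A.scale_sum_right)
    also have "\<dots> = (\<Sum>v\<in>S. sA (\<Sum>s\<in>X. u s * c s v) (ev (pt r) v))"
      by (subst sum.swap) (simp add: A.scale_sum_left)
    also have "\<dots> = 0" using u(2) by simp
    finally have "(\<Sum>s\<in>X. sA (u s) (F s (pt r))) = 0" .
    moreover have "(\<Sum>s\<in>X. sA (u s) (F s (pt r))) = (\<Sum>s\<in>{r}. sA (u s) (F s (pt r)))"
      using r X(1) dual by (intro sum.mono_neutral_right) auto
    ultimately show ?thesis using dual[OF r r] by simp
  qed
  then show False using u(1) by blast
qed

end

section \<open>Adapted bases and the upper bound\<close>

text \<open>The situation of the theorem together with an adapted basis \<open>E\<close> of
  \<open>A\<close>: \<open>Es i\<close> is a basis of the block \<open>B\<^sub>i\<close> and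
  \<open>EJ\<close> a basis of \<open>J\<close>.\<close>

locale structured_action = fd_action sH sA act \<Gamma> E
  for sH :: "'f::field \<Rightarrow> 'h::ring_1 \<Rightarrow> 'h"
    and sA :: "'f \<Rightarrow> 'a::ring \<Rightarrow> 'a"
    and act :: "'h \<Rightarrow> 'a \<Rightarrow> 'a" and \<Gamma> :: "'h set" and E :: "'a set" +
  fixes J :: "'a set" and q :: nat and Bs :: "nat \<Rightarrow> 'a set" and Es :: "nat \<Rightarrow> 'a set" and EJ :: "'a set"
  assumes J_radical: "J = jacobson_radical sA UNIV"
    and J_invariant: "H_invariant act J"
    and E_eq: "E = (\<Union>i\<in>{1..q}. Es i) \<union> EJ"
    and EJ_span: "A.span EJ = J"
    and Es_span: "i \<in> {1..q} \<Longrightarrow> A.span (Es i) = Bs i"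
    and Es_disjoint: "i \<in> {1..q} \<Longrightarrow> k \<in> {1..q} \<Longrightarrow> i \<noteq> k \<Longrightarrow> Es i \<inter> Es k = {}"
    and EJ_disjoint: "i \<in> {1..q} \<Longrightarrow> EJ \<inter> Es i = {}"
    and Bs_orth: "i \<in> {1..q} \<Longrightarrow> k \<in> {1..q} \<Longrightarrow> i \<noteq> k \<Longrightarrow> x \<in> Bs i \<Longrightarrow> y \<in> Bs k \<Longrightarrow> x * y = 0"
    and Bs_simple: "i \<in> {1..q} \<Longrightarrow> H_simple sA act (Bs i)"
    and Bs_semisimple: "i \<in> {1..q} \<Longrightarrow> semisimple_algebra sA (Bs i)"
begin

definition block_basis :: "nat set \<Rightarrow> 'a set" where
  "block_basis I = (\<Union>i\<in>I. Es i)"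

lemma J_sub: "A.subspace J" using A.radical_subspace J_radical by simp
lemma J_left: "x \<in> J \<Longrightarrow> a * x \<in> J" using A.radical_left J_radical by simp

lemma Bs_sub: "i \<in> {1..q} \<Longrightarrow> A.subspace (Bs i)"
  using Bs_simple by (simp add: H_simple_def is_subalgebra_def)
lemma Bs_mult: "i \<in> {1..q} \<Longrightarrow> x \<in> Bs i \<Longrightarrow> y \<in> Bs i \<Longrightarrow> x * y \<in> Bs i"
  using Bs_simple by (simp add: H_simple_def is_subalgebra_def)
lemma Bs_act: "i \<in> {1..q} \<Longrightarrow> x \<in> Bs i \<Longrightarrow> act h x \<in> Bs i"
  using Bs_simple by (simp add: H_simple_def H_invariant_def)
lemma Bs_nonzero: "i \<in> {1..q} \<Longrightarrow> Bs i \<noteq> {0}"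
  using Bs_simple by (simp add: H_simple_def)

lemma Es_subset: "i \<in> {1..q} \<Longrightarrow> Es i \<subseteq> Bs i"
  using Es_span A.span_base by blast

lemma block_basis_subset: "I \<subseteq> {1..q} \<Longrightarrow> block_basis I \<subseteq> E"
  by (auto simp: block_basis_def E_eq)

lemma span_Bs_eq: 
  assumes I: "I \<subseteq> {1..q}"
  shows "A.span (\<Union>i\<in>I. Bs i) = A.span (block_basis I)"
proof
  have "Bs i \<subseteq> A.span (block_basis I)" if "i \<in> I" for i
  proof -
    have "A.span (Es i) \<subseteq> A.span (block_basis I)" using that by (intro A.span_mono) (auto simp: block_basis_def)
    then show ?thesis using Es_span that I by blast
  qed
  then show "A.span (\<Union>i\<in>I. Bs i) \<subseteq> A.span (block_basis I)" by (intro A.span_minimal) auto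
  show "A.span (block_basis I) \<subseteq> A.span (\<Union>i\<in>I. Bs i)"
  proof (rule A.span_mono)
    show "block_basis I \<subseteq> (\<Union>i\<in>I. Bs i)" unfolding block_basis_def using Es_subset I by blast
  qed
qed

lemma dim_Bs: "I \<subseteq> {1..q} \<Longrightarrow> A.dim (A.span (\<Union>i\<in>I. Bs i)) = card (block_basis I)"
  using A.dim_span_eq_card_independent[OF A.independent_mono[OF A.independent_Basis block_basis_subset]]
  by (simp add: span_Bs_eq)

abbreviation dA :: nat where "dA \<equiv> d_number sA q Bs J"

definition chains :: "nat list set" where
  "chains = {is. is \<noteq> [] \<and> distinct is \<and> set is \<subseteq> {1..q} \<and> BJ_chain sA Bs J is \<noteq> {0}}"

lemma chains_length: "is \<in> chains \<Longrightarrow> length is \<le> q"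
  using card_mono[of "{1..q}" "set is"] by (auto simp: chains_def distinct_card)

lemma finite_chains: "finite chains"
  by (rule finite_subset[OF _ finite_lists_length_le[of "{1..q}" q]]) (use chains_length in \<open>auto simp: chains_def\<close>)

lemma dA_eq: "dA = Max (insert 0 ((\<lambda>is. card (block_basis (set is))) ` chains))"
proof -
  have "{A.dim (A.span (\<Union>i\<in>set is. Bs i)) | is.
        is \<noteq> [] \<and> length is \<le> q \<and> distinct is \<and> set is \<subseteq> {1..q} \<and> BJ_chain sA Bs J is \<noteq> {0}}
     = (\<lambda>is. A.dim (A.span (\<Union>i\<in>set is. Bs i))) ` chains"
    using chains_length unfolding chains_def by blast
  also have "\<dots> = (\<lambda>is. card (block_basis (set is))) ` chains"
    by (intro image_cong refl dim_Bs) (auto simp: chains_def)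
  finally have "{A.dim (A.span (\<Union>i\<in>set is. Bs i)) | is.
        is \<noteq> [] \<and> length is \<le> q \<and> distinct is \<and> set is \<subseteq> {1..q} \<and> BJ_chain sA Bs J is \<noteq> {0}}
     = (\<lambda>is. card (block_basis (set is))) ` chains" .
  then show ?thesis by (simp add: d_number_def)
qed

lemma dA_ge: "is \<in> chains \<Longrightarrow> card (block_basis (set is)) \<le> dA"
  unfolding dA_eq using finite_chains by (intro Max_ge) auto

lemma dA_attained:
  assumes "q \<ge> 1"
  obtains "is" where "is \<in> chains" "dA = card (block_basis (set is))"
proof -
  have "[1] \<in> chains" using assms Bs_nonzero by (auto simp: chains_def)
  moreover have "dA \<in> insert 0 ((\<lambda>is. card (block_basis (set is))) ` chains)"
    unfolding dA_eq using finite_chains by (intro Max_in) auto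
  ultimately show thesis
  proof (cases "dA = 0")
    case True
    then show thesis using that[OF \<open>[1] \<in> chains\<close>] dA_ge[OF \<open>[1] \<in> chains\<close>] by simp
  next
    case False
    then show thesis using that \<open>dA \<in> _\<close> by auto
  qed
qed

subsection \<open>Nonzero products and good tuples\<close>

lemma span_mult_left:
  assumes "x \<in> A.span X" and "\<And>y. y \<in> X \<Longrightarrow> a * y \<in> V" and "A.subspace V"
  shows "a * x \<in> V"
proof -
  interpret L: Vector_Spaces.linear sA sA "\<lambda>y. a * y" by (rule A.linear_mult_left)
  show ?thesis using assms(1)
  proof (induction rule: A.span_induct_alt)
    case base
    then show ?case using assms(3) by (simp add: A.subspace_0)
  next
    case (step c x y)
    then show ?case using assms by (simp add: L.add L.scale A.subspace_add A.subspace_scale)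
  qed
qed

lemma chain_left_same:
  assumes "i \<in> {1..q}" "z \<in> Bs i" "x \<in> BJ_chain sA Bs J (i # is)"
  shows "z * x \<in> BJ_chain sA Bs J (i # is)"
proof (cases "is")
  case Nil
  then show ?thesis using assms Bs_mult by simp
next
  case (Cons k ks)
  show ?thesis
  proof (rule span_mult_left)
    show "x \<in> A.span {u * v |u v. u \<in> Bs i \<and> v \<in> subspace_mult sA J (BJ_chain sA Bs J (k # ks))}"
      using assms(3) by (simp add: Cons subspace_mult_def)
    show "A.subspace (BJ_chain sA Bs J (i # is))" by (simp add: Cons subspace_mult_def)
    fix y assume "y \<in> {u * v |u v. u \<in> Bs i \<and> v \<in> subspace_mult sA J (BJ_chain sA Bs J (k # ks))}"
    then obtain u v where uv: "y = u * v" "u \<in> Bs i" "v \<in> subspace_mult sA J (BJ_chain sA Bs J (k # ks))"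
      by blast
    then have "z * y = (z * u) * v" "z * u \<in> Bs i" using assms Bs_mult by (auto simp: mult.assoc)
    then show "z * y \<in> BJ_chain sA Bs J (i # is)" using uv(3)
      unfolding Cons BJ_chain.simps subspace_mult_def[of _ "Bs i"] by (intro A.span_base) blast
  qed
qed

lemma chain_left_other:
  assumes "i \<in> {1..q}" "k \<in> {1..q}" "k \<noteq> i" "z \<in> Bs k" "x \<in> BJ_chain sA Bs J (i # is)"
  shows "z * x = 0"
proof (cases "is")
  case Nil
  then show ?thesis using assms Bs_orth[of k i] by simp
next
  case (Cons l ls)
  have "z * x \<in> {0}"
  proof (rule span_mult_left)
    show "x \<in> A.span {u * v |u v. u \<in> Bs i \<and> v \<in> subspace_mult sA J (BJ_chain sA Bs J (l # ls))}"
      using assms(5) by (simp add: Cons subspace_mult_def)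
    fix y assume "y \<in> {u * v |u v. u \<in> Bs i \<and> v \<in> subspace_mult sA J (BJ_chain sA Bs J (l # ls))}"
    then obtain u v where uv: "y = u * v" "u \<in> Bs i" by blast
    then have "z * y = (z * u) * v" by (simp add: mult.assoc)
    also have "z * u = 0" using assms uv Bs_orth[of k i] by simp
    finally show "z * y \<in> {0}" by simp
  qed simp
  then show ?thesis by simp
qed

text \<open>\<open>C A\<^sup>#\<close> and \<open>J C A\<^sup>#\<close> for the product
  \<open>C\<close> of blocks given by the index list, where \<open>A\<^sup>#\<close> is
  \<open>A\<close> with a unit adjoined.\<close>

definition chainA :: "nat list \<Rightarrow> 'a set" where
  "chainA is = A.span (BJ_chain sA Bs J is \<union> {c * v | c v. c \<in> BJ_chain sA Bs J is})"

definition JchainA :: "nat list \<Rightarrow> 'a set" where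
  "JchainA is = A.span {j * x | j x. j \<in> J \<and> x \<in> chainA is}"

lemma chainA_zero: "BJ_chain sA Bs J is = {0} \<Longrightarrow> chainA is = {0} \<and> JchainA is = {0}"
proof -
  assume "BJ_chain sA Bs J is = {0}"
  then have "BJ_chain sA Bs J is \<union> {c * v | c v. c \<in> BJ_chain sA Bs J is} = {0}" by auto
  then have "chainA is = {0}" by (simp add: chainA_def)
  moreover from this have "{j * x | j x. j \<in> J \<and> x \<in> chainA is} = {0}"
    using A.subspace_0[OF J_sub] by auto
  ultimately show ?thesis by (simp add: JchainA_def)
qed

lemma chainA_subspace: "A.subspace (chainA is)" "A.subspace (JchainA is)"
  by (simp_all add: chainA_def JchainA_def)

lemma chainA_left_same:
  assumes "i \<in> {1..q}" "z \<in> Bs i" "x \<in> chainA (i # is)"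
  shows "z * x \<in> chainA (i # is)"
proof (rule span_mult_left[OF assms(3)[unfolded chainA_def] _ chainA_subspace(1)])
  fix y assume "y \<in> BJ_chain sA Bs J (i # is) \<union> {c * v |c v. c \<in> BJ_chain sA Bs J (i # is)}"
  then consider "y \<in> BJ_chain sA Bs J (i # is)" | c v where "y = c * v" "c \<in> BJ_chain sA Bs J (i # is)" by blast
  then show "z * y \<in> chainA (i # is)"
  proof cases
    case 1
    then show ?thesis unfolding chainA_def
      using chain_left_same[OF assms(1,2)] by (intro A.span_base) blast
  next
    case 2
    have "z * y = (z * c) * v" by (simp add: 2 mult.assoc)
    then show ?thesis unfolding chainA_def
      using chain_left_same[OF assms(1,2) 2(2)] by (intro A.span_base) blast
  qed
qed

lemma chainA_left_other:
  assumes "i \<in> {1..q}" "k \<in> {1..q}" "k \<noteq> i" "z \<in> Bs k" "x \<in> chainA (i # is)"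
  shows "z * x = 0"
proof -
  have "z * x \<in> {0}"
  proof (rule span_mult_left[OF assms(5)[unfolded chainA_def]])
    fix y assume "y \<in> BJ_chain sA Bs J (i # is) \<union> {c * v |c v. c \<in> BJ_chain sA Bs J (i # is)}"
    then show "z * y \<in> {0}"
      using chain_left_other[OF assms(1-4)] by (auto simp: mult.assoc[symmetric])
  qed simp
  then show ?thesis by simp
qed

lemma JchainA_left: "x \<in> JchainA is \<Longrightarrow> a * x \<in> JchainA is"
proof (rule span_mult_left[OF _ _ chainA_subspace(2)])
  fix y assume "y \<in> {j * x |j x. j \<in> J \<and> x \<in> chainA is}"
  then show "a * y \<in> JchainA is" unfolding JchainA_def
    using J_left by (intro A.span_base) (force simp: mult.assoc[symmetric])
qed (simp add: JchainA_def)

lemma J_chainA: "j \<in> J \<Longrightarrow> x \<in> chainA is \<Longrightarrow> j * x \<in> JchainA is"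
  unfolding JchainA_def by (intro A.span_base) blast

lemma JchainA_extend:
  assumes "z \<in> Bs i" "is \<noteq> []" "x \<in> JchainA is"
  shows "z * x \<in> chainA (i # is)"
proof (rule span_mult_left[OF assms(3)[unfolded JchainA_def] _ chainA_subspace(1)])
  obtain k ks where "is": "is = k # ks" using assms(2) by (cases "is") auto
  fix y assume "y \<in> {j * x |j x. j \<in> J \<and> x \<in> chainA is}"
  then obtain j x where y: "y = j * x" "j \<in> J" "x \<in> chainA is" by blast
  have zjc: "z * (j * c) \<in> BJ_chain sA Bs J (i # is)" if "c \<in> BJ_chain sA Bs J is" for c
  proof -
    have "j * c \<in> subspace_mult sA J (BJ_chain sA Bs J (k # ks))"
      unfolding subspace_mult_def using y(2) that by (intro A.span_base) (auto simp: "is")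
    then show ?thesis unfolding "is" BJ_chain.simps subspace_mult_def[of _ "Bs i"]
      using assms(1) by (intro A.span_base) blast
  qed
  have "(z * j) * x \<in> chainA (i # is)"
  proof (rule span_mult_left[OF y(3)[unfolded chainA_def] _ chainA_subspace(1)])
    fix u assume "u \<in> BJ_chain sA Bs J is \<union> {c * v |c v. c \<in> BJ_chain sA Bs J is}"
    then consider "u \<in> BJ_chain sA Bs J is" | c v where "u = c * v" "c \<in> BJ_chain sA Bs J is" by blast
    then show "(z * j) * u \<in> chainA (i # is)"
    proof cases
      case 1
      then show ?thesis unfolding chainA_def using zjc
        by (intro A.span_base) (simp add: mult.assoc)
    next
      case 2
      have "(z * j) * u = (z * (j * c)) * v" using 2 by (simp add: mult.assoc)
      then show ?thesis unfolding chainA_def using zjc[OF 2(2)]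
        by (intro A.span_base) blast
    qed
  qed
  then show "z * y \<in> chainA (i # is)" by (simp add: y mult.assoc)
qed

definition label_ok :: "nat option \<times> 'a \<Rightarrow> bool" where
  "label_ok l = (case fst l of None \<Rightarrow> snd l \<in> J | Some i \<Rightarrow> i \<in> {1..q} \<and> snd l \<in> Bs i)"

text \<open>Reading a product from right to left, the index list grows whenever a new block
  appears. The product lies in \<open>C A\<^sup>#\<close> if the leading factor belongs to the
  block at the head of the list, and in \<open>J C A\<^sup>#\<close> as soon as the part in front
  of \<open>C\<close> contains a factor from \<open>J\<close>. In the first case a factor from
  another block kills the product, in the second case a new block extends the chain.\<close>

lemma product_in_chain:
  assumes "tz \<noteq> []" "\<And>l. l \<in> set tz \<Longrightarrow> label_ok l"
  shows "nonunital_prod (map snd tz) = 0 \<or> (\<exists>is. distinct is \<and> set is = {i. Some i \<in> fst ` set tz} \<and>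
    (is = [] \<or> nonunital_prod (map snd tz) \<in> chainA is \<or> nonunital_prod (map snd tz) \<in> JchainA is))"
  using assms
proof (induction tz)
  case (Cons l tz)
  obtain o' z where l: "l = (o', z)" by force
  have ok: "label_ok (o', z)" using Cons.prems l by simp
  show ?case
  proof (cases "tz = []")
    case True
    show ?thesis
    proof (cases o')
      case None
      then show ?thesis using True l by (intro disjI2 exI[of _ "[]"]) auto
    next
      case (Some i)
      then have "z \<in> Bs i" using ok by (simp add: label_ok_def)
      then have "z \<in> chainA [i]" unfolding chainA_def by (intro A.span_base) simp
      then show ?thesis using Some True l by (intro disjI2 exI[of _ "[i]"]) auto
    qed
  next
    case False
    let ?P = "nonunital_prod (map snd tz)"
    have prod: "nonunital_prod (map snd (l # tz)) = z * ?P"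
      using False l by (simp add: nonunital_prod_Cons)
    show ?thesis
    proof (cases "?P = 0")
      case True
      then show ?thesis unfolding prod by simp
    next
      case nz: False
      then obtain "is" where "is": "distinct is" "set is = {i. Some i \<in> fst ` set tz}"
        "is = [] \<or> ?P \<in> chainA is \<or> ?P \<in> JchainA is"
        using Cons False by auto
      have isq: "set is \<subseteq> {1..q}"
        using Cons.prems(2) "is"(2) by (force simp: label_ok_def)
      show ?thesis
      proof (cases o')
        case None
        then have zJ: "z \<in> J" using ok by (simp add: label_ok_def)
        have "set is = {i. Some i \<in> fst ` set (l # tz)}" using "is"(2) None l by auto
        moreover have "is = [] \<or> z * ?P \<in> JchainA is"
          using "is"(3) J_chainA[OF zJ] JchainA_left by blast
        ultimately show ?thesis unfolding prod using "is"(1) by blast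
      next
        case (Some i)
        then have iq: "i \<in> {1..q}" and zB: "z \<in> Bs i" using ok by (auto simp: label_ok_def)
        have set_eq: "insert i (set is) = {i. Some i \<in> fst ` set (l # tz)}" using "is"(2) Some l by auto
        consider "is = []" | "?P \<in> JchainA is" "is \<noteq> []" | k ks where "?P \<in> chainA is" "is = k # ks"
          using "is"(3) by (cases "is") auto
        then show ?thesis
        proof cases
          case 1
          have "z * ?P \<in> chainA [i]" unfolding chainA_def using zB by (intro A.span_base) auto
          then show ?thesis unfolding prod using set_eq 1 by (intro disjI2 exI[of _ "[i]"]) auto
        next
          case 2
          show ?thesis
          proof (cases "i \<in> set is")
            case True
            then show ?thesis unfolding prod using JchainA_left[OF 2(1), of z] "is"(1) set_eq
              by (intro disjI2 exI[of _ "is"]) auto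
          next
            case False
            then show ?thesis unfolding prod using JchainA_extend[OF zB 2(2,1)] "is"(1) set_eq
              by (intro disjI2 exI[of _ "i # is"]) auto
          qed
        next
          case 3
          then have kq: "k \<in> {1..q}" using isq by auto
          show ?thesis
          proof (cases "i = k")
            case True
            then have "z * ?P \<in> chainA is" using chainA_left_same[OF kq] zB 3 by blast
            then show ?thesis unfolding prod using "is"(1) set_eq True 3
              by (intro disjI2 exI[of _ "is"]) auto
          next
            case False
            then have "z * ?P = 0" using chainA_left_other[OF kq iq] zB 3 by blast
            then show ?thesis unfolding prod by simp
          qed
        qed
      qed
    qed
  qed
qed simp

lemma nonzero_product_labels:
  assumes "tz \<noteq> []" "\<And>l. l \<in> set tz \<Longrightarrow> label_ok l" "nonunital_prod (map snd tz) \<noteq> 0"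
  shows "card (block_basis {i. Some i \<in> fst ` set tz}) \<le> dA"
proof -
  let ?P = "nonunital_prod (map snd tz)"
  obtain "is" where "is": "distinct is" "set is = {i. Some i \<in> fst ` set tz}"
    "is = [] \<or> ?P \<in> chainA is \<or> ?P \<in> JchainA is"
    using product_in_chain[OF assms(1,2)] assms(3) by blast
  show ?thesis
  proof (cases "is = []")
    case True
    then have "block_basis {i. Some i \<in> fst ` set tz} = {}" using "is"(2) by (simp add: block_basis_def)
    then show ?thesis by simp
  next
    case False
    have "BJ_chain sA Bs J is \<noteq> {0}" using "is"(3) False assms(3) chainA_zero by blast
    moreover have "set is \<subseteq> {1..q}"
      using assms(2) "is"(2) by (force simp: label_ok_def)
    ultimately have "is \<in> chains" using False "is"(1) by (simp add: chains_def)
    from dA_ge[OF this] show ?thesis by (simp add: "is"(2))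
  qed
qed

definition good_tuples :: "nat \<Rightarrow> nat \<Rightarrow> (nat \<Rightarrow> 'a) set" where
  "good_tuples p n = (\<Union>I\<in>{I. I \<subseteq> {1..q} \<and> card (block_basis I) \<le> dA}.
     {\<tau>\<in>{1..n} \<rightarrow>\<^sub>E (block_basis I \<union> EJ). card {k\<in>{1..n}. \<tau> k \<in> EJ} \<le> p})"

lemma monomial_zero_outside_good:
  assumes p: "\<And>zs. p \<le> length (filter (\<lambda>z. z \<in> J) zs) \<Longrightarrow> nonunital_prod zs = 0"
    and ws: "ws \<noteq> []" "distinct (map fst ws)" "set (map fst ws) = {1..n}"
    and \<tau>: "\<tau> \<in> {1..n} \<rightarrow>\<^sub>E E" "\<tau> \<notin> good_tuples p n"
  shows "monomial ws \<tau> = 0"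
proof (rule ccontr)
  assume nz: "monomial ws \<tau> \<noteq> 0"
  define lab where "lab e = (if e \<in> EJ then None else Some (THE i. i \<in> {1..q} \<and> e \<in> Es i))" for e
  have lab_Some: "lab e = Some i" if "e \<in> Es i" "i \<in> {1..q}" for e i
  proof -
    have "(THE i. i \<in> {1..q} \<and> e \<in> Es i) = i" using that Es_disjoint by (intro the_equality) blast+
    then show ?thesis using that EJ_disjoint by (auto simp: lab_def)
  qed
  have lab_None: "lab e = None \<longleftrightarrow> e \<in> EJ" for e by (simp add: lab_def)
  have ok: "label_ok (lab e, act h e)" if eE: "e \<in> E" for e h
  proof (cases "e \<in> EJ")
    case True
    then have "e \<in> J" using EJ_span A.span_base by blast
    then have "act h e \<in> J" using J_invariant by (simp add: H_invariant_def)
    moreover have "lab e = None" using True lab_None by simp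
    ultimately show ?thesis by (simp add: label_ok_def)
  next
    case False
    then obtain i where i: "i \<in> {1..q}" "e \<in> Es i" using eE E_eq by auto
    then have "act h e \<in> Bs i" using Es_subset Bs_act by blast
    then show ?thesis using i lab_Some by (simp add: label_ok_def)
  qed
  define tz where "tz = map (\<lambda>(i, h). (lab (\<tau> i), act h (\<tau> i))) ws"
  have \<tau>E: "\<tau> k \<in> E" if "k \<in> {1..n}" for k using \<tau>(1) that by blast
  have snd_tz: "map snd tz = map (\<lambda>(i, h). act h (\<tau> i)) ws" by (auto simp: tz_def)
  have tz_ok: "label_ok l" if l: "l \<in> set tz" for l
  proof -
    obtain i h where "(i, h) \<in> set ws" "l = (lab (\<tau> i), act h (\<tau> i))" using l by (auto simp: tz_def)
    moreover from this have "i \<in> {1..n}" using ws(3) by force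
    ultimately show ?thesis using ok \<tau>E by simp
  qed
  define I where "I = {i. Some i \<in> fst ` set tz}"
  have Ieq: "fst ` set tz = (\<lambda>k. lab (\<tau> k)) ` {1..n}"
    unfolding ws(3)[symmetric] by (simp add: tz_def image_image case_prod_beta)
  have "card (block_basis I) \<le> dA" unfolding I_def
  proof (rule nonzero_product_labels[OF _ tz_ok])
    show "tz \<noteq> []" using ws(1) by (simp add: tz_def)
    show "nonunital_prod (map snd tz) \<noteq> 0" unfolding snd_tz using nz by (simp add: monomial_def)
  qed
  moreover have "I \<subseteq> {1..q}"
    using tz_ok by (force simp: I_def label_ok_def)
  moreover have "\<tau> \<in> {1..n} \<rightarrow>\<^sub>E (block_basis I \<union> EJ)"
  proof -
    have "\<tau> k \<in> block_basis I \<union> EJ" if k: "k \<in> {1..n}" for k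
    proof (cases "\<tau> k \<in> EJ")
      case False
      then obtain i where i: "i \<in> {1..q}" "\<tau> k \<in> Es i" using \<tau>E[OF k] E_eq by auto
      then have "lab (\<tau> k) = Some i" using lab_Some by simp
      then have "i \<in> I" unfolding I_def Ieq using k by (metis (mono_tags, lifting) image_eqI mem_Collect_eq)
      then show ?thesis using i by (auto simp: block_basis_def)
    qed simp
    then show ?thesis using \<tau>(1) by (auto simp: PiE_iff)
  qed
  moreover have "card {k\<in>{1..n}. \<tau> k \<in> EJ} \<le> p"
  proof (rule ccontr)
    assume many: "\<not> ?thesis"
    have "length (filter (\<lambda>(i, h). \<tau> i \<in> EJ) ws) = card {k\<in>{1..n}. \<tau> k \<in> EJ}"
    proof -
      have "length (filter (\<lambda>(i, h). \<tau> i \<in> EJ) ws) = length (filter (\<lambda>i. \<tau> i \<in> EJ) (map fst ws))"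
        by (induction ws) auto
      also have "\<dots> = card (set (filter (\<lambda>i. \<tau> i \<in> EJ) (map fst ws)))"
        using ws(2) by (intro distinct_card[symmetric]) simp
      finally show ?thesis by (simp add: ws(3)[unfolded set_map])
    qed
    moreover have "length (filter (\<lambda>(i, h). \<tau> i \<in> EJ) ws) \<le> length (filter (\<lambda>z. z \<in> J) (map snd tz))"
    proof -
      have "act h (\<tau> i) \<in> J" if "\<tau> i \<in> EJ" for i h
        using that J_invariant EJ_span A.span_base[of "\<tau> i" EJ] by (simp add: H_invariant_def)
      then show ?thesis unfolding snd_tz by (induction ws) auto
    qed
    ultimately have "nonunital_prod (map snd tz) = 0" using many by (intro p) simp
    then show False using nz snd_tz by (simp add: monomial_def)
  qed
  ultimately have "\<tau> \<in> good_tuples p n" unfolding good_tuples_def by blast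
  then show False using \<tau>(2) by simp
qed

lemma good_tuples_test:
  assumes p: "\<And>zs. p \<le> length (filter (\<lambda>z. z \<in> J) zs) \<Longrightarrow> nonunital_prod zs = 0"
  shows "test_set n (good_tuples p n)"
  unfolding test_set_def
proof (intro allI impI)
  fix F a assume F: "multilin {1..n} F" and z: "\<forall>\<tau>\<in>good_tuples p n. F \<tau> = 0"
  have "F \<tau> = 0" if \<tau>: "\<tau> \<in> {1..n} \<rightarrow>\<^sub>E E" for \<tau>
  proof (cases "\<tau> \<in> good_tuples p n")
    case False
    show ?thesis using F
      by induction (use False \<tau> monomial_zero_outside_good[OF p] in auto)
  qed (use z in simp)
  then show "F a = 0" using basis_tuples_test[of n] F unfolding test_set_def by blast
qed

text \<open>Give the basis elements of \<open>J\<close> the weight \<open>x\<close> and all others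
  the weight 1. The total weight of all tuples with entries in \<open>block_basis I \<union>
  EJ\<close> is the \<open>n\<close>-th power of the sum of the weights, and a tuple with at most
  \<open>p\<close> entries from \<open>EJ\<close> has weight at least \<open>x\<^sup>p\<close>.
  Later \<open>x\<close> tends to 0.\<close>

lemma card_good_tuples:
  assumes x: "0 < x" "x \<le> (1::real)"
  shows "finite (good_tuples p n)"
    and "real (card (good_tuples p n)) \<le> 2 ^ q * ((real dA + x * real (card E)) ^ n / x ^ p)"
proof -
  let ?\<I> = "{I. I \<subseteq> {1..q} \<and> card (block_basis I) \<le> dA}"
  define T where "T I = {\<tau>\<in>{1..n} \<rightarrow>\<^sub>E (block_basis I \<union> EJ). card {k\<in>{1..n}. \<tau> k \<in> EJ} \<le> p}" for I
  have EJE: "EJ \<subseteq> E" by (simp add: E_eq)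
  have finEJ: "finite EJ" using EJE A.finite_Basis finite_subset by blast
  have finEI: "finite (block_basis I)" if "I \<in> ?\<I>" for I
    using block_basis_subset[of I] that A.finite_Basis finite_subset by blast
  have finP: "finite ({1..n} \<rightarrow>\<^sub>E (block_basis I \<union> EJ))" if "I \<in> ?\<I>" for I
    using finEI[OF that] finEJ by (intro finite_PiE) auto
  have finT: "finite (T I)" if "I \<in> ?\<I>" for I
    using finP[OF that] by (auto simp: T_def)
  have good: "good_tuples p n = (\<Union>I\<in>?\<I>. T I)" by (simp add: good_tuples_def T_def)
  then show "finite (good_tuples p n)" using finT by auto
  define w where "w e = (if e \<in> EJ then x else 1)" for e
  have T: "real (card (T I)) * x ^ p \<le> (real dA + x * real (card E)) ^ n" if I: "I \<in> ?\<I>" for I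
  proof -
    have "real (card (T I)) * x ^ p = (\<Sum>\<tau>\<in>T I. x ^ p)" by simp
    also have "\<dots> \<le> (\<Sum>\<tau>\<in>T I. \<Prod>k\<in>{1..n}. w (\<tau> k))"
    proof (rule sum_mono)
      fix \<tau> assume \<tau>: "\<tau> \<in> T I"
      have "(\<Prod>k\<in>{1..n}. w (\<tau> k)) = x ^ card {k\<in>{1..n}. \<tau> k \<in> EJ}"
        by (simp add: w_def prod.If_cases Int_def)
      then show "x ^ p \<le> (\<Prod>k\<in>{1..n}. w (\<tau> k))"
        using x \<tau> by (simp add: T_def power_decreasing)
    qed
    also have "\<dots> \<le> (\<Sum>\<tau>\<in>{1..n} \<rightarrow>\<^sub>E (block_basis I \<union> EJ). \<Prod>k\<in>{1..n}. w (\<tau> k))"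
      using finP[OF I] x by (intro sum_mono2) (auto simp: T_def w_def intro!: prod_nonneg)
    also have "\<dots> = (\<Sum>e\<in>block_basis I \<union> EJ. w e) ^ n"
      using prod_sum_PiE[of "{1..n}" "\<lambda>_. block_basis I \<union> EJ" "\<lambda>_. w"] finEI[OF I] finEJ by simp
    also have "\<dots> \<le> (real dA + x * real (card E)) ^ n"
    proof (rule power_mono)
      have "block_basis I \<inter> EJ = {}" using EJ_disjoint I unfolding block_basis_def by blast
      then have "(\<Sum>e\<in>block_basis I \<union> EJ. w e) = (\<Sum>e\<in>block_basis I. w e) + (\<Sum>e\<in>EJ. w e)"
        using finEI[OF I] finEJ by (intro sum.union_disjoint)
      moreover have "(\<Sum>e\<in>block_basis I. w e) \<le> (\<Sum>e\<in>block_basis I. 1)" using x by (intro sum_mono) (auto simp: w_def)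
      moreover have "(\<Sum>e\<in>block_basis I. 1) \<le> real dA" using I by simp
      moreover have "(\<Sum>e\<in>EJ. w e) = x * real (card EJ)" by (simp add: w_def)
      moreover have "x * real (card EJ) \<le> x * real (card E)"
        using card_mono[OF A.finite_Basis EJE] x by simp
      ultimately show "(\<Sum>e\<in>block_basis I \<union> EJ. w e) \<le> real dA + x * real (card E)" by linarith
      show "0 \<le> (\<Sum>e\<in>block_basis I \<union> EJ. w e)" using x by (intro sum_nonneg) (simp add: w_def)
    qed
    finally show ?thesis .
  qed
  have fin\<I>: "finite ?\<I>" by (rule finite_subset[of _ "Pow {1..q}"]) auto
  have "card ?\<I> \<le> card (Pow {1..q})" by (rule card_mono) auto
  then have card\<I>: "card ?\<I> \<le> 2 ^ q" by (simp add: card_Pow)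
  have "real (card ?\<I>) \<le> 2 ^ q"
    using of_nat_mono[OF card\<I>, where ?'a = real] by simp
  have "card (good_tuples p n) \<le> (\<Sum>I\<in>?\<I>. card (T I))" unfolding good by (rule card_UN_le[OF fin\<I>])
  from of_nat_mono[OF this, where ?'a = real]
  have "real (card (good_tuples p n)) \<le> (\<Sum>I\<in>?\<I>. real (card (T I)))" by simp
  also have "\<dots> \<le> (\<Sum>I\<in>?\<I>. (real dA + x * real (card E)) ^ n / x ^ p)"
    using T x by (intro sum_mono) (simp add: pos_le_divide_eq)
  also have "\<dots> = real (card ?\<I>) * ((real dA + x * real (card E)) ^ n / x ^ p)" by simp
  also have "\<dots> \<le> 2 ^ q * ((real dA + x * real (card E)) ^ n / x ^ p)"
    using \<open>real (card ?\<I>) \<le> 2 ^ q\<close> x by (intro mult_right_mono) auto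
  finally show "real (card (good_tuples p n)) \<le> 2 ^ q * ((real dA + x * real (card E)) ^ n / x ^ p)" .
qed

theorem codim_upper_bound:
  assumes x: "0 < x" "x \<le> (1::real)"
  obtains C where "C > 0" "\<And>n. n \<ge> 1 \<Longrightarrow> real (H_codim sH sA act \<Gamma> n) \<le> C * (real dA + x * real (card E)) ^ n"
proof -
  obtain p where p: "\<And>zs. p \<le> length (filter (\<lambda>z. z \<in> J) zs) \<Longrightarrow> nonunital_prod zs = 0"
    using A.radical_nilpotent unfolding J_radical by metis
  define C where "C = 2 ^ q / x ^ p * (real (card E) + 1)"
  have "C > 0" using x by (auto simp: C_def intro!: mult_pos_pos divide_pos_pos)
  moreover have "real (H_codim sH sA act \<Gamma> n) \<le> C * (real dA + x * real (card E)) ^ n" if n: "n \<ge> 1" for n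
  proof -
    have "H_codim sH sA act \<Gamma> n \<le> card (good_tuples p n) * card E"
      by (rule H_codim_le[OF n card_good_tuples(1)[OF x] good_tuples_test[OF p]])
    from of_nat_mono[OF this, where ?'a = real]
    have "real (H_codim sH sA act \<Gamma> n) \<le> real (card (good_tuples p n)) * real (card E)" by simp
    also have "\<dots> \<le> (2 ^ q * ((real dA + x * real (card E)) ^ n / x ^ p)) * (real (card E) + 1)"
      using card_good_tuples(2)[OF x, of p n] x by (intro mult_mono) auto
    finally show ?thesis by (simp add: C_def mult_ac)
  qed
  ultimately show thesis using that by blast
qed

end

section \<open>Density and the trace form\<close>

text \<open>A polynomial \<open>p\<close> of least degree with \<open>p(\<theta>) v\<^sub>0 =
  0\<close> has a root \<open>z\<close>; writing \<open>p = (X - z) r\<close>, the vector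
  \<open>r(\<theta>) v\<^sub>0\<close> is an eigenvector.\<close>

lemma eigenvector_exists:
  fixes scale :: "'f::alg_closed_field \<Rightarrow> 'a::ring \<Rightarrow> 'a"
  assumes "fd_algebra scale E"
    and V: "module.subspace scale V" and v0: "v0 \<in> V" "v0 \<noteq> 0"
    and maps: "\<And>x. x \<in> V \<Longrightarrow> \<theta> x \<in> V"
    and add: "\<And>x y. x \<in> V \<Longrightarrow> y \<in> V \<Longrightarrow> \<theta> (x + y) = \<theta> x + \<theta> y"
    and scl: "\<And>c x. x \<in> V \<Longrightarrow> \<theta> (scale c x) = scale c (\<theta> x)"
  obtains v \<mu> where "v \<in> V" "v \<noteq> 0" "\<theta> v = scale \<mu> v"
proof -
  interpret fd_algebra scale E by fact
  define pw where "pw i = (\<theta> ^^ i) v0" for i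
  have pwV: "pw i \<in> V" for i by (induction i) (auto simp: pw_def v0 maps)
  have pwS: "pw (Suc i) = \<theta> (pw i)" for i by (simp add: pw_def)
  define ap where "ap p = (\<Sum>i\<le>degree p. scale (coeff p i) (pw i))" for p
  have ap_ge: "ap p = (\<Sum>i\<le>n. scale (coeff p i) (pw i))" if "n \<ge> degree p" for p n
    unfolding ap_def using that by (intro sum.mono_neutral_left) (auto simp: coeff_eq_0)
  have sumV: "(\<Sum>i\<in>I. scale (c i) (pw i)) \<in> V" for I c
    using pwV V by (intro subspace_sum subspace_scale) auto
  have \<theta>sum: "\<theta> (\<Sum>i\<in>I. scale (c i) (pw i)) = (\<Sum>i\<in>I. scale (c i) (pw (Suc i)))" if "finite I" for I c
    using that
  proof (induction I rule: finite_induct)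
    case empty
    show ?case using scl[OF v0(1), of 0] by simp
  next
    case (insert i I)
    have "\<theta> (scale (c i) (pw i) + (\<Sum>i\<in>I. scale (c i) (pw i)))
        = \<theta> (scale (c i) (pw i)) + \<theta> (\<Sum>i\<in>I. scale (c i) (pw i))"
      by (intro add subspace_scale V pwV sumV)
    then show ?case using insert by (simp add: scl[OF pwV] pwS)
  qed
  have "card E < card {..card E}" by simp
  from nontrivial_solution[OF finite_Basis _ this, of "\<lambda>i. coord (pw i)"]
  obtain u where u: "\<exists>i\<in>{..card E}. u i \<noteq> 0" "\<And>e. e \<in> E \<Longrightarrow> (\<Sum>i\<le>card E. u i * coord (pw i) e) = 0"
    by auto
  define p0 where "p0 = (\<Sum>i\<le>card E. monom (u i) i)"
  have c0: "coeff p0 i = (if i \<le> card E then u i else 0)" for i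
    by (simp add: p0_def coeff_sum coeff_monom sum.delta)
  have "p0 \<noteq> 0" using u(1) c0 by (metis atMost_iff coeff_0)
  moreover have "ap p0 = 0"
  proof (rule coord_eqI)
    fix e assume e: "e \<in> E"
    have deg: "degree p0 \<le> card E" using c0 by (intro degree_le) simp
    show "coord (ap p0) e = coord 0 e"
      using u(2)[OF e] by (simp add: ap_ge[OF deg] coord_sum coord_scale c0)
  qed
  ultimately obtain p where p: "p \<noteq> 0" "ap p = 0" "\<And>q. q \<noteq> 0 \<Longrightarrow> ap q = 0 \<Longrightarrow> degree p \<le> degree q"
    using ex_has_least_nat[of "\<lambda>p. p \<noteq> 0 \<and> ap p = 0" p0 degree] by blast
  have "degree p > 0"
  proof (rule ccontr)
    assume "\<not> ?thesis"
    then have "degree p = 0" by simp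
    then have "ap p = scale (coeff p 0) v0" "coeff p 0 \<noteq> 0"
      using p(1) leading_coeff_neq_0[of p] by (auto simp: ap_def pw_def)
    then show False using p(2) v0 by simp
  qed
  then obtain z where "poly p z = 0" using alg_closed_imp_poly_has_root by blast
  then obtain r where r: "p = [:- z, 1:] * r" by (metis dvdE poly_eq_0_iff_dvd)
  have rnz: "r \<noteq> 0" using r p(1) by auto
  have "degree p = degree [:- z, 1:] + degree r" unfolding r using rnz by (intro degree_mult_eq) auto
  then have degp: "degree p = Suc (degree r)" by simp
  have cf: "coeff p i = - z * coeff r i + coeff (pCons 0 r) i" for i
    by (simp add: r mult_pCons_left)
  have "ap p = scale (- z) (ap r) + \<theta> (ap r)"
  proof -
    have "ap p = (\<Sum>i\<le>Suc (degree r). scale (- z) (scale (coeff r i) (pw i)) + scale (coeff (pCons 0 r) i) (pw i))"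
      unfolding ap_def degp cf by (simp only: scale_left_distrib scale_scale)
    also have "\<dots> = scale (- z) (\<Sum>i\<le>Suc (degree r). scale (coeff r i) (pw i))
        + (\<Sum>i\<le>Suc (degree r). scale (coeff (pCons 0 r) i) (pw i))"
      by (simp only: sum.distrib scale_sum_right)
    also have "(\<Sum>i\<le>Suc (degree r). scale (coeff (pCons 0 r) i) (pw i)) = (\<Sum>i\<le>degree r. scale (coeff r i) (pw (Suc i)))"
      by (subst sum.atMost_Suc_shift) simp
    also have "\<dots> = \<theta> (ap r)" by (simp add: ap_def \<theta>sum)
    also have "(\<Sum>i\<le>Suc (degree r). scale (coeff r i) (pw i)) = ap r" by (rule ap_ge[symmetric]) simp
    finally show ?thesis .
  qed
  then have "\<theta> (ap r) = scale z (ap r)" using p(2) by (simp add: eq_neg_iff_add_eq_0[symmetric] add.commute)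
  moreover have "ap r \<noteq> 0" using p(3)[OF rnz] degp by auto
  moreover have "ap r \<in> V" unfolding ap_def by (rule sumV)
  ultimately show thesis using that by blast
qed

locale closed_structured_action = structured_action sH sA act \<Gamma> E J q Bs Es EJ
  for sH :: "'f::{alg_closed_field, field_char_0} \<Rightarrow> 'h::ring_1 \<Rightarrow> 'h"
    and sA :: "'f \<Rightarrow> 'a::ring \<Rightarrow> 'a"
    and act :: "'h \<Rightarrow> 'a \<Rightarrow> 'a" and \<Gamma> :: "'h set" and E :: "'a set"
    and J :: "'a set" and q :: nat and Bs :: "nat \<Rightarrow> 'a set" and Es :: "nat \<Rightarrow> 'a set" and EJ :: "'a set"
begin

subsection \<open>Density\<close>

text \<open>Operators on \<open>A\<close> that involve at least one multiplication by an element
  of the block \<open>k\<close>. For this reason they kill all other blocks.\<close>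

inductive block_op :: "nat \<Rightarrow> ('a \<Rightarrow> 'a) \<Rightarrow> bool" for k where
  left: "u \<in> Bs k \<Longrightarrow> block_op k (\<lambda>x. u * x)"
| right: "u \<in> Bs k \<Longrightarrow> block_op k (\<lambda>x. x * u)"
| add: "block_op k S \<Longrightarrow> block_op k T \<Longrightarrow> block_op k (\<lambda>x. S x + T x)"
| scale: "block_op k T \<Longrightarrow> block_op k (\<lambda>x. sA c (T x))"
| comp: "block_op k S \<Longrightarrow> block_op k T \<Longrightarrow> block_op k (\<lambda>x. S (T x))"
| act_left: "block_op k T \<Longrightarrow> block_op k (\<lambda>x. act h (T x))"
| act_right: "block_op k T \<Longrightarrow> block_op k (\<lambda>x. T (act h x))"

lemma block_op_linear:
  assumes "block_op k T"
  shows block_op_add: "T (x + y) = T x + T y" and block_op_scale: "T (sA c x) = sA c (T x)"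
proof -
  have "\<forall>x y c. T (x + y) = T x + T y \<and> T (sA c x) = sA c (T x)"
    using assms by induction (auto simp: distrib_left distrib_right A.scale_mult_left[symmetric] A.scale_mult_right[symmetric]
      act_plus act_sA A.scale_right_distrib mult.commute)
  then show "T (x + y) = T x + T y" "T (sA c x) = sA c (T x)" by auto
qed

lemma block_op_0: "block_op k T \<Longrightarrow> T 0 = 0"
  using block_op_scale[of k T 0 0] by simp

lemma block_op_maps: "block_op k T \<Longrightarrow> k \<in> {1..q} \<Longrightarrow> x \<in> Bs k \<Longrightarrow> T x \<in> Bs k"
  by (induction arbitrary: x rule: block_op.induct)
    (blast intro: Bs_mult Bs_act A.subspace_add A.subspace_scale Bs_sub)+

lemma block_op_kills: "block_op k T \<Longrightarrow> k \<in> {1..q} \<Longrightarrow> l \<in> {1..q} \<Longrightarrow> l \<noteq> k \<Longrightarrow> x \<in> Bs l \<Longrightarrow> T x = 0"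
  by (induction arbitrary: x rule: block_op.induct) (auto simp: block_op_0 Bs_orth Bs_act)

lemma block_op_zero: "k \<in> {1..q} \<Longrightarrow> block_op k (\<lambda>_. 0)"
  using block_op.left[OF A.subspace_0[OF Bs_sub]] by simp

text \<open>An algebra with zero multiplication is its own radical.\<close>

lemma Bs_not_null:
  assumes k: "k \<in> {1..q}"
  shows "\<exists>x\<in>Bs k. \<exists>y\<in>Bs k. x * y \<noteq> 0"
proof (rule ccontr)
  assume "\<not> ?thesis"
  then have null: "\<And>x. x \<in> Bs k \<Longrightarrow> pow1 x 1 = 0" by simp
  have "is_subalgebra sA (Bs k)" using Bs_simple[OF k] by (simp add: H_simple_def)
  moreover have "left_ideal sA (Bs k) (Bs k)"
    using Bs_sub[OF k] Bs_mult[OF k] by (simp add: left_ideal_def)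
  ultimately have "Bs k \<subseteq> jacobson_radical sA (Bs k)"
    using A.nil_left_ideal_subset_radical null by blast
  then have "Bs k \<subseteq> {0}" using Bs_semisimple[OF k] by (simp add: semisimple_algebra_def)
  then show False using Bs_nonzero[OF k] A.subspace_0[OF Bs_sub[OF k]] by blast
qed

lemma Bs_ideal_trivial:
  assumes "k \<in> {1..q}" "A.subspace I" "I \<subseteq> Bs k" "\<And>r x. r \<in> Bs k \<Longrightarrow> x \<in> I \<Longrightarrow> r * x \<in> I"
    "\<And>r x. r \<in> Bs k \<Longrightarrow> x \<in> I \<Longrightarrow> x * r \<in> I" "\<And>h x. x \<in> I \<Longrightarrow> act h x \<in> I"
  shows "I = {0} \<or> I = Bs k"
proof -
  have "two_sided_ideal sA (Bs k) I" "H_invariant act I"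
    using assms by (auto simp: two_sided_ideal_def H_invariant_def)
  then show ?thesis using Bs_simple[OF assms(1)] by (auto simp: H_simple_def)
qed

lemma block_op_span:
  assumes "block_op k T" "x \<in> A.span X" "\<And>y. y \<in> X \<Longrightarrow> T y \<in> V" "A.subspace V"
  shows "T x \<in> V"
  using assms(2)
proof (induction rule: A.span_induct_alt)
  case base
  then show ?case using assms(4) block_op_0[OF assms(1)] by (simp add: A.subspace_0)
next
  case (step c x y)
  then show ?case using assms
    by (simp add: block_op_add[OF assms(1)] block_op_scale[OF assms(1)] A.subspace_add A.subspace_scale)
qed

lemma act_span:
  assumes "x \<in> A.span X" "\<And>y. y \<in> X \<Longrightarrow> act h y \<in> V" "A.subspace V"
  shows "act h x \<in> V"
  using assms(1)
proof (induction rule: A.span_induct_alt)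
  case base
  then show ?case using assms(3) by (simp add: A.subspace_0)
next
  case (step c x y)
  then show ?case using assms by (simp add: act_plus act_sA A.subspace_add A.subspace_scale)
qed

text \<open>If all these operators killed \<open>x\<close>, then the \<open>H\<close>-submodule
  generated by \<open>x\<close> would be an invariant ideal with zero multiplication.\<close>

lemma block_op_nonzero:
  assumes k: "k \<in> {1..q}" and x: "x \<in> Bs k" "x \<noteq> 0"
  shows "\<exists>T. block_op k T \<and> T x \<noteq> 0"
proof (rule ccontr)
  assume "\<not> ?thesis"
  then have z: "T x = 0" if "block_op k T" for T using that by blast
  define N where "N = A.span (range (\<lambda>h. act h x))"
  have kill: "T y \<in> {0}" if "block_op k T" "y \<in> N" for T y
    by (rule block_op_span[OF that(1) that(2)[unfolded N_def]])
      (use z block_op.act_right[OF that(1)] in \<open>auto\<close>)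
  have N0: "0 \<in> N" by (simp add: N_def A.span_zero)
  have "N = {0} \<or> N = Bs k"
  proof (rule Bs_ideal_trivial[OF k])
    show "A.subspace N" by (simp add: N_def)
    show "N \<subseteq> Bs k" unfolding N_def
      by (rule A.span_minimal[OF _ Bs_sub[OF k]]) (use x Bs_act[OF k] in auto)
    show "r * y \<in> N" if "r \<in> Bs k" "y \<in> N" for r y
      using kill[OF block_op.left[OF that(1)] that(2)] N0 by simp
    show "y * r \<in> N" if "r \<in> Bs k" "y \<in> N" for r y
      using kill[OF block_op.right[OF that(1)] that(2)] N0 by simp
    show "act h y \<in> N" if "y \<in> N" for h y
    proof (rule act_span[OF that[unfolded N_def]])
      show "act h w \<in> N" if w: "w \<in> range (\<lambda>h. act h x)" for w
      proof -
        obtain g where "w = act g x" using w by blast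
        then have "act h w = act (h * g) x" by (simp add: act_mult)
        then show ?thesis unfolding N_def by (intro A.span_base) blast
      qed
    qed (simp add: N_def)
  qed
  moreover have "x \<in> N" unfolding N_def using act_one[of x] by (intro A.span_base) (metis rangeI)
  ultimately have "N = Bs k" using x by blast
  then show False using Bs_not_null[OF k] kill block_op.left by blast
qed

lemma block_op_irreducible:
  assumes k: "k \<in> {1..q}" and U: "A.subspace U" "U \<subseteq> Bs k" "U \<noteq> {0}"
    and inv: "\<And>T x. block_op k T \<Longrightarrow> x \<in> U \<Longrightarrow> T x \<in> U"
  shows "U = Bs k"
proof -
  define X where "X = {T x | T x. block_op k T \<and> x \<in> U}"
  define M where "M = A.span X"
  have XI: "T x \<in> X" if "block_op k T" "x \<in> U" for T x using that unfolding X_def by blast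
  have XU: "X \<subseteq> U" using inv by (auto simp: X_def)
  have MU: "M \<subseteq> U" unfolding M_def by (rule A.span_minimal[OF XU U(1)])
  have "M = {0} \<or> M = Bs k"
  proof (rule Bs_ideal_trivial[OF k])
    show "A.subspace M" by (simp add: M_def)
    show "M \<subseteq> Bs k" using MU U by blast
    show "r * x \<in> M" if "r \<in> Bs k" "x \<in> M" for r x
    proof -
      have "x \<in> U" using that MU by blast
      then have "r * x \<in> X" using XI[OF block_op.left[OF that(1)]] by simp
      then show ?thesis unfolding M_def by (rule A.span_base)
    qed
    show "x * r \<in> M" if "r \<in> Bs k" "x \<in> M" for r x
    proof -
      have "x \<in> U" using that MU by blast
      then have "x * r \<in> X" using XI[OF block_op.right[OF that(1)]] by simp
      then show ?thesis unfolding M_def by (rule A.span_base)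
    qed
    show "act h x \<in> M" if "x \<in> M" for h x
    proof (rule act_span[OF that[unfolded M_def]])
      show "act h y \<in> M" if y: "y \<in> X" for y
      proof -
        obtain T x where "block_op k T" "x \<in> U" "y = T x" using y unfolding X_def by blast
        then have "act h y \<in> X" using XI[OF block_op.act_left] by blast
        then show ?thesis unfolding M_def by (rule A.span_base)
      qed
    qed (simp add: M_def)
  qed
  moreover have "M \<noteq> {0}"
  proof -
    obtain x where x: "x \<in> U" "x \<noteq> 0" using U A.subspace_0[OF U(1)] by blast
    then obtain T where T: "block_op k T" "T x \<noteq> 0" using block_op_nonzero[OF k] U by blast
    then have "T x \<in> M" unfolding M_def using XI x by (intro A.span_base) blast
    then show ?thesis using T by blast
  qed
  ultimately show ?thesis using MU U by blast
qed

lemma block_op_transitive: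
  assumes k: "k \<in> {1..q}" and x: "x \<in> Bs k" "x \<noteq> 0" and b: "b \<in> Bs k"
  shows "\<exists>T. block_op k T \<and> T x = b"
proof -
  define U where "U = {T x | T. block_op k T}"
  have UI: "T x \<in> U" if "block_op k T" for T using that unfolding U_def by blast
  have UE: "\<exists>T. block_op k T \<and> y = T x" if "y \<in> U" for y using that unfolding U_def by blast
  have "U = Bs k"
  proof (rule block_op_irreducible[OF k])
    show "A.subspace U"
    proof (rule A.subspaceI)
      show "0 \<in> U" using UI[OF block_op_zero[OF k]] .
      show "y + z \<in> U" if "y \<in> U" "z \<in> U" for y z
        using UE[OF that(1)] UE[OF that(2)] UI[OF block_op.add] by auto
      show "sA c y \<in> U" if "y \<in> U" for c y
        using UE[OF that] UI[OF block_op.scale] by auto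
    qed
    show "U \<subseteq> Bs k" using UE block_op_maps k x by blast
    show "U \<noteq> {0}" using block_op_nonzero[OF k x] UI by blast
    show "T y \<in> U" if "block_op k T" "y \<in> U" for T y
      using UE[OF that(2)] UI[OF block_op.comp[OF that(1)]] by auto
  qed
  then show ?thesis using b UE by blast
qed

text \<open>The density theorem. For the step from \<open>Y\<close> to \<open>Y \<union>
  {y}\<close>, assume that every operator which kills \<open>Y\<close> and \<open>y\<close> also
  kills \<open>x\<close>. Then \<open>T y \<mapsto> T x\<close>, for operators \<open>T\<close>
  that kill \<open>Y\<close>, is a well-defined module endomorphism of the block, hence a scalar
  \<open>\<mu>\<close> by Schur's lemma. So every such \<open>T\<close> kills \<open>x - \<mu>
  y\<close>, and by induction \<open>x - \<mu> y\<close> lies in the span of \<open>Y\<close>.\<close>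

lemma block_op_separates:
  assumes k: "k \<in> {1..q}" and "finite X" "X \<subseteq> Bs k" "x \<in> Bs k" "x \<notin> A.span X"
  shows "\<exists>T. block_op k T \<and> (\<forall>y\<in>X. T y = 0) \<and> T x \<noteq> 0"
  using assms(2-)
proof (induction X arbitrary: x rule: finite_induct)
  case empty
  then show ?case using block_op_nonzero[OF k] by simp
next
  case (insert y Y)
  define I where "I T \<longleftrightarrow> block_op k T \<and> (\<forall>w\<in>Y. T w = 0)" for T
  have I_add: "I (\<lambda>x. S x + T x)" if "I S" "I T" for S T using that block_op.add by (auto simp: I_def)
  have I_scale: "I (\<lambda>x. sA c (T x))" if "I T" for T c using that block_op.scale by (auto simp: I_def)
  have I_comp: "I (\<lambda>x. S (T x))" if "block_op k S" "I T" for S T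
    using that block_op.comp block_op_0 by (auto simp: I_def)
  have IH: "\<exists>T. I T \<and> T z \<noteq> 0" if "z \<in> Bs k" "z \<notin> A.span Y" for z
    using insert.IH[of z] that insert.prems by (auto simp: I_def)
  have yB: "y \<in> Bs k" using insert.prems by simp
  have xY: "x \<notin> A.span Y" using insert.prems A.span_mono[of Y "insert y Y"] by blast
  show ?case
  proof (cases "y \<in> A.span Y")
    case True
    obtain T where T: "I T" "T x \<noteq> 0" using IH xY insert.prems by blast
    have "T y \<in> {0}"
      by (rule block_op_span[OF _ True]) (use T in \<open>auto simp: I_def\<close>)
    then show ?thesis using T by (auto simp: I_def)
  next
    case False
    show ?thesis
    proof (rule ccontr)
      assume "\<not> ?thesis"
      then have no: "T x = 0" if "I T" "T y = 0" for T using that by (auto simp: I_def)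
      define U where "U = {T y | T. I T}"
      have UI: "T y \<in> U" if "I T" for T using that unfolding U_def by blast
      have UE: "\<exists>T. I T \<and> v = T y" if "v \<in> U" for v using that unfolding U_def by blast
      have I_zero: "I (\<lambda>_. 0)" using block_op_zero[OF k] by (simp add: I_def)
      have UB: "U = Bs k"
      proof (rule block_op_irreducible[OF k])
        show "A.subspace U"
        proof (rule A.subspaceI)
          show "0 \<in> U" using UI[OF I_zero] .
          show "v + z \<in> U" if "v \<in> U" "z \<in> U" for v z
            using UE[OF that(1)] UE[OF that(2)] UI[OF I_add] by auto
          show "sA c v \<in> U" if "v \<in> U" for c v
            using UE[OF that] UI[OF I_scale] by auto
        qed
        show "U \<subseteq> Bs k" using block_op_maps k yB UE unfolding I_def by blast
        show "U \<noteq> {0}" using IH[OF yB False] UI by blast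
        show "T v \<in> U" if "block_op k T" "v \<in> U" for T v
          using UE[OF that(2)] UI[OF I_comp[OF that(1)]] by auto
      qed
      define \<theta> where "\<theta> v = (SOME T. I T \<and> T y = v) x" for v
      have \<theta>: "\<theta> (T y) = T x" if T: "I T" for T
      proof -
        define S where "S = (SOME S. I S \<and> S y = T y)"
        have "\<exists>S. I S \<and> S y = T y" using T by blast
        then have S: "I S \<and> S y = T y" unfolding S_def by (rule someI_ex)
        have IST: "I (\<lambda>x. S x + sA (-1) (T x))"
          by (rule I_add[OF conjunct1[OF S] I_scale[OF T]])
        have "S y + sA (- 1) (T y) = 0" using S by simp
        from no[OF IST this] have "S x = T x" by simp
        moreover have "\<theta> (T y) = S x" by (simp only: \<theta>_def S_def)
        ultimately show ?thesis by simp
      qed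
      have ex: "\<exists>T. I T \<and> v = T y" if "v \<in> Bs k" for v using that UB UE by blast
      obtain v \<mu> where v: "v \<in> Bs k" "v \<noteq> 0" "\<theta> v = sA \<mu> v"
      proof (rule eigenvector_exists[OF A.fd_algebra_axioms Bs_sub[OF k] yB, of \<theta>])
        show "y \<noteq> 0" using False A.span_zero by blast
        show "\<theta> w \<in> Bs k" if "w \<in> Bs k" for w
          using ex[OF that] \<theta> block_op_maps k insert.prems by (auto simp: I_def)
        show "\<theta> (w + z) = \<theta> w + \<theta> z" if wz: "w \<in> Bs k" "z \<in> Bs k" for w z
        proof -
          obtain S T where "I S" "w = S y" "I T" "z = T y" using ex wz by metis
          then show ?thesis using \<theta>[OF I_add, of S T] \<theta> by simp
        qed
        show "\<theta> (sA c w) = sA c (\<theta> w)" if w: "w \<in> Bs k" for c w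
        proof -
          obtain T where "I T" "w = T y" using ex w by metis
          then show ?thesis using \<theta>[OF I_scale, of T c] \<theta> by simp
        qed
      qed blast
      define K where "K = {w\<in>Bs k. \<theta> w = sA \<mu> w}"
      have "K = Bs k"
      proof (rule block_op_irreducible[OF k])
        show "A.subspace K"
        proof (rule A.subspaceI)
          from \<theta>[OF I_zero] show "0 \<in> K" using A.subspace_0[OF Bs_sub[OF k]] by (simp add: K_def)
          show "w + z \<in> K" if wz: "w \<in> K" "z \<in> K" for w z
          proof -
            obtain S T where "I S" "w = S y" "I T" "z = T y" using ex wz unfolding K_def by blast
            then show ?thesis using \<theta>[OF I_add, of S T] \<theta> wz A.subspace_add[OF Bs_sub[OF k]]
              by (auto simp: K_def A.scale_right_distrib)
          qed
          show "sA c w \<in> K" if w: "w \<in> K" for c w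
          proof -
            obtain T where "I T" "w = T y" using ex w unfolding K_def by blast
            then show ?thesis using \<theta>[OF I_scale, of T c] \<theta> w A.subspace_scale[OF Bs_sub[OF k]]
              by (auto simp: K_def mult.commute)
          qed
        qed
        show "K \<subseteq> Bs k" by (auto simp: K_def)
        show "K \<noteq> {0}" using v by (auto simp: K_def)
        show "S w \<in> K" if S: "block_op k S" and w: "w \<in> K" for S w
        proof -
          obtain T where T: "I T" "w = T y" using ex w unfolding K_def by blast
          have "T x = sA \<mu> (T y)" using \<theta>[OF T(1)] w T by (simp add: K_def)
          then have "\<theta> (S w) = sA \<mu> (S w)"
            using \<theta>[OF I_comp[OF S T(1)]] T block_op_scale[OF S] by simp
          then show ?thesis using w block_op_maps[OF S k] by (simp add: K_def)
        qed
      qed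
      have eq: "T x = sA \<mu> (T y)" if T: "I T" for T
      proof -
        have "T y \<in> Bs k" using block_op_maps[of k T y] k yB T by (simp add: I_def)
        then have "T y \<in> K" using \<open>K = Bs k\<close> by simp
        then show ?thesis using \<theta>[OF T] by (simp add: K_def)
      qed
      define z where "z = x - sA \<mu> y"
      have zB: "z \<in> Bs k" unfolding z_def using insert.prems yB
        by (intro A.subspace_diff A.subspace_scale Bs_sub k) auto
      have "z \<notin> A.span Y"
      proof
        assume "z \<in> A.span Y"
        then have "z + sA \<mu> y \<in> A.span (insert y Y)"
          using A.span_mono[of Y "insert y Y"] by (intro A.span_add A.span_scale) (auto intro: A.span_base)
        then show False using insert.prems by (simp add: z_def)
      qed
      then obtain T where T: "I T" "T z \<noteq> 0" using IH[OF zB] by blast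
      have "block_op k T" using T by (simp add: I_def)
      then have "T (z + sA \<mu> y) = T z + sA \<mu> (T y)" by (simp only: block_op_add block_op_scale)
      then have "T x = T z + sA \<mu> (T y)" by (simp add: z_def)
      then show False using eq[OF T(1)] T(2) by simp
    qed
  qed
qed

lemma block_op_matrix_unit:
  assumes k: "k \<in> {1..q}" and e: "e \<in> Es k" and b: "b \<in> Bs k"
  obtains T where "block_op k T" "T e = b" "\<And>e'. e' \<in> block_basis {1..q} \<Longrightarrow> e' \<noteq> e \<Longrightarrow> T e' = 0"
proof -
  have EE: "Es k \<subseteq> E" using k by (auto simp: E_eq)
  have fin: "finite (Es k - {e})" using EE A.finite_Basis finite_subset by blast
  have "A.independent (Es k)" using A.independent_mono[OF A.independent_Basis EE] .
  then have notin: "e \<notin> A.span (Es k - {e})" using e by (auto simp: A.dependent_def)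
  have eB: "e \<in> Bs k" and EB: "Es k - {e} \<subseteq> Bs k" using Es_subset[OF k] e by auto
  obtain T where T: "block_op k T" "\<And>y. y \<in> Es k - {e} \<Longrightarrow> T y = 0" "T e \<noteq> 0"
    using block_op_separates[OF k fin EB eB notin] by blast
  obtain S where S: "block_op k S" "S (T e) = b"
    using block_op_transitive[OF k block_op_maps[OF T(1) k eB] T(3) b] by blast
  have "S (T e') = 0" if "e' \<in> block_basis {1..q}" "e' \<noteq> e" for e'
  proof -
    obtain l where l: "l \<in> {1..q}" "e' \<in> Es l" using \<open>e' \<in> block_basis {1..q}\<close> by (auto simp: block_basis_def)
    have "T e' = 0"
    proof (cases "l = k")
      case True
      then show ?thesis using T(2) l that by blast
    next
      case False
      then show ?thesis using block_op_kills[OF T(1) k l(1)] l Es_subset by blast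
    qed
    then show ?thesis using block_op_0[OF S(1)] by simp
  qed
  then show thesis using that[of "\<lambda>x. S (T x)"] block_op.comp[OF S(1) T(1)] S(2) by blast
qed

end

subsection \<open>The trace form\<close>

context closed_structured_action
begin

text \<open>The trace of left multiplication by \<open>u\<close> on the sum of the blocks with
  index in \<open>I\<close>; the trace form is \<open>(u, v) \<mapsto> trace_fun I (u *
  v)\<close>.\<close>

definition trace_fun :: "nat set \<Rightarrow> 'a \<Rightarrow> 'f" where
  "trace_fun I u = A.trace_on (block_basis I) (\<lambda>x. u * x)"

lemma trace_fun_add: "trace_fun I (u + v) = trace_fun I u + trace_fun I v"
  by (simp add: trace_fun_def A.trace_on_def distrib_right A.coord_add sum.distrib)

lemma trace_fun_scale: "trace_fun I (sA c u) = c * trace_fun I u"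
  by (simp add: trace_fun_def A.trace_on_def A.scale_mult_left[symmetric] A.coord_scale sum_distrib_left)

lemma trace_fun_0 [simp]: "trace_fun I 0 = 0"
  by (simp add: trace_fun_def A.trace_on_def)

lemma Bs_in_span: "I \<subseteq> {1..q} \<Longrightarrow> i \<in> I \<Longrightarrow> Bs i \<subseteq> A.span (block_basis I)"
  unfolding span_Bs_eq[symmetric] using A.span_superset by blast

lemma span_block_basis_decomp:
  assumes I: "I \<subseteq> {1..q}" and x: "x \<in> A.span (block_basis I)"
  obtains u where "\<And>i. i \<in> I \<Longrightarrow> u i \<in> Bs i" "x = (\<Sum>i\<in>I. u i)"
proof -
  have finI: "finite I" using I finite_subset by blast
  have finE: "finite (Es i)" if "i \<in> I" for i
  proof -
    have "Es i \<subseteq> E" using that I by (auto simp: E_eq)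
    then show ?thesis using A.finite_Basis finite_subset by blast
  qed
  have "x = (\<Sum>e\<in>block_basis I. sA (A.coord x e) e)" by (rule A.coord_expand[OF block_basis_subset[OF I] x])
  also have "\<dots> = (\<Sum>i\<in>I. \<Sum>e\<in>Es i. sA (A.coord x e) e)"
    unfolding block_basis_def
  proof (rule sum.UNION_disjoint[OF finI])
    show "\<forall>i\<in>I. finite (Es i)" using finE by blast
    show "\<forall>i\<in>I. \<forall>j\<in>I. i \<noteq> j \<longrightarrow> Es i \<inter> Es j = {}" using Es_disjoint I by blast
  qed
  finally have 1: "x = (\<Sum>i\<in>I. \<Sum>e\<in>Es i. sA (A.coord x e) e)" .
  show thesis
  proof (rule that[OF _ 1])
    fix i assume i: "i \<in> I"
    then have "i \<in> {1..q}" using I by blast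
    then show "(\<Sum>e\<in>Es i. sA (A.coord x e) e) \<in> Bs i"
      using Es_subset by (intro A.subspace_sum A.subspace_scale Bs_sub) auto
  qed
qed

lemma span_block_basis_mult_component:
  assumes I: "I \<subseteq> {1..q}" and u: "\<And>i. i \<in> I \<Longrightarrow> u i \<in> Bs i" and k: "k \<in> I" and v: "v \<in> Bs k"
  shows "(\<Sum>i\<in>I. u i) * v = u k * v"
proof -
  have "(\<Sum>i\<in>I. u i) * v = (\<Sum>i\<in>I. u i * v)" by (rule sum_distrib_right)
  also have "\<dots> = (\<Sum>i\<in>{k}. u i * v)"
  proof (rule sum.mono_neutral_right)
    show "\<forall>i\<in>I - {k}. u i * v = 0"
      using I k u v Bs_orth by blast
  qed (use I k finite_subset in auto)
  finally show ?thesis by simp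
qed

lemma span_block_basis_mult:
  assumes I: "I \<subseteq> {1..q}" and x: "x \<in> A.span (block_basis I)" and y: "y \<in> A.span (block_basis I)"
  shows "x * y \<in> A.span (block_basis I)"
proof -
  obtain u where u: "\<And>i. i \<in> I \<Longrightarrow> u i \<in> Bs i" "x = (\<Sum>i\<in>I. u i)"
    using span_block_basis_decomp[OF I x] by metis
  obtain v where v: "\<And>i. i \<in> I \<Longrightarrow> v i \<in> Bs i" "y = (\<Sum>i\<in>I. v i)"
    using span_block_basis_decomp[OF I y] by metis
  have "x * y = (\<Sum>i\<in>I. x * v i)" by (simp add: v(2) sum_distrib_left)
  also have "\<dots> = (\<Sum>i\<in>I. u i * v i)"
    unfolding u(2) using span_block_basis_mult_component[OF I u(1) _ v(1)] by (intro sum.cong refl) auto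
  also have "\<dots> \<in> A.span (block_basis I)"
  proof (rule A.span_sum)
    fix i assume i: "i \<in> I"
    then have "u i * v i \<in> Bs i" using I u v by (intro Bs_mult) auto
    then show "u i * v i \<in> A.span (block_basis I)" using Bs_in_span[OF I i] by blast
  qed
  finally show ?thesis .
qed

lemma trace_fun_commute:
  assumes I: "I \<subseteq> {1..q}" and x: "x \<in> A.span (block_basis I)" and y: "y \<in> A.span (block_basis I)"
  shows "trace_fun I (x * y) = trace_fun I (y * x)"
  using A.trace_on_comp_commute[OF block_basis_subset[OF I] A.linear_mult_left _ A.linear_mult_left, of x y]
    span_block_basis_mult[OF I x] span_block_basis_mult[OF I y]
  by (auto simp: trace_fun_def mult.assoc)

text \<open>The trace is the rank, which is nonzero in characteristic 0.\<close>

lemma trace_fun_idempotent_nonzero: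
  assumes I: "I \<subseteq> {1..q}" and g: "g \<in> A.span (block_basis I)" "g * g = g" "g \<noteq> 0"
  shows "trace_fun I g \<noteq> 0"
proof -
  let ?V = "(\<lambda>x. g * x) ` A.span (block_basis I)"
  have "trace_fun I g = of_nat (A.dim ?V)"
    unfolding trace_fun_def
  proof (rule A.trace_on_idempotent[OF block_basis_subset[OF I] A.linear_mult_left])
    show "?V \<subseteq> A.span (block_basis I)" using span_block_basis_mult[OF I g(1)] by blast
    show "g * (g * x) = g * x" for x using g(2) by (simp add: mult.assoc[symmetric])
  qed
  moreover have "A.dim ?V \<noteq> 0"
  proof -
    have "g \<in> ?V" using g by (metis imageI)
    then show ?thesis using g(3) by (auto simp: A.dim_eq_0)
  qed
  ultimately show ?thesis by simp
qed

text \<open>The left ideal \<open>L\<close> of \<open>B\<^sub>k\<close> generated by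
  \<open>u\<close> is nil, hence zero by semisimplicity: an idempotent \<open>e = w' u \<noteq>
  0\<close> would make \<open>g = u e w'\<close> an idempotent of the form \<open>u v\<close>, and
  idempotents have nonzero trace.\<close>

lemma trace_fun_nondegenerate_component:
  assumes I: "I \<subseteq> {1..q}" and k: "k \<in> I" and u: "u \<in> Bs k"
    and z: "\<And>v. v \<in> Bs k \<Longrightarrow> trace_fun I (u * v) = 0"
  shows "u = 0"
proof -
  have kq: "k \<in> {1..q}" using I k by blast
  note sub = Bs_sub[OF kq] and mul = Bs_mult[OF kq]
  define L where "L = {sA c u + b * u | c b. b \<in> Bs k}"
  have LI: "left_ideal sA (Bs k) L"
    unfolding left_ideal_def
  proof (intro conjI ballI)
    show "A.subspace L"
    proof (rule A.subspaceI)
      have "sA 0 u + 0 * u \<in> L" unfolding L_def using A.subspace_0[OF sub] by blast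
      then show "0 \<in> L" by simp
      show "x + y \<in> L" if xy: "x \<in> L" "y \<in> L" for x y
      proof -
        obtain c b c' b' where "x = sA c u + b * u" "y = sA c' u + b' * u" "b \<in> Bs k" "b' \<in> Bs k"
          using xy unfolding L_def by blast
        then have "x + y = sA (c + c') u + (b + b') * u" "b + b' \<in> Bs k"
          by (auto simp: A.scale_left_distrib distrib_right A.subspace_add[OF sub])
        then show ?thesis unfolding L_def by blast
      qed
      show "sA a x \<in> L" if x: "x \<in> L" for a x
      proof -
        obtain c b where "x = sA c u + b * u" "b \<in> Bs k" using x unfolding L_def by blast
        then have "sA a x = sA (a * c) u + sA a b * u" "sA a b \<in> Bs k"
          by (auto simp: A.scale_right_distrib A.scale_mult_left A.subspace_scale[OF sub])
        then show ?thesis unfolding L_def by blast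
      qed
    qed
    show "L \<subseteq> Bs k" unfolding L_def using u mul by (auto intro!: A.subspace_add A.subspace_scale sub)
    fix r x assume r: "r \<in> Bs k" and "x \<in> L"
    then obtain c b where x: "x = sA c u + b * u" "b \<in> Bs k" unfolding L_def by blast
    have "r * x = sA 0 u + (sA c r + r * b) * u"
      by (simp add: x distrib_left distrib_right mult.assoc A.scale_mult_right[symmetric] A.scale_mult_left[symmetric])
    moreover have "sA c r + r * b \<in> Bs k" using r x mul by (intro A.subspace_add A.subspace_scale sub) auto
    ultimately show "r * x \<in> L" unfolding L_def by blast
  qed
  have "\<exists>n. pow1 x n = 0" if xL: "x \<in> L" for x
  proof (rule ccontr)
    assume "\<not> ?thesis"
    then obtain e w where e: "e * e = e" "e \<noteq> 0" "e = w * x" "w \<in> A.span (range (pow1 x))"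
      using A.nonnilpotent_idempotent[of x] by metis
    obtain c b where x: "x = sA c u + b * u" "b \<in> Bs k" using xL unfolding L_def by blast
    have xB: "x \<in> Bs k" using xL LI by (auto simp: left_ideal_def)
    have "pow1 x n \<in> Bs k" for n by (induction n) (auto simp: xB mul)
    then have "A.span (range (pow1 x)) \<subseteq> Bs k" by (intro A.span_minimal sub) auto
    then have wB: "w \<in> Bs k" using e(4) by blast
    \<comment> \<open>\<open>w'\<close> absorbs the coefficients of \<open>x = c u + b u\<close>,
      so that \<open>e = w' u\<close>.\<close>
    define w' where "w' = sA c w + w * b"
    have w'B: "w' \<in> Bs k" unfolding w'_def using wB x mul by (intro A.subspace_add A.subspace_scale sub) auto
    have ew: "e = w' * u"
      by (simp add: e(3) x w'_def distrib_left distrib_right mult.assoc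
          A.scale_mult_left[symmetric] A.scale_mult_right[symmetric])
    have eB: "e \<in> Bs k" using ew w'B u mul by simp
    define g where "g = u * (e * w')"
    have wgu: "w' * g * u = e"
    proof -
      have "w' * g * u = (w' * u) * e * (w' * u)" by (simp add: g_def mult.assoc)
      then show ?thesis using e(1) by (simp add: ew[symmetric])
    qed
    have gg: "g * g = g"
    proof -
      have "g * g = u * (e * (w' * u) * e * w')" by (simp add: g_def mult.assoc)
      then show ?thesis using e(1) by (simp add: ew[symmetric] g_def)
    qed
    have "g \<noteq> 0" using wgu e(2) by auto
    have ewB: "e * w' \<in> Bs k" using eB w'B mul by simp
    then have "g \<in> Bs k" unfolding g_def using u mul by simp
    then have "trace_fun I g \<noteq> 0"
      using Bs_in_span[OF I k] trace_fun_idempotent_nonzero[OF I _ gg \<open>g \<noteq> 0\<close>] by blast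
    then show False using z[OF ewB] by (simp add: g_def)
  qed
  then have "L \<subseteq> jacobson_radical sA (Bs k)"
    using A.nil_left_ideal_subset_radical[OF _ LI] Bs_simple[OF kq] by (simp add: H_simple_def)
  then have "L \<subseteq> {0}" using Bs_semisimple[OF kq] by (simp add: semisimple_algebra_def)
  moreover have "sA 1 u + 0 * u \<in> L" unfolding L_def using A.subspace_0[OF sub] by blast
  ultimately show ?thesis by auto
qed

lemma trace_fun_nondegenerate:
  assumes I: "I \<subseteq> {1..q}" and x: "x \<in> A.span (block_basis I)"
    and z: "\<And>v. v \<in> A.span (block_basis I) \<Longrightarrow> trace_fun I (x * v) = 0"
  shows "x = 0"
proof -
  obtain u where u: "\<And>i. i \<in> I \<Longrightarrow> u i \<in> Bs i" "x = (\<Sum>i\<in>I. u i)"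
    using span_block_basis_decomp[OF I x] by metis
  have "u k = 0" if k: "k \<in> I" for k
  proof (rule trace_fun_nondegenerate_component[OF I k u(1)[OF k]])
    fix v assume v: "v \<in> Bs k"
    then have "trace_fun I (x * v) = 0" using z Bs_in_span[OF I k] by blast
    moreover have "x * v = u k * v"
      unfolding u(2) by (rule span_block_basis_mult_component[OF I u(1) k v])
    ultimately show "trace_fun I (u k * v) = 0" by simp
  qed
  then show ?thesis using u(2) by simp
qed

text \<open>By nondegeneracy and symmetry the map \<open>f\<close>, which sends \<open>v\<close>
  to the vector with the coordinates \<open>\<beta>(e, v)\<close>, is injective on the span of the
  basis, hence surjective.\<close>

lemma trace_fun_dual_basis:
  assumes I: "I \<subseteq> {1..q}"
  obtains dual where "\<And>e. e \<in> block_basis I \<Longrightarrow> dual e \<in> A.span (block_basis I)"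
    "\<And>e e'. e \<in> block_basis I \<Longrightarrow> e' \<in> block_basis I \<Longrightarrow> trace_fun I (e * dual e') = (if e = e' then 1 else 0)"
proof -
  let ?D = "block_basis I" and ?V = "A.span (block_basis I)"
  note DE = block_basis_subset[OF I]
  define f where "f v = (\<Sum>e\<in>?D. sA (trace_fun I (e * v)) e)" for v
  have lin: "Vector_Spaces.linear sA sA f"
  proof (unfold_locales)
    show "f (x + y) = f x + f y" for x y
      by (simp add: f_def distrib_left trace_fun_add A.scale_left_distrib sum.distrib)
    show "f (sA c x) = sA c (f x)" for c x
      by (simp add: f_def A.scale_mult_right[symmetric] trace_fun_scale A.scale_sum_right)
  qed
  interpret f: Vector_Spaces.linear sA sA f by (rule lin)
  have coord_f: "A.coord (f v) e = trace_fun I (e * v)" if e: "e \<in> ?D" for v e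
  proof -
    have "A.coord (f v) e = (\<Sum>e'\<in>?D. if e' = e then trace_fun I (e' * v) else 0)"
      unfolding f_def A.coord_sum A.coord_scale
      using DE by (intro sum.cong refl) (auto simp: A.coord_basis subset_iff)
    also have "\<dots> = trace_fun I (e * v)" using e DE A.finite_Basis by (simp add: finite_subset sum.delta)
    finally show ?thesis .
  qed
  have inj: "inj_on f ?V"
  proof (rule f.inj_on_iff_eq_0[THEN iffD2])
    show "A.subspace ?V" by simp
    show "\<forall>x\<in>?V. f x = 0 \<longrightarrow> x = 0"
    proof (intro ballI impI)
      fix v assume v: "v \<in> ?V" "f v = 0"
      have base: "trace_fun I (e * v) = 0" if "e \<in> ?D" for e using coord_f[OF that, of v] v(2) by simp
      have "trace_fun I (x * v) = 0" if "x \<in> ?V" for x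
        using that
        by (induction rule: A.span_induct_alt)
          (auto simp: distrib_right trace_fun_add A.scale_mult_left[symmetric] trace_fun_scale base)
      then have "trace_fun I (v * x) = 0" if "x \<in> ?V" for x using trace_fun_commute[OF I v(1) that] that by simp
      then show "v = 0" using trace_fun_nondegenerate[OF I v(1)] by blast
    qed
  qed
  have fV: "f v \<in> ?V" for v unfolding f_def by (intro A.span_sum A.span_scale A.span_base)
  have indD: "A.independent ?D" by (rule A.independent_mono[OF A.independent_Basis DE])
  have "?V \<subseteq> A.span (f ` ?D)"
  proof (rule A.card_ge_dim_independent)
    show "f ` ?D \<subseteq> ?V" using fV by blast
    show "A.independent (f ` ?D)" by (rule f.independent_injective_image[OF indD inj])
    have "card (f ` ?D) = card ?D"
      using inj A.span_superset by (intro card_image) (rule inj_on_subset)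
    then show "A.dim ?V \<le> card (f ` ?D)" using A.dim_span_eq_card_independent[OF indD] by simp
  qed
  then have surj: "?V \<subseteq> f ` ?V" by (simp add: f.span_image)
  define dual where "dual e = (SOME v. v \<in> ?V \<and> f v = e)" for e
  have dual: "dual e \<in> ?V \<and> f (dual e) = e" if "e \<in> ?D" for e
  proof -
    have "e \<in> f ` ?V" using that surj A.span_base by blast
    then have "\<exists>v. v \<in> ?V \<and> f v = e" by auto
    then show ?thesis unfolding dual_def by (rule someI_ex)
  qed
  show thesis
  proof (rule that[of dual])
    show "dual e \<in> ?V" if "e \<in> ?D" for e using dual[OF that] by simp
    show "trace_fun I (e * dual e') = (if e = e' then 1 else 0)" if "e \<in> ?D" "e' \<in> ?D" for e e'
      using coord_f[OF that(1), of "dual e'"] dual[OF that(2)] DE that by (simp add: A.coord_basis subset_iff)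
  qed
qed

end

section \<open>The lower bound\<close>

context closed_structured_action
begin

subsection \<open>Realizable functions\<close>

text \<open>Functions of the variables \<open>S\<close> that arise from a multilinear function by
  giving fixed values \<open>y\<close> to finitely many further variables. Different functions may
  need different numbers of further variables, so their sums are considered separately.\<close>

definition realizable :: "'a set \<Rightarrow> (('a \<Rightarrow> 'a) \<Rightarrow> 'a) \<Rightarrow> bool" where
  "realizable S Q \<longleftrightarrow> (\<exists>n f y. multilin (Inl ` S \<union> Inr ` {..<n::nat}) f \<and> Q = (\<lambda>x. f (case_sum x y)))"

inductive realizable_sum :: "'a set \<Rightarrow> (('a \<Rightarrow> 'a) \<Rightarrow> 'a) \<Rightarrow> bool" for S where
  single: "realizable S Q \<Longrightarrow> realizable_sum S Q"
| add: "realizable_sum S Q \<Longrightarrow> realizable_sum S Q' \<Longrightarrow> realizable_sum S (\<lambda>x. Q x + Q' x)"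

lemma realizableI: "multilin (Inl ` S \<union> Inr ` {..<n::nat}) f \<Longrightarrow> realizable S (\<lambda>x. f (case_sum x y))"
  by (auto simp: realizable_def)

lemma realizable_mult:
  assumes "realizable S Q" "realizable S' Q'" "S \<inter> S' = {}"
  shows "realizable (S \<union> S') (\<lambda>x. Q x * Q' x)"
proof -
  obtain n f y where f: "multilin (Inl ` S \<union> Inr ` {..<n::nat}) f" "Q = (\<lambda>x. f (case_sum x y))"
    using assms(1) by (auto simp: realizable_def)
  obtain m g z where g: "multilin (Inl ` S' \<union> Inr ` {..<m::nat}) g" "Q' = (\<lambda>x. g (case_sum x z))"
    using assms(2) by (auto simp: realizable_def)
  define \<rho> :: "'a + nat \<Rightarrow> 'a + nat" where "\<rho> = map_sum id (\<lambda>j. j + n)"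
  \<comment> \<open>The further variables of \<open>g\<close> are moved behind the
    \<open>n\<close> further variables of \<open>f\<close>.\<close>
  define y' where "y' j = (if j < n then y j else z (j - n))" for j
  have "inj \<rho>" unfolding \<rho>_def by (rule sum.inj_map) (auto simp: inj_on_def)
  then have "multilin (\<rho> ` (Inl ` S' \<union> Inr ` {..<m})) (\<lambda>a. g (\<lambda>i. a (\<rho> i)))"
    by (intro multilin_rename[OF g(1)]) (auto simp: inj_on_def)
  moreover have "\<rho> ` (Inl ` S' \<union> Inr ` {..<m}) = Inl ` S' \<union> Inr ` {n..<n+m}"
  proof -
    have "(\<lambda>j. j + n) ` {..<m} = {n..<n+m}"
      by (simp add: lessThan_atLeast0 add.commute)
    moreover have "\<rho> ` (Inl ` S' \<union> Inr ` {..<m}) = Inl ` S' \<union> Inr ` ((\<lambda>j. j + n) ` {..<m})"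
      by (simp add: \<rho>_def image_Un image_image)
    ultimately show ?thesis by simp
  qed
  ultimately have "multilin (Inl ` S' \<union> Inr ` {n..<n+m}) (\<lambda>a. g (\<lambda>i. a (\<rho> i)))" by simp
  moreover have "(Inl ` S \<union> Inr ` {..<n}) \<inter> (Inl ` S' \<union> Inr ` {n..<n+m}) = {}"
    using assms(3) by auto
  ultimately have "multilin ((Inl ` S \<union> Inr ` {..<n}) \<union> (Inl ` S' \<union> Inr ` {n..<n+m})) (\<lambda>a. f a * g (\<lambda>i. a (\<rho> i)))"
    using multilin_mult[OF f(1)] by blast
  moreover have "(Inl ` S \<union> Inr ` {..<n}) \<union> (Inl ` S' \<union> Inr ` {n..<n+m}) = Inl ` (S \<union> S') \<union> Inr ` {..<n+m}"
  proof -
    have "{..<n+m} = {..<n} \<union> {n..<n+m}" by auto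
    then show ?thesis by (simp only: image_Un) blast
  qed
  ultimately have "multilin (Inl ` (S \<union> S') \<union> Inr ` {..<n+m}) (\<lambda>a. f a * g (\<lambda>i. a (\<rho> i)))" by simp
  from realizableI[OF this, of y'] have "realizable (S \<union> S')
      (\<lambda>x. f (case_sum x y') * g (\<lambda>i. case_sum x y' (\<rho> i)))" .
  moreover have "f (case_sum x y') = f (case_sum x y)" for x
    by (rule multilin_cong[OF f(1)]) (auto simp: y'_def)
  moreover have "(\<lambda>i. case_sum x y' (\<rho> i)) = case_sum x z" for x
    by (rule ext) (auto simp: \<rho>_def y'_def split: sum.split)
  ultimately show ?thesis by (simp add: f(2) g(2))
qed

lemma realizable_act: "realizable S Q \<Longrightarrow> realizable S (\<lambda>x. act h (Q x))"
  using multilin_act unfolding realizable_def by fastforce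

lemma realizable_scale: "realizable S Q \<Longrightarrow> realizable S (\<lambda>x. sA c (Q x))"
  using multilin.scale unfolding realizable_def by fastforce

lemma realizable_sum_zero: "realizable_sum S (\<lambda>_. 0)"
proof -
  have "multilin (Inl ` S \<union> Inr ` {..<0::nat}) (\<lambda>_. 0)" by (rule multilin.zero)
  from realizable_sum.single[OF realizableI[OF this]] show ?thesis by simp
qed

lemma realizable_sum_const: "realizable_sum {} (\<lambda>_. c)"
proof -
  have "multilin (Inl ` {} \<union> Inr ` {..<1::nat}) (\<lambda>a. a (Inr 0))"
    using multilin_id[of "Inr 0"] by (simp add: lessThan_Suc)
  from realizable_sum.single[OF realizableI[OF this, of "\<lambda>_. c"]] show ?thesis by simp
qed

lemma realizable_sum_var: "realizable_sum {e} (\<lambda>x. x e)"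
proof -
  have "multilin (Inl ` {e} \<union> Inr ` {..<0::nat}) (\<lambda>a. a (Inl e))"
    using multilin_id[of "Inl e"] by simp
  from realizable_sum.single[OF realizableI[OF this]] show ?thesis by simp
qed

lemma realizable_sum_mult:
  assumes "realizable_sum S Q" "realizable_sum S' Q'" "S \<inter> S' = {}"
  shows "realizable_sum (S \<union> S') (\<lambda>x. Q x * Q' x)"
  using assms(1)
proof induction
  case (single Q)
  note Q = this
  show ?case using assms(2)
  proof induction
    case (single Q')
    show ?case by (rule realizable_sum.single[OF realizable_mult[OF Q single assms(3)]])
  next
    case (add Q1 Q2)
    then show ?case by (auto simp: distrib_left intro: realizable_sum.add)
  qed
next
  case (add Q1 Q2)
  then show ?case by (auto simp: distrib_right intro: realizable_sum.add)
qed

lemma realizable_sum_act: "realizable_sum S Q \<Longrightarrow> realizable_sum S (\<lambda>x. act h (Q x))"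
  by (induction rule: realizable_sum.induct) (auto simp: act_plus intro: realizable_sum.intros realizable_act)

lemma realizable_sum_scale: "realizable_sum S Q \<Longrightarrow> realizable_sum S (\<lambda>x. sA c (Q x))"
  by (induction rule: realizable_sum.induct) (auto simp: A.scale_right_distrib intro: realizable_sum.intros realizable_scale)

lemma realizable_sum_bop: "block_op k T \<Longrightarrow> realizable_sum S Q \<Longrightarrow> realizable_sum S (\<lambda>x. T (Q x))"
proof (induction arbitrary: Q rule: block_op.induct)
  case (left u)
  then show ?case using realizable_sum_mult[OF realizable_sum_const left(2), of u] by simp
next
  case (right u)
  then show ?case using realizable_sum_mult[OF right(2) realizable_sum_const, of u] by simp
next
  case (add R T)
  show ?case by (rule realizable_sum.add[OF add.IH(1)[OF add.prems] add.IH(2)[OF add.prems]])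
next
  case (scale T c)
  show ?case by (rule realizable_sum_scale[OF scale.IH[OF scale.prems]])
next
  case (comp R T)
  show ?case by (rule comp.IH(1)[OF comp.IH(2)[OF comp.prems]])
next
  case (act_left T h)
  show ?case by (rule realizable_sum_act[OF act_left.IH[OF act_left.prems]])
next
  case (act_right T h)
  show ?case by (rule act_right.IH[OF realizable_sum_act[OF act_right.prems]])
qed

text \<open>On tuples of block basis elements the function \<open>Q\<close> detects the identical
  tuple.\<close>

definition selects :: "'a set \<Rightarrow> 'a \<Rightarrow> bool" where
  "selects S y \<longleftrightarrow> (\<exists>Q. realizable_sum S Q \<and>
     (\<forall>x. (\<forall>e\<in>S. x e \<in> block_basis {1..q}) \<longrightarrow> Q x = (if \<forall>e\<in>S. x e = e then y else 0)))"

lemma selects_zero: "selects S 0"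
  unfolding selects_def by (rule exI[of _ "\<lambda>_. 0"]) (simp add: realizable_sum_zero)

lemma selects_add:
  assumes "selects S y" "selects S z"
  shows "selects S (y + z)"
proof -
  obtain Q R where "realizable_sum S Q" "\<forall>x. (\<forall>e\<in>S. x e \<in> block_basis {1..q}) \<longrightarrow> Q x = (if \<forall>e\<in>S. x e = e then y else 0)"
    "realizable_sum S R" "\<forall>x. (\<forall>e\<in>S. x e \<in> block_basis {1..q}) \<longrightarrow> R x = (if \<forall>e\<in>S. x e = e then z else 0)"
    using assms unfolding selects_def by blast
  then show ?thesis unfolding selects_def
    by (intro exI[of _ "\<lambda>x. Q x + R x"]) (auto intro: realizable_sum.add)
qed

lemma selects_scale:
  assumes "selects S y"
  shows "selects S (sA c y)"
proof -
  obtain Q where "realizable_sum S Q" "\<forall>x. (\<forall>e\<in>S. x e \<in> block_basis {1..q}) \<longrightarrow> Q x = (if \<forall>e\<in>S. x e = e then y else 0)"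
    using assms unfolding selects_def by blast
  then show ?thesis unfolding selects_def
    by (intro exI[of _ "\<lambda>x. sA c (Q x)"]) (auto intro: realizable_sum_scale)
qed

lemma selects_mult:
  assumes "selects S y" "selects S' z" "S \<inter> S' = {}"
  shows "selects (S \<union> S') (y * z)"
proof -
  obtain Q R where "realizable_sum S Q" "\<forall>x. (\<forall>e\<in>S. x e \<in> block_basis {1..q}) \<longrightarrow> Q x = (if \<forall>e\<in>S. x e = e then y else 0)"
    "realizable_sum S' R" "\<forall>x. (\<forall>e\<in>S'. x e \<in> block_basis {1..q}) \<longrightarrow> R x = (if \<forall>e\<in>S'. x e = e then z else 0)"
    using assms unfolding selects_def by blast
  then show ?thesis unfolding selects_def using realizable_sum_mult[of S Q S' R] assms(3)
    by (intro exI[of _ "\<lambda>x. Q x * R x"]) auto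
qed

lemma selects_const: "selects {} c"
  unfolding selects_def using realizable_sum_const by (intro exI[of _ "\<lambda>_. c"]) simp

lemma selects_span:
  assumes "y \<in> A.span X" "\<And>y. y \<in> X \<Longrightarrow> selects S y"
  shows "selects S y"
  using assms(1)
  by (induction rule: A.span_induct_alt) (auto intro: selects_zero selects_add selects_scale assms(2))

lemma Bs_square:
  assumes k: "k \<in> {1..q}"
  shows "Bs k = A.span {u * v | u v. u \<in> Bs k \<and> v \<in> Bs k}"
proof -
  let ?X = "{u * v | u v. u \<in> Bs k \<and> v \<in> Bs k}"
  have sub: "A.span ?X \<subseteq> Bs k"
    by (rule A.span_minimal[OF _ Bs_sub[OF k]]) (use Bs_mult[OF k] in auto)
  have XI: "u * v \<in> A.span ?X" if "u \<in> Bs k" "v \<in> Bs k" for u v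
    using that by (intro A.span_base) blast
  have "A.span ?X = {0} \<or> A.span ?X = Bs k"
  proof (rule Bs_ideal_trivial[OF k A.subspace_span sub])
    show "r * x \<in> A.span ?X" "x * r \<in> A.span ?X" if "r \<in> Bs k" "x \<in> A.span ?X" for r x
      using that XI sub by blast+
    show "act h x \<in> A.span ?X" if "x \<in> A.span ?X" for h x
    proof (rule act_span[OF that _ A.subspace_span])
      fix y assume "y \<in> ?X"
      then obtain u v where y: "y = u * v" "u \<in> Bs k" "v \<in> Bs k" by blast
      obtain hs where hs: "\<And>a b. act h (a * b) =
          (\<Sum>(h1, h2, h3, h4)\<leftarrow>hs. act h1 a * act h2 b + act h3 b * act h4 a)"
        using act_prod[of h] by blast
      have "(\<Sum>(h1, h2, h3, h4)\<leftarrow>hs. act h1 u * act h2 v + act h3 v * act h4 u) \<in> A.span ?X"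
        by (induction hs) (auto intro!: A.span_add XI A.span_zero Bs_act[OF k] y)
      then show "act h y \<in> A.span ?X" by (simp add: y(1) hs)
    qed
  qed
  moreover have "A.span ?X \<noteq> {0}" using Bs_not_null[OF k] XI by blast
  ultimately show ?thesis by simp
qed

text \<open>By \<open>B\<^sub>k = B\<^sub>k B\<^sub>k\<close> the element \<open>b\<close> is a
  sum of products with as many factors as \<open>S\<close> has elements; each factor is produced
  from one variable by a matrix unit.\<close>

lemma selects_block:
  assumes k: "k \<in> {1..q}" and S: "finite S" "S \<noteq> {}" "S \<subseteq> Es k" and b: "b \<in> Bs k"
  shows "selects S b"
proof -
  have single: "selects {e} b" if e: "e \<in> Es k" and b: "b \<in> Bs k" for e b
  proof -
    obtain T where T: "block_op k T" "T e = b" "\<And>e'. e' \<in> block_basis {1..q} \<Longrightarrow> e' \<noteq> e \<Longrightarrow> T e' = 0"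
      using block_op_matrix_unit[OF k e b] by blast
    show ?thesis unfolding selects_def
      by (rule exI[of _ "\<lambda>x. T (x e)"]) (use T realizable_sum_bop[OF T(1) realizable_sum_var] in auto)
  qed
  show ?thesis using S b
  proof (induction S arbitrary: b rule: finite_ne_induct)
    case (singleton e)
    then show ?case using single by simp
  next
    case (insert e S)
    show ?case
    proof (rule selects_span)
      show "b \<in> A.span {u * v | u v. u \<in> Bs k \<and> v \<in> Bs k}" using insert.prems Bs_square[OF k] by simp
      fix y assume "y \<in> {u * v | u v. u \<in> Bs k \<and> v \<in> Bs k}"
      then obtain u v where y: "y = u * v" "u \<in> Bs k" "v \<in> Bs k" by blast
      then show "selects (insert e S) y"
        using selects_mult[OF single[of e u] insert.IH[of v]] insert by simp
    qed
  qed
qed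

lemma finite_block_basis: "I \<subseteq> {1..q} \<Longrightarrow> finite (block_basis I)"
  using block_basis_subset A.finite_Basis finite_subset by metis

lemma selects_chain:
  assumes "is \<noteq> []" "distinct is" "set is \<subseteq> {1..q}" "y \<in> BJ_chain sA Bs J is"
  shows "selects (block_basis (set is)) y"
  using assms
proof (induction "is" arbitrary: y)
  case (Cons i "is")
  have iq: "i \<in> {1..q}" using Cons.prems by simp
  have block: "selects (Es i) b" if "b \<in> Bs i" for b
  proof (rule selects_block[OF iq _ _ order_refl that])
    show "finite (Es i)" using finite_block_basis[of "{i}"] iq by (simp add: block_basis_def)
    show "Es i \<noteq> {}" using Es_span[OF iq] Bs_nonzero[OF iq] by auto
  qed
  show ?case
  proof (cases "is")
    case Nil
    then show ?thesis using Cons.prems block by (simp add: block_basis_def)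
  next
    case (Cons l ls)
    have disj: "Es i \<inter> block_basis (set is) = {}"
      using Es_disjoint Cons.prems(2,3) unfolding block_basis_def by fastforce
    have union: "block_basis (set (i # is)) = Es i \<union> block_basis (set is)" by (simp add: block_basis_def)
    show ?thesis
    proof (rule selects_span)
      show "y \<in> A.span {u * v |u v. u \<in> Bs i \<and> v \<in> subspace_mult sA J (BJ_chain sA Bs J is)}"
        using Cons.prems(4) by (simp add: Cons subspace_mult_def)
      fix w assume "w \<in> {u * v |u v. u \<in> Bs i \<and> v \<in> subspace_mult sA J (BJ_chain sA Bs J is)}"
      then obtain u v where w: "w = u * v" "u \<in> Bs i"
        "v \<in> A.span {j * c | j c. j \<in> J \<and> c \<in> BJ_chain sA Bs J is}" by (auto simp: subspace_mult_def)
      have "selects (block_basis (set is)) v"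
      proof (rule selects_span[OF w(3)])
        fix z assume "z \<in> {j * c | j c. j \<in> J \<and> c \<in> BJ_chain sA Bs J is}"
        then obtain j c where z: "z = j * c" "c \<in> BJ_chain sA Bs J is" by blast
        have "selects (block_basis (set is)) c" using Cons.IH[OF _ _ _ z(2)] Cons.prems Cons by simp
        then show "selects (block_basis (set is)) z" using selects_mult[OF selects_const, of _ c j] z by simp
      qed
      then show "selects (block_basis (set (i # is))) w"
        unfolding union w(1) by (rule selects_mult[OF block[OF w(2)] _ disj])
    qed
  qed
qed simp

subsection \<open>Alternation\<close>

definition alt_sum :: "'a set \<Rightarrow> (('a \<Rightarrow> 'a) \<Rightarrow> 'a) \<Rightarrow> ('a \<Rightarrow> 'a) \<Rightarrow> 'a" where
  "alt_sum D Q x = (\<Sum>\<sigma> | \<sigma> permutes D. sA (of_int (sign \<sigma>)) (Q (x \<circ> \<sigma>)))"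

definition alternating :: "'a set \<Rightarrow> (('a \<Rightarrow> 'a) \<Rightarrow> 'a) \<Rightarrow> bool" where
  "alternating D g \<longleftrightarrow>
     (\<forall>e\<in>D. \<forall>x. \<forall>S :: 'a set. \<forall>c v. g (x(e := (\<Sum>s\<in>S. sA (c s) (v s)))) = (\<Sum>s\<in>S. sA (c s) (g (x(e := v s))))) \<and>
     (\<forall>x. \<forall>p\<in>D. \<forall>r\<in>D. p \<noteq> r \<longrightarrow> g (x \<circ> transpose p r) = - g x)"

lemma alt_sum_transpose:
  assumes D: "finite D" and p: "p \<in> D" "r \<in> D" "p \<noteq> r"
  shows "alt_sum D Q (x \<circ> transpose p r) = - alt_sum D Q x"
proof -
  let ?t = "transpose p r"
  have t: "?t permutes D" using p by (intro permutes_swap_id)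
  have perm: "permutation \<sigma>" if "\<sigma> permutes D" for \<sigma> using that D permutation_permutes by blast
  have sgn: "sign (?t \<circ> \<sigma>) = - sign \<sigma>" if "\<sigma> permutes D" for \<sigma>
    using sign_compose[OF perm[OF t] perm[OF that]] p(3) by (simp add: sign_swap_id)
  have "alt_sum D Q (x \<circ> ?t) = (\<Sum>\<sigma> | \<sigma> permutes D. - sA (of_int (sign \<sigma>)) (Q (x \<circ> \<sigma>)))"
    unfolding alt_sum_def
  proof (rule sum.reindex_bij_witness[of _ "\<lambda>\<sigma>. ?t \<circ> \<sigma>" "\<lambda>\<sigma>. ?t \<circ> \<sigma>"])
    fix \<sigma> assume \<sigma>: "\<sigma> \<in> {\<sigma>. \<sigma> permutes D}"
    show tt: "?t \<circ> (?t \<circ> \<sigma>) = \<sigma>" by (simp add: fun_eq_iff)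
    show tt2: "?t \<circ> \<sigma> \<in> {\<sigma>. \<sigma> permutes D}" using \<sigma> t by (simp add: permutes_compose)
    show "- sA (of_int (sign (?t \<circ> \<sigma>))) (Q (x \<circ> (?t \<circ> \<sigma>))) = sA (of_int (sign \<sigma>)) (Q (x \<circ> ?t \<circ> \<sigma>))"
      using sgn \<sigma> by (simp add: o_assoc)
    show "?t \<circ> (?t \<circ> \<sigma>) = \<sigma>" by (rule tt)
    show "?t \<circ> \<sigma> \<in> {\<sigma>. \<sigma> permutes D}" by (rule tt2)
  qed
  also have "\<dots> = - alt_sum D Q x" by (simp add: alt_sum_def sum_negf)
  finally show ?thesis .
qed

lemma alternating_equal_args:
  assumes g: "alternating D g" and p: "p \<in> D" "r \<in> D" "p \<noteq> r" "x p = x r"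
  shows "g x = 0"
proof -
  have "x \<circ> transpose p r = x" using p(4) by (auto simp: fun_eq_iff transpose_def)
  then have "g x = - g x" using g p by (metis (no_types, lifting) alternating_def)
  then have "g x + g x = 0" by (metis add.right_inverse)
  then have "sA 2 (g x) = 0" using A.scale_left_distrib[of 1 1 "g x"] by simp
  then show ?thesis by simp
qed

text \<open>If \<open>x\<close> permutes the basis \<open>D\<close>, then all terms of the
  expansion of \<open>u x\<^sub>e\<close> except the diagonal one repeat an argument. If
  \<open>x\<close> takes a value of \<open>D\<close> twice, then both sides vanish. The general
  case follows since both sides are linear in every \<open>x\<^sub>e\<close>.\<close>

lemma alternating_trace:
  assumes I: "I \<subseteq> {1..q}" and D: "D = block_basis I" and g: "alternating D g"
    and u: "u \<in> A.span D" and x: "\<And>e. e \<in> D \<Longrightarrow> x e \<in> A.span D"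
  shows "(\<Sum>e\<in>D. g (x(e := u * x e))) = sA (trace_fun I u) (g x)"
proof -
  have finD: "finite D" using finite_block_basis[OF I] D by simp
  have DE: "D \<subseteq> E" using block_basis_subset[OF I] D by simp
  have lin: "g (f(e := (\<Sum>s\<in>S. sA (c s) (v s)))) = (\<Sum>s\<in>S. sA (c s) (g (f(e := v s))))"
    if "e \<in> D" for e f c v and S :: "'a set" using g that unfolding alternating_def by blast
  have anti: "g (x \<circ> transpose p r) = - g x" if "p \<in> D" "r \<in> D" "p \<noteq> r" for x p r
    using g that unfolding alternating_def by blast
  define \<Phi> where "\<Phi> x = (\<Sum>e\<in>D. g (x(e := u * x e)))" for x
  have basis: "\<Phi> x = sA (trace_fun I u) (g x)" if x: "\<And>e. e \<in> D \<Longrightarrow> x e \<in> D" for x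
  proof (cases "inj_on x D")
    case True
    then have bij: "bij_betw x D D"
      using x finD by (simp add: bij_betw_def endo_inj_surj image_subsetI)
    have "g (x(e := u * x e)) = sA (A.coord (u * x e) (x e)) (g x)" if e: "e \<in> D" for e
    proof -
      have ux: "u * x e \<in> A.span D" using span_block_basis_mult[OF I] u x[OF e] A.span_base unfolding D by blast
      have "g (x(e := u * x e)) = g (x(e := (\<Sum>c\<in>D. sA (A.coord (u * x e) c) c)))"
        using A.coord_expand[OF DE ux] by simp
      also have "\<dots> = (\<Sum>c\<in>D. sA (A.coord (u * x e) c) (g (x(e := c))))" by (rule lin[OF e])
      also have "\<dots> = (\<Sum>c\<in>{x e}. sA (A.coord (u * x e) c) (g (x(e := c))))"
      proof (rule sum.mono_neutral_right[OF finD])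
        show "{x e} \<subseteq> D" using x e by simp
        show "\<forall>c\<in>D - {x e}. sA (A.coord (u * x e) c) (g (x(e := c))) = 0"
        proof
          fix c assume c: "c \<in> D - {x e}"
          have "x ` D = D" using bij by (simp add: bij_betw_def)
          then have "c \<in> x ` D" using c by simp
          then obtain e' where e': "e' \<in> D" "x e' = c" by blast
          then have "e' \<noteq> e" using c by auto
          then have "g (x(e := c)) = 0" using alternating_equal_args[OF g e e'(1)] e' by simp
          then show "sA (A.coord (u * x e) c) (g (x(e := c))) = 0" by simp
        qed
      qed
      finally show ?thesis by simp
    qed
    then have "\<Phi> x = (\<Sum>e\<in>D. sA (A.coord (u * x e) (x e)) (g x))" by (simp add: \<Phi>_def)
    also have "\<dots> = sA (\<Sum>e\<in>D. A.coord (u * x e) (x e)) (g x)" by (simp add: A.scale_sum_left)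
    also have "(\<Sum>e\<in>D. A.coord (u * x e) (x e)) = (\<Sum>e\<in>D. A.coord (u * e) e)"
      by (rule sum.reindex_bij_betw[OF bij])
    finally show ?thesis by (simp add: trace_fun_def A.trace_on_def D)
  next
    case False
    then obtain p r where pr: "p \<in> D" "r \<in> D" "p \<noteq> r" "x p = x r" by (auto simp: inj_on_def)
    have gx: "g x = 0" by (rule alternating_equal_args[OF g pr])
    have other: "g (x(e := u * x e)) = 0" if "e \<in> D - {p, r}" for e
      using that pr by (intro alternating_equal_args[OF g pr(1-3)]) auto
    have "x(r := u * x r) = x(p := u * x p) \<circ> transpose p r"
      using pr by (auto simp: fun_eq_iff transpose_def fun_upd_apply)
    then have "g (x(r := u * x r)) = - g (x(p := u * x p))" using anti[OF pr(1-3)] by simp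
    then have "(\<Sum>e\<in>{p, r}. g (x(e := u * x e))) = 0" using pr by simp
    moreover have "\<Phi> x = (\<Sum>e\<in>{p, r}. g (x(e := u * x e)))"
      unfolding \<Phi>_def using other pr finD by (intro sum.mono_neutral_right) auto
    ultimately show ?thesis using gx by simp
  qed
  have \<Phi>_lin: "\<Phi> (x(k := (\<Sum>s\<in>S. sA (c s) (v s)))) = (\<Sum>s\<in>S. sA (c s) (\<Phi> (x(k := v s))))"
    if k: "k \<in> D" for k x c v and S :: "'a set"
  proof -
    let ?w = "\<Sum>s\<in>S. sA (c s) (v s)"
    have "g ((x(k := ?w))(e := u * (x(k := ?w)) e)) = (\<Sum>s\<in>S. sA (c s) (g ((x(k := v s))(e := u * (x(k := v s)) e))))"
      if e: "e \<in> D" for e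
    proof (cases "e = k")
      case True
      have "u * ?w = (\<Sum>s\<in>S. sA (c s) (u * v s))"
        by (simp add: sum_distrib_left A.scale_mult_right)
      moreover have "g (x(k := (\<Sum>s\<in>S. sA (c s) (u * v s)))) = (\<Sum>s\<in>S. sA (c s) (g (x(k := u * v s))))"
        by (rule lin[OF k])
      ultimately show ?thesis using True by simp
    next
      case False
      have "(x(k := z))(e := u * (x(k := z)) e) = (x(e := u * x e))(k := z)" for z
        using False by (auto simp: fun_eq_iff fun_upd_apply)
      then show ?thesis using lin[OF k] by simp
    qed
    then have "\<Phi> (x(k := ?w)) = (\<Sum>e\<in>D. \<Sum>s\<in>S. sA (c s) (g ((x(k := v s))(e := u * (x(k := v s)) e))))"
      unfolding \<Phi>_def by (intro sum.cong refl)
    also have "\<dots> = (\<Sum>s\<in>S. sA (c s) (\<Phi> (x(k := v s))))"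
      unfolding \<Phi>_def by (subst sum.swap) (simp add: A.scale_sum_right)
    finally show ?thesis .
  qed
  have gen: "\<lbrakk>\<And>e. e \<in> D \<Longrightarrow> x e \<in> A.span D; \<And>e. e \<in> D - K \<Longrightarrow> x e \<in> D\<rbrakk> \<Longrightarrow> \<Phi> x = sA (trace_fun I u) (g x)"
    if "finite K" "K \<subseteq> D" for K x
    using that
  proof (induction K arbitrary: x rule: finite_induct)
    case empty
    then show ?case using basis by simp
  next
    case (insert k K)
    have k: "k \<in> D" using insert.prems by simp
    have xk: "x k = (\<Sum>e\<in>D. sA (A.coord (x k) e) e)"
      by (rule A.coord_expand[OF DE insert.prems(1)[OF k]])
    have "\<Phi> x = \<Phi> (x(k := (\<Sum>e\<in>D. sA (A.coord (x k) e) e)))" using xk by simp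
    also have "\<dots> = (\<Sum>e\<in>D. sA (A.coord (x k) e) (\<Phi> (x(k := e))))" by (rule \<Phi>_lin[OF k])
    also have "\<dots> = (\<Sum>e\<in>D. sA (A.coord (x k) e) (sA (trace_fun I u) (g (x(k := e)))))"
    proof (rule sum.cong[OF refl])
      fix e assume e: "e \<in> D"
      have "\<Phi> (x(k := e)) = sA (trace_fun I u) (g (x(k := e)))"
        using insert e by (intro insert.IH) (auto simp: fun_upd_apply A.span_base)
      then show "sA (A.coord (x k) e) (\<Phi> (x(k := e))) = sA (A.coord (x k) e) (sA (trace_fun I u) (g (x(k := e))))"
        by simp
    qed
    also have "\<dots> = sA (trace_fun I u) (\<Sum>e\<in>D. sA (A.coord (x k) e) (g (x(k := e))))"
      by (simp add: A.scale_sum_right mult.commute)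
    also have "(\<Sum>e\<in>D. sA (A.coord (x k) e) (g (x(k := e)))) = g (x(k := (\<Sum>e\<in>D. sA (A.coord (x k) e) e)))"
      by (rule lin[OF k, symmetric])
    also have "\<dots> = g x" using xk by simp
    finally show ?case .
  qed
  have "\<Phi> x = sA (trace_fun I u) (g x)" by (rule gen[OF finD order_refl]) (use x in auto)
  then show ?thesis by (simp add: \<Phi>_def)
qed

text \<open>A sum of realizable functions with nonzero alternation has a summand with nonzero
  alternation, so that a single multilinear function can be chosen.\<close>

lemma alternating_initial:
  assumes ch: "is \<in> chains" and D: "D = block_basis (set is)"
  obtains k G y where "multilin (Inl ` D \<union> Inr ` {..<k::nat}) G"
    "alternating D (\<lambda>x. G (case_sum x y))" "G (case_sum id y) \<noteq> 0"
proof -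
  have "is": "is \<noteq> []" "distinct is" "set is \<subseteq> {1..q}" "BJ_chain sA Bs J is \<noteq> {0}"
    using ch by (auto simp: chains_def)
  have finD: "finite D" using finite_block_basis[OF "is"(3)] D by simp
  have "0 \<in> BJ_chain sA Bs J is"
  proof (cases "is")
    case (Cons i ks)
    then show ?thesis using "is"(3)
      by (cases ks) (auto simp: subspace_mult_def A.span_zero A.subspace_0 Bs_sub)
  qed (use "is"(1) in simp)
  then obtain y where y: "y \<in> BJ_chain sA Bs J is" "y \<noteq> 0" using "is"(4) by blast
  obtain Q where Q: "realizable_sum D Q" "\<And>x. (\<And>e. e \<in> D \<Longrightarrow> x e \<in> block_basis {1..q}) \<Longrightarrow> Q x = (if \<forall>e\<in>D. x e = e then y else 0)"
    using selects_chain[OF "is"(1-3) y(1)] D unfolding selects_def by blast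
  have DE: "D \<subseteq> block_basis {1..q}" using "is"(3) by (auto simp: D block_basis_def)
  have fin: "finite {\<sigma>. \<sigma> permutes D}" by (rule finite_permutations[OF finD])
  have "alt_sum D Q id = (\<Sum>\<sigma>\<in>{id}. sA (of_int (sign \<sigma>)) (Q (id \<circ> \<sigma>)))"
    unfolding alt_sum_def
  proof (rule sum.mono_neutral_right[OF fin])
    show "\<forall>\<sigma>\<in>{\<sigma>. \<sigma> permutes D} - {id}. sA (of_int (sign \<sigma>)) (Q (id \<circ> \<sigma>)) = 0"
    proof
      fix \<sigma> assume \<sigma>: "\<sigma> \<in> {\<sigma>. \<sigma> permutes D} - {id}"
      then have "\<not> (\<forall>e\<in>D. \<sigma> e = e)" by (auto simp: permutes_def fun_eq_iff)
      moreover have "\<sigma> e \<in> block_basis {1..q}" if "e \<in> D" for e using \<sigma> that DE permutes_in_image by fastforce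
      ultimately have "Q \<sigma> = 0" using Q(2)[of \<sigma>] by (metis (full_types))
      then show "sA (of_int (sign \<sigma>)) (Q (id \<circ> \<sigma>)) = 0" by simp
    qed
  qed (simp add: permutes_id)
  also have "\<dots> = y" using Q(2)[of id] DE by (simp add: subset_iff)
  finally have nz: "alt_sum D Q id \<noteq> 0" using y by simp
  have "\<exists>R. realizable D R \<and> alt_sum D R id \<noteq> 0"
    using Q(1) nz
  proof induction
    case (single Q)
    then show ?case by blast
  next
    case (add Q Q')
    have "alt_sum D (\<lambda>x. Q x + Q' x) id = alt_sum D Q id + alt_sum D Q' id"
      by (simp add: alt_sum_def A.scale_right_distrib sum.distrib)
    then have "alt_sum D Q id \<noteq> 0 \<or> alt_sum D Q' id \<noteq> 0" using add.prems by (metis add_0)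
    then show ?case using add.IH by blast
  qed
  then obtain k f z where f: "multilin (Inl ` D \<union> Inr ` {..<k::nat}) f" "alt_sum D (\<lambda>x. f (case_sum x z)) id \<noteq> 0"
    unfolding realizable_def by blast
  let ?I = "Inl ` D \<union> Inr ` {..<k} :: ('a + nat) set"
  define G where "G a = (\<Sum>\<sigma> | \<sigma> permutes D. sA (of_int (sign \<sigma>)) (f (\<lambda>i. a (map_sum \<sigma> id i))))" for a
  have G: "multilin ?I G"
    unfolding G_def
  proof (intro multilin_sum multilin.scale)
    fix \<sigma> assume "\<sigma> \<in> {\<sigma>. \<sigma> permutes D}"
    then have \<sigma>: "\<sigma> permutes D" by simp
    have "inj (map_sum \<sigma> (id :: nat \<Rightarrow> nat))" using permutes_inj[OF \<sigma>] by (intro sum.inj_map) auto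
    then have "multilin (map_sum \<sigma> id ` ?I) (\<lambda>a. f (\<lambda>i. a (map_sum \<sigma> id i)))"
      by (intro multilin_rename[OF f(1)]) (auto simp: inj_on_def)
    moreover have "map_sum \<sigma> id ` ?I = ?I"
    proof -
      have "map_sum \<sigma> id ` ?I = Inl ` (\<sigma> ` D) \<union> Inr ` {..<k}" by (simp add: image_Un image_image)
      then show ?thesis by (simp add: permutes_image[OF \<sigma>])
    qed
    ultimately show "multilin ?I (\<lambda>a. f (\<lambda>i. a (map_sum \<sigma> id i)))" by simp
  qed
  have Geq: "G (case_sum x z) = alt_sum D (\<lambda>x. f (case_sum x z)) x" for x
  proof -
    have "(\<lambda>i. case_sum x z (map_sum \<sigma> id i)) = case_sum (x \<circ> \<sigma>) z" for \<sigma> :: "'a \<Rightarrow> 'a"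
      by (rule ext) (auto split: sum.split)
    then show ?thesis unfolding G_def alt_sum_def by (simp only:)
  qed
  have upd: "case_sum (x(e := v)) z = (case_sum x z)(Inl e := v)" for x e v
    by (rule ext) (auto simp: fun_upd_apply split: sum.split)
  have "alternating D (\<lambda>x. G (case_sum x z))"
    unfolding alternating_def
  proof (intro conjI ballI allI impI)
    fix e x c v and S :: "'a set" assume "e \<in> D"
    then show "G (case_sum (x(e := (\<Sum>s\<in>S. sA (c s) (v s)))) z) = (\<Sum>s\<in>S. sA (c s) (G (case_sum (x(e := v s)) z)))"
      unfolding upd by (intro multilin_linear_sum[OF G]) simp
  next
    fix x p r assume "p \<in> D" "r \<in> D" "p \<noteq> r"
    then show "G (case_sum (x \<circ> transpose p r) z) = - G (case_sum x z)"
      unfolding Geq by (rule alt_sum_transpose[OF finD])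
  qed
  moreover have "G (case_sum id z) \<noteq> 0" using f(2) unfolding Geq .
  ultimately show thesis by (rule that[OF G])
qed

subsection \<open>Absorbing trace factors\<close>

text \<open>The multilinear function \<open>H\<close> extends \<open>g\<close> by a scalar factor
  \<open>W\<close>: the variables below \<open>k\<close> have the fixed values \<open>y\<close>,
  and those between \<open>k\<close> and \<open>m\<close> enter the factor.\<close>

definition trace_extension :: "'a set \<Rightarrow> (('a \<Rightarrow> 'a) \<Rightarrow> 'a) \<Rightarrow> nat \<Rightarrow> (nat \<Rightarrow> 'a) \<Rightarrow> nat \<Rightarrow>
    (('a + nat \<Rightarrow> 'a) \<Rightarrow> 'a) \<Rightarrow> ((nat \<Rightarrow> 'a) \<Rightarrow> 'f) \<Rightarrow> bool" where
  "trace_extension D g k y m H W \<longleftrightarrow> multilin (Inl ` D \<union> Inr ` {..<m}) H \<and>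
     (\<forall>x z. (\<forall>e\<in>D. x e \<in> A.span D) \<longrightarrow> (\<forall>j<k. z j = y j) \<longrightarrow> (\<forall>j\<in>{k..<m}. z j \<in> A.span D) \<longrightarrow>
        H (case_sum x z) = sA (W z) (g x))"

lemma trace_extension_step:
  fixes H mm :: "('a + nat \<Rightarrow> 'a) \<Rightarrow> 'a"
  assumes I: "I \<subseteq> {1..q}" and D: "D = block_basis I" and g: "alternating D g"
    and H: "trace_extension D g k y m H W" and mm: "multilin (Inr ` {m..<m+l}) mm"
    and mv: "\<And>x z. mm (case_sum x z) = mv z"
    and mspan: "\<And>z. (\<And>j. j \<in> {m..<m+l} \<Longrightarrow> z j \<in> A.span D) \<Longrightarrow> mv z \<in> A.span D" and km: "k \<le> m"
  shows "\<exists>H'. trace_extension D g k y (m + l) H' (\<lambda>z. W z * trace_fun I (mv z))"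
proof -
  \<comment> \<open>The variable \<open>x\<^sub>e\<close> stays in place and is multiplied by the
    new product \<open>mm\<close>.\<close>
  define H' where "H' a = (\<Sum>e\<in>D. H (a(Inl e := mm a * a (Inl e))))" for a
  have Hm: "multilin (Inl ` D \<union> Inr ` {..<m}) H" using H by (simp add: trace_extension_def)
  have Hv: "H (case_sum x z) = sA (W z) (g x)"
    if "\<And>e. e \<in> D \<Longrightarrow> x e \<in> A.span D" "\<And>j. j < k \<Longrightarrow> z j = y j" "\<And>j. j \<in> {k..<m} \<Longrightarrow> z j \<in> A.span D" for x z
    using H that unfolding trace_extension_def by blast
  have un: "{..<m+l} = {..<m} \<union> {m..<m+l}" by auto
  have "multilin (Inl ` D \<union> Inr ` {..<m+l}) H'"
    unfolding H'_def
  proof (rule multilin_sum)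
    fix e assume e: "e \<in> D"
    have "multilin (Inr ` {m..<m+l} \<union> {Inl e}) (\<lambda>a. mm a * a (Inl e))"
      by (intro multilin_mult mm multilin_id) auto
    moreover have "(Inl ` D \<union> Inr ` {..<m} - {Inl e}) \<inter> (Inr ` {m..<m+l} \<union> {Inl e}) = {}" by auto
    moreover have "Inl e \<in> Inl ` D \<union> Inr ` {..<m}" using e by simp
    ultimately have "multilin ((Inl ` D \<union> Inr ` {..<m}) - {Inl e} \<union> (Inr ` {m..<m+l} \<union> {Inl e})) (\<lambda>a. H (a(Inl e := mm a * a (Inl e))))"
      by (rule multilin_subst[OF Hm])
    moreover have "(Inl ` D \<union> Inr ` {..<m}) - {Inl e} \<union> (Inr ` {m..<m+l} \<union> {Inl e}) = Inl ` D \<union> Inr ` {..<m+l}"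
      unfolding un using e by auto
    ultimately show "multilin (Inl ` D \<union> Inr ` {..<m+l}) (\<lambda>a. H (a(Inl e := mm a * a (Inl e))))" by simp
  qed
  moreover have "H' (case_sum x z) = sA (W z * trace_fun I (mv z)) (g x)"
    if x: "\<And>e. e \<in> D \<Longrightarrow> x e \<in> A.span D" and z: "\<And>j. j < k \<Longrightarrow> z j = y j"
      "\<And>j. j \<in> {k..<m+l} \<Longrightarrow> z j \<in> A.span D" for x z
  proof -
    have mvD: "mv z \<in> A.span D" using z(2) km by (intro mspan) auto
    have "H' (case_sum x z) = (\<Sum>e\<in>D. H (case_sum (x(e := mv z * x e)) z))"
    proof -
      have "(case_sum x z)(Inl e := v) = case_sum (x(e := v)) z" for e v
        by (rule ext) (auto simp: fun_upd_apply split: sum.split)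
      then show ?thesis by (simp add: H'_def mv)
    qed
    also have "\<dots> = (\<Sum>e\<in>D. sA (W z) (g (x(e := mv z * x e))))"
    proof (intro sum.cong refl Hv)
      fix e e' assume e: "e \<in> D" "e' \<in> D"
      show "(x(e := mv z * x e)) e' \<in> A.span D"
        using x e span_block_basis_mult[OF I] mvD unfolding D by (auto simp: fun_upd_apply)
    qed (use z in auto)
    also have "\<dots> = sA (W z) (\<Sum>e\<in>D. g (x(e := mv z * x e)))" by (simp add: A.scale_sum_right)
    also have "\<dots> = sA (W z) (sA (trace_fun I (mv z)) (g x))"
      by (subst alternating_trace[OF I D g mvD x]) auto
    finally show ?thesis by simp
  qed
  ultimately show ?thesis unfolding trace_extension_def by blast
qed

lemma trace_extension_pairs:
  assumes I: "I \<subseteq> {1..q}" and D: "D = block_basis I" and g: "alternating D g"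
    and H: "trace_extension D g k y k H (\<lambda>_. c)"
  shows "\<exists>H. trace_extension D g k y (k + 2 * N) H (\<lambda>z. c * (\<Prod>i<N. trace_fun I (z (k + 2 * i) * z (k + 2 * i + 1))))"
proof (induction N)
  case 0
  then show ?case using H by auto
next
  case (Suc N)
  let ?m = "k + 2 * N"
  obtain H where H: "trace_extension D g k y ?m H (\<lambda>z. c * (\<Prod>i<N. trace_fun I (z (k + 2 * i) * z (k + 2 * i + 1))))"
    using Suc by blast
  have "\<exists>H'. trace_extension D g k y (?m + 2) H'
      (\<lambda>z. (c * (\<Prod>i<N. trace_fun I (z (k + 2 * i) * z (k + 2 * i + 1)))) * trace_fun I (z ?m * z (?m + 1)))"
  proof (rule trace_extension_step[OF I D g H])
    have "multilin ({Inr ?m} \<union> {Inr (?m + 1)}) (\<lambda>a :: 'a + nat \<Rightarrow> 'a. a (Inr ?m) * a (Inr (?m + 1)))"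
      by (intro multilin_mult multilin_id) auto
    moreover have "{Inr ?m} \<union> {Inr (?m + 1)} = (Inr ` {?m..<?m + 2} :: ('a + nat) set)" by auto
    ultimately show "multilin (Inr ` {?m..<?m + 2}) (\<lambda>a :: 'a + nat \<Rightarrow> 'a. a (Inr ?m) * a (Inr (?m + 1)))" by simp
    show "z ?m * z (?m + 1) \<in> A.span D" if "\<And>j. j \<in> {?m..<?m + 2} \<Longrightarrow> z j \<in> A.span D" for z
      using that span_block_basis_mult[OF I] unfolding D by auto
  qed auto
  then show ?case by (simp add: mult.assoc)
qed

text \<open>A trace factor in three variables with fixed values. It is needed since the pairs of
  variables reach only one parity of the number of variables.\<close>

lemma trace_extension_triple:
  assumes I: "I \<subseteq> {1..q}" "I \<noteq> {}" and D: "D = block_basis I" and g: "alternating D g"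
    and H: "trace_extension D g k y k H (\<lambda>_. 1)"
  shows "\<exists>H y' c. c \<noteq> 0 \<and> trace_extension D g (k + 3) y' (k + 3) H (\<lambda>_. c)"
proof -
  have "\<exists>H'. trace_extension D g k y (k + 3) H' (\<lambda>z. 1 * trace_fun I (z k * (z (k + 1) * z (k + 2))))"
  proof (rule trace_extension_step[OF I(1) D g H])
    have "multilin ({Inr k} \<union> ({Inr (k + 1)} \<union> {Inr (k + 2)}))
        (\<lambda>a :: 'a + nat \<Rightarrow> 'a. a (Inr k) * (a (Inr (k + 1)) * a (Inr (k + 2))))"
      by (intro multilin_mult multilin_id) auto
    moreover have "{Inr k} \<union> ({Inr (k + 1)} \<union> {Inr (k + 2)}) = (Inr ` {k..<k + 3} :: ('a + nat) set)"
    proof -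
      have "{k..<k + 3} = {k, k + 1, k + 2}" by auto
      then show ?thesis by auto
    qed
    ultimately show "multilin (Inr ` {k..<k + 3})
        (\<lambda>a :: 'a + nat \<Rightarrow> 'a. a (Inr k) * (a (Inr (k + 1)) * a (Inr (k + 2))))" by simp
    show "z k * (z (k + 1) * z (k + 2)) \<in> A.span D" if "\<And>j. j \<in> {k..<k + 3} \<Longrightarrow> z j \<in> A.span D" for z
      using that span_block_basis_mult[OF I(1)] unfolding D by auto
  qed auto
  then obtain H' where H': "trace_extension D g k y (k + 3) H' (\<lambda>z. 1 * trace_fun I (z k * (z (k + 1) * z (k + 2))))" by blast
  obtain i where i: "i \<in> I" using I(2) by blast
  then obtain v w where vw: "v \<in> Bs i" "w \<in> Bs i" "v * w \<noteq> 0" using Bs_not_null I(1) by blast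
  then have vwD: "v \<in> A.span D" "w \<in> A.span D" using Bs_in_span[OF I(1) i] D by auto
  then have "v * w \<in> A.span D" using span_block_basis_mult[OF I(1)] D by simp
  then obtain u where u: "u \<in> A.span D" "trace_fun I (v * w * u) \<noteq> 0"
    using trace_fun_nondegenerate[OF I(1)] vw(3) D by blast
  have c: "trace_fun I (u * (v * w)) \<noteq> 0" 
    using u trace_fun_commute[OF I(1), of "v * w" u] \<open>v * w \<in> A.span D\<close> D by simp
  define y' where "y' = y(k := u, k + 1 := v, k + 2 := w)"
  have "trace_extension D g (k + 3) y' (k + 3) H' (\<lambda>_. trace_fun I (u * (v * w)))"
    unfolding trace_extension_def
  proof (intro conjI allI impI)
    show "multilin (Inl ` D \<union> Inr ` {..<k + 3}) H'" using H' by (simp add: trace_extension_def)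
    fix x z assume x: "\<forall>e\<in>D. x e \<in> A.span D" and z: "\<forall>j<k + 3. z j = y' j"
    have zk: "z k = u" "z (k + 1) = v" "z (k + 2) = w" using z by (auto simp: y'_def)
    have "\<forall>j<k. z j = y j" using z by (auto simp: y'_def)
    moreover have "\<forall>j\<in>{k..<k + 3}. z j \<in> A.span D"
    proof
      fix j assume "j \<in> {k..<k + 3}"
      then have "j = k \<or> j = k + 1 \<or> j = k + 2" by auto
      then show "z j \<in> A.span D" using zk u vwD by auto
    qed
    ultimately have "H' (case_sum x z) = sA (1 * trace_fun I (z k * (z (k + 1) * z (k + 2)))) (g x)"
      using H' x unfolding trace_extension_def by blast
    then show "H' (case_sum x z) = sA (trace_fun I (u * (v * w))) (g x)" by (simp only: zk mult_1)
  qed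
  then show ?thesis using c by blast
qed

text \<open>For \<open>i < N\<close> the variable with number \<open>k + 2i\<close> is
  \<open>u\<^sub>i\<close> and the one with number \<open>k + 2i + 1\<close> is
  \<open>v\<^sub>i\<close>. The renaming \<open>\<rho> s\<close> replaces \<open>v\<^sub>i\<close>
  by \<open>v\<^bsub>p s i\<^esub>\<close>, and at the point \<open>zz r\<close> the variables
  spell the words of \<open>r\<close> in the basis and in the dual basis.\<close>

lemma trace_extension_codim:
  assumes I: "I \<subseteq> {1..q}" "I \<noteq> {}" and D: "D = block_basis I" and g: "g id \<noteq> 0"
    and H: "trace_extension D g k y (k + 2 * N) H (\<lambda>z. c * (\<Prod>i<N. trace_fun I (z (k + 2 * i) * z (k + 2 * i + 1))))"
    and c: "c \<noteq> 0" and t: "card D \<le> t" "t * L \<le> N"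
    and G: "G \<subseteq> {..<L} \<rightarrow>\<^sub>E {..<card D}" "\<And>g i. g \<in> G \<Longrightarrow> card {x\<in>{..<L}. g x = i} = cc i"
  shows "card G ^ (2 * t - card D) \<le> H_codim sH sA act \<Gamma> (card D + k + 2 * N)"
proof -
  have finD: "finite D" using finite_block_basis[OF I(1)] D by simp
  have "D \<noteq> {}"
  proof -
    obtain i where i: "i \<in> I" using I(2) by blast
    then have "Es i \<noteq> {}" using Es_span[of i] Bs_nonzero[of i] I(1) by auto
    then show ?thesis using i by (auto simp: D block_basis_def)
  qed
  then have d1: "card D \<ge> 1" using finD by (simp add: Suc_le_eq card_gt_0_iff)
  obtain S :: "((nat \<Rightarrow> nat \<Rightarrow> nat) \<times> (nat \<Rightarrow> nat \<Rightarrow> nat)) set" and w v p where S: "finite S" "card G ^ (2 * t - card D) \<le> card S"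
    and perm: "\<And>s. s \<in> S \<Longrightarrow> p s permutes {..<N}"
    and wv: "\<And>s i. s \<in> S \<Longrightarrow> i < N \<Longrightarrow> w s i < card D \<and> v s i < card D"
    and rigid: "\<And>s r. s \<in> S \<Longrightarrow> r \<in> S \<Longrightarrow> (\<forall>i<N. v r (p s i) = w r i) \<longleftrightarrow> r = s"
  proof (rule rigid_matchings[OF d1 t G])
    fix S :: "((nat \<Rightarrow> nat \<Rightarrow> nat) \<times> (nat \<Rightarrow> nat \<Rightarrow> nat)) set" and w v p
    assume *: "finite S" "card G ^ (2 * t - card D) \<le> card S"
      "\<And>s. s \<in> S \<Longrightarrow> p s permutes {..<N}"
      "\<And>s i. s \<in> S \<Longrightarrow> i < N \<Longrightarrow> w s i < card D \<and> v s i < card D"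
      "\<And>s r. s \<in> S \<Longrightarrow> r \<in> S \<Longrightarrow> (\<forall>i<N. v r (p s i) = w r i) \<longleftrightarrow> r = s"
    show thesis by (rule that[of S p w v]) (fact *)+
  qed
  obtain en where en: "bij_betw en {..<card D} D"
    using ex_bij_betw_nat_finite[OF finD] by (auto simp: atLeast0LessThan)
  obtain dual where dual: "\<And>e. e \<in> D \<Longrightarrow> dual e \<in> A.span D"
    "\<And>e e'. e \<in> D \<Longrightarrow> e' \<in> D \<Longrightarrow> trace_fun I (e * dual e') = (if e = e' then 1 else 0)"
    using trace_fun_dual_basis[OF I(1)] D by metis
  let ?J = "Inl ` D \<union> Inr ` {..<k + 2 * N} :: ('a + nat) set"
  let ?n = "card D + k + 2 * N"
  define \<rho> where "\<rho> s j = (if k \<le> j \<and> odd (j - k) \<and> j < k + 2 * N then k + 2 * p s ((j - k) div 2) + 1 else j)" for s j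
  define F where "F s a = H (\<lambda>i. a (map_sum id (\<rho> s) i))" for s and a :: "'a + nat \<Rightarrow> 'a"
  define zz where "zz r j = (if j < k then y j else if even (j - k) then en (w r ((j - k) div 2))
      else dual (en (v r ((j - k) div 2))))" for r j
  have \<rho>_even: "\<rho> s (k + 2 * i) = k + 2 * i" for s i by (simp add: \<rho>_def)
  have \<rho>_odd: "\<rho> s (k + 2 * i + 1) = k + 2 * p s i + 1" if "i < N" for s i
    using that by (simp add: \<rho>_def)
  have \<rho>_low: "\<rho> s j = j" if "j < k" for s j using that by (simp add: \<rho>_def)
  have split: "j < k \<or> (\<exists>i<N. j = k + 2 * i) \<or> (\<exists>i<N. j = k + 2 * i + 1)" if "j < k + 2 * N" for j
  proof (cases "j < k")
    case False
    define i where "i = (j - k) div 2"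
    have "i < N" using that False by (auto simp: i_def)
    moreover have "j = k + 2 * i \<or> j = k + 2 * i + 1" using False unfolding i_def by presburger
    ultimately show ?thesis by blast
  qed simp
  have p_lt: "p s i < N" if "s \<in> S" "i < N" for s i
    using permutes_in_image[OF perm[OF that(1)], of i] that(2) by simp
  have \<rho>_perm: "inj_on (map_sum id (\<rho> s)) ?J \<and> map_sum id (\<rho> s) ` ?J = ?J" if s: "s \<in> S" for s
  proof -
    have into: "\<rho> s j < k + 2 * N" if "j < k + 2 * N" for j
      using split[OF that] p_lt[OF s] \<rho>_low[of j s] \<rho>_even[of s] \<rho>_odd[of _ s] that by fastforce
    have inj: "inj_on (\<rho> s) {..<k + 2 * N}"
    proof (rule inj_onI)
      fix j j' assume j: "j \<in> {..<k + 2 * N}" "j' \<in> {..<k + 2 * N}" and eq: "\<rho> s j = \<rho> s j'"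
      have pinj: "p s i = p s i' \<Longrightarrow> i = i'" for i i' using permutes_inj[OF perm[OF s]] by (auto simp: inj_on_def)
      from split[of j] split[of j'] j
      consider "j < k" | i where "i < N" "j = k + 2 * i" | i where "i < N" "j = k + 2 * i + 1" by auto
      then show "j = j'"
      proof cases
        case 1
        from split[of j'] j 1 eq show ?thesis
          by (auto simp: \<rho>_low \<rho>_even \<rho>_odd[simplified])
      next
        case 2
        from split[of j'] j eq show ?thesis
          unfolding 2 \<rho>_even by (auto simp: \<rho>_low \<rho>_even \<rho>_odd[simplified]; presburger)
      next
        case 3
        from split[of j'] j eq show ?thesis
          unfolding 3 \<rho>_odd[OF 3(1)] by (auto simp: \<rho>_low \<rho>_even \<rho>_odd[simplified] dest: pinj; presburger)
      qed
    qed
    have surj: "\<rho> s ` {..<k + 2 * N} = {..<k + 2 * N}"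
      using into inj by (intro endo_inj_surj) auto
    have "map_sum id (\<rho> s) ` ?J = Inl ` D \<union> Inr ` (\<rho> s ` {..<k + 2 * N})"
      by (simp add: image_Un image_image)
    then show ?thesis using inj surj by (auto simp: inj_on_def)
  qed
  have Hm: "multilin ?J H" using H by (simp add: trace_extension_def)
  have Fm: "multilin ?J (F s)" if s: "s \<in> S" for s
    using multilin_rename[OF Hm, of "map_sum id (\<rho> s)"] \<rho>_perm[OF s] by (simp add: F_def[abs_def])
  have enD: "en i \<in> D" if "i < card D" for i using en that by (auto simp: bij_betw_def)
  have en_inj: "en i = en j \<longleftrightarrow> i = j" if "i < card D" "j < card D" for i j
    using en that by (auto simp: bij_betw_def inj_on_def)
  have Fval: "F s (case_sum id (zz r)) \<noteq> 0 \<longleftrightarrow> r = s" if s: "s \<in> S" and r: "r \<in> S" for s r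
  proof -
    define z where "z j = zz r (\<rho> s j)" for j
    have "(\<lambda>i. case_sum id (zz r) (map_sum id (\<rho> s) i)) = case_sum id z"
      by (rule ext) (auto simp: z_def split: sum.split)
    then have 1: "F s (case_sum id (zz r)) = H (case_sum id z)" by (simp add: F_def)
    have ze: "z (k + 2 * i) = en (w r i)" for i unfolding z_def \<rho>_even by (simp add: zz_def)
    have zo: "z (k + 2 * i + 1) = dual (en (v r (p s i)))" if "i < N" for i
      unfolding z_def \<rho>_odd[OF that] by (simp add: zz_def)
    have "H (case_sum id z) = sA (c * (\<Prod>i<N. trace_fun I (z (k + 2 * i) * z (k + 2 * i + 1)))) (g id)"
    proof -
      have "\<forall>e\<in>D. id e \<in> A.span D" by (simp add: A.span_base)
      moreover have "\<forall>j<k. z j = y j" by (simp add: z_def \<rho>_low zz_def)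
      moreover have "\<forall>j\<in>{k..<k + 2 * N}. z j \<in> A.span D"
      proof
        fix j assume j: "j \<in> {k..<k + 2 * N}"
        then consider i where "i < N" "j = k + 2 * i" | i where "i < N" "j = k + 2 * i + 1"
          using split[of j] by auto
        then show "z j \<in> A.span D"
        proof cases
          case 1
          then show ?thesis unfolding 1(2) ze using wv[OF r 1(1)] enD A.span_base by blast
        next
          case 2
          then show ?thesis unfolding 2(2) zo[OF 2(1)] using wv[OF r p_lt[OF s 2(1)]] enD dual(1) by blast
        qed
      qed
      ultimately show ?thesis using H unfolding trace_extension_def by blast
    qed
    moreover have "(\<Prod>i<N. trace_fun I (z (k + 2 * i) * z (k + 2 * i + 1))) \<noteq> 0 \<longleftrightarrow> (\<forall>i<N. v r (p s i) = w r i)"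
    proof -
      have "trace_fun I (z (k + 2 * i) * z (k + 2 * i + 1)) \<noteq> 0 \<longleftrightarrow> v r (p s i) = w r i" if i: "i < N" for i
        unfolding ze zo[OF i]
        using dual(2)[of "en (w r i)" "en (v r (p s i))"] enD wv[OF r i] wv[OF r p_lt[OF s i]] en_inj by auto
      then show ?thesis by (auto simp: prod_zero_iff)
    qed
    ultimately show ?thesis using 1 c g rigid[OF s r] by simp
  qed
  have cardJ: "card ?J = ?n"
    using finD by (subst card_Un_disjoint) (auto simp: card_image)
  have "finite ?J" using finD by simp
  then obtain \<beta> where \<beta>: "bij_betw \<beta> ?J {1..?n}"
    using finite_same_card_bij[of ?J "{1..?n}"] cardJ by auto
  define \<beta>' where "\<beta>' = inv_into ?J \<beta>"
  have inv: "\<beta>' (\<beta> i) = i" if "i \<in> ?J" for i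
    unfolding \<beta>'_def using \<beta> that by (auto simp: bij_betw_def intro: inv_into_f_f)
  have "card S \<le> H_codim sH sA act \<Gamma> ?n"
  proof (rule H_codim_ge[where F = "\<lambda>s a. F s (\<lambda>i. a (\<beta> i))" and pt = "\<lambda>r j. case_sum id (zz r) (\<beta>' j)"])
    show "1 \<le> ?n" using d1 by simp
    show "multilin {1..?n} (\<lambda>a. F s (\<lambda>i. a (\<beta> i)))" if "s \<in> S" for s
      using multilin_rename[OF Fm[OF that], of \<beta>] \<beta> by (simp add: bij_betw_def)
    show "F s (\<lambda>i. case_sum id (zz r) (\<beta>' (\<beta> i))) \<noteq> 0 \<longleftrightarrow> r = s" if "s \<in> S" "r \<in> S" for s r
    proof -
      have "F s (\<lambda>i. case_sum id (zz r) (\<beta>' (\<beta> i))) = F s (case_sum id (zz r))"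
        by (rule multilin_cong[OF Fm[OF that(1)]]) (simp only: inv)
      then show ?thesis using Fval[OF that] by simp
    qed
  qed (fact S(1))
  then show ?thesis using S(2) by simp
qed

theorem codim_lower_bound:
  assumes q: "q \<ge> 1"
  obtains k where "\<And>L t n. dA \<le> t \<Longrightarrow> k + 2 * (t * L) \<le> n \<Longrightarrow>
    \<exists>K. dA ^ L \<le> (L + 1) ^ dA * K \<and> K ^ (2 * t - dA) \<le> H_codim sH sA act \<Gamma> n"
proof -
  obtain "is" where "is": "is \<in> chains" "dA = card (block_basis (set is))" using dA_attained[OF q] by blast
  define I D where "I = set is" and "D = block_basis I"
  have I: "I \<subseteq> {1..q}" "I \<noteq> {}" using "is"(1) by (auto simp: I_def chains_def)
  have dA: "dA = card D" using "is"(2) by (simp add: D_def I_def)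
  obtain k G y where G: "multilin (Inl ` D \<union> Inr ` {..<k::nat}) G"
    "alternating D (\<lambda>x. G (case_sum x y))" "G (case_sum id y) \<noteq> 0"
    using alternating_initial[OF "is"(1), of D] by (auto simp: D_def I_def)
  define g where "g x = G (case_sum x y)" for x
  have g: "alternating D g" "g id \<noteq> 0" using G by (simp_all add: g_def[abs_def])
  have "trace_extension D g k y k G (\<lambda>_. 1)"
    unfolding trace_extension_def
  proof (intro conjI allI impI)
    fix x z assume "\<forall>j<k. z j = y j"
    then have "G (case_sum x z) = G (case_sum x y)" by (intro multilin_cong[OF G(1)]) auto
    then show "G (case_sum x z) = sA 1 (g x)" by (simp add: g_def)
  qed (fact G(1))
  note base = this
  obtain H' y' c' where triple: "c' \<noteq> 0" "trace_extension D g (k + 3) y' (k + 3) H' (\<lambda>_. c')"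
    using trace_extension_triple[OF I D_def g(1) base] by blast
  show thesis
  proof (rule that[of "card D + k + 3"])
    fix L t n assume t: "dA \<le> t" and n: "card D + k + 3 + 2 * (t * L) \<le> n"
    obtain W cc where W: "W \<subseteq> {..<L} \<rightarrow>\<^sub>E {..<card D}" "\<And>g i. g \<in> W \<Longrightarrow> card {x\<in>{..<L}. g x = i} = cc i"
      "card D ^ L \<le> (L + 1) ^ card D * card W"
    proof (rule large_content_class[of L "card D"])
      fix W cc
      assume "W \<subseteq> {..<L} \<rightarrow>\<^sub>E {..<card D}" "\<And>g i. g \<in> W \<Longrightarrow> card {x\<in>{..<L}. g x = i} = cc i"
        "card D ^ L \<le> (L + 1) ^ card D * card W"
      then show thesis by (rule that)
    qed
    have t': "card D \<le> t" using t dA by simp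
    have "card W ^ (2 * t - card D) \<le> H_codim sH sA act \<Gamma> n"
    proof (cases "even (n - card D - k)")
      case True
      then obtain N where N: "n - card D - k = 2 * N" by (elim evenE)
      then have n_eq: "n = card D + k + 2 * N" and tN: "t * L \<le> N" using n by auto
      obtain H where H: "trace_extension D g k y (k + 2 * N) H
          (\<lambda>z. 1 * (\<Prod>i<N. trace_fun I (z (k + 2 * i) * z (k + 2 * i + 1))))"
        using trace_extension_pairs[OF I(1) D_def g(1) base] by blast
      show ?thesis unfolding n_eq
        by (rule trace_extension_codim[OF I D_def g(2) H _ t' tN W(1,2)]) simp_all
    next
      case False
      then obtain M where M: "n - card D - k = 2 * M + 1" by (elim oddE)
      \<comment> \<open>Three of the remaining variables go into the fixed trace factor, and
        \<open>2 M + 1 = 3 + 2 N\<close>.\<close>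
      define N where "N = M - 1"
      have n_eq: "n = card D + (k + 3) + 2 * N" and tN: "t * L \<le> N" using n M by (auto simp: N_def)
      obtain H where H: "trace_extension D g (k + 3) y' (k + 3 + 2 * N) H
          (\<lambda>z. c' * (\<Prod>i<N. trace_fun I (z (k + 3 + 2 * i) * z (k + 3 + 2 * i + 1))))"
        using trace_extension_pairs[OF I(1) D_def g(1) triple(2)] by blast
      show ?thesis unfolding n_eq
        by (rule trace_extension_codim[OF I D_def g(2) H triple(1) t' tN W(1,2)]) simp_all
    qed
    then show "\<exists>K. dA ^ L \<le> (L + 1) ^ dA * K \<and> K ^ (2 * t - dA) \<le> H_codim sH sA act \<Gamma> n"
      using W(3) unfolding dA by blast
  qed
qed

end

section \<open>The limit\<close>

text \<open>The upper bounds allow every \<open>d + x e\<close> as base. The lower bounds, with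
  \<open>t\<close> about \<open>n / 2L\<close>, allow as base the number \<open>d /
  (2L)\<^bsup>d/L\<^esup>\<close>, which tends to \<open>d\<close> as \<open>L\<close> grows.\<close>

lemma nth_root_limit:
  fixes c :: "nat \<Rightarrow> nat" and d e k :: nat
  assumes d: "d \<ge> 1"
    and upper: "\<And>x. 0 < x \<Longrightarrow> x \<le> 1 \<Longrightarrow> \<exists>C>0. \<forall>n\<ge>1. real (c n) \<le> C * (real d + x * real e) ^ n"
    and lower: "\<And>L t n. d \<le> t \<Longrightarrow> k + 2 * (t * L) \<le> n \<Longrightarrow>
      \<exists>K. d ^ L \<le> (L + 1) ^ d * K \<and> K ^ (2 * t - d) \<le> c n"
  shows "(\<lambda>n. root n (real (c n))) \<longlonglongrightarrow> real d"
proof (rule order_tendstoI)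
  fix u assume u: "real d < u"
  \<comment> \<open>small enough that \<open>d + x e < u\<close>\<close>
  define x where "x = min 1 ((u - real d) / (2 * (real e + 1)))"
  have x: "0 < x" "x \<le> 1" using u by (auto simp: x_def)
  have "x * real e < u - real d"
  proof -
    have "x * (real e + 1) \<le> (u - real d) / 2"
    proof -
      have "x \<le> (u - real d) / (2 * (real e + 1))" by (simp add: x_def)
      then have "x * (real e + 1) \<le> (u - real d) / (2 * (real e + 1)) * (real e + 1)"
        by (intro mult_right_mono) auto
      also have "\<dots> = (u - real d) / 2" by (simp add: field_simps)
      finally show ?thesis .
    qed
    then show ?thesis using x u by (simp add: algebra_simps)
  qed
  then have y: "real d + x * real e < u" by simp
  obtain C where C: "C > 0" "\<And>n. n \<ge> 1 \<Longrightarrow> real (c n) \<le> C * (real d + x * real e) ^ n"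
    using upper[OF x] by blast
  have le: "root n (real (c n)) \<le> root n C * (real d + x * real e)" if n: "n \<ge> 1" for n
  proof -
    have "root n (real (c n)) \<le> root n (C * (real d + x * real e) ^ n)"
      using C(2)[OF n] n by (intro real_root_le_mono) auto
    also have "\<dots> = root n C * (real d + x * real e)"
      using n x by (simp add: real_root_mult real_root_power_cancel)
    finally show ?thesis .
  qed
  have "(\<lambda>n. root n C * (real d + x * real e)) \<longlonglongrightarrow> 1 * (real d + x * real e)"
    by (intro tendsto_intros LIMSEQ_root_const C)
  then have "\<forall>\<^sub>F n in sequentially. root n C * (real d + x * real e) < u"
    using y by (intro order_tendstoD(2)) auto
  then show "\<forall>\<^sub>F n in sequentially. root n (real (c n)) < u"
    using eventually_ge_at_top[of 1] by eventually_elim (use le in \<open>force intro: le_less_trans\<close>)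
next
  fix l assume l: "l < real d"
  show "\<forall>\<^sub>F n in sequentially. l < root n (real (c n))"
  proof (cases "l < 1")
    case True
    have "\<forall>\<^sub>F n in sequentially. n \<ge> Suc k" by (rule eventually_ge_at_top)
    then show ?thesis
    proof eventually_elim
      case (elim n)
      obtain K where K: "d ^ 0 \<le> (0 + 1) ^ d * K" "K ^ (2 * d - d) \<le> c n"
        using lower[of d 0 n] elim by auto
      then have "1 \<le> K ^ (2 * d - d)" by (intro one_le_power) simp
      then have "c n \<ge> 1" using K(2) by (rule le_trans)
      then have "root n (real (c n)) \<ge> 1" using elim by simp
      then show ?case using True by simp
    qed
  next
    case False
    have dpos: "real d > 0" using d by simp
    have "(\<lambda>L. real d / (root L 2 * root L (real L)) ^ d) \<longlonglongrightarrow> real d / (1 * 1) ^ d"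
      by (intro tendsto_intros LIMSEQ_root_const LIMSEQ_root) auto
    then have "\<forall>\<^sub>F L in sequentially. l < real d / (root L 2 * root L (real L)) ^ d"
      using l by (intro order_tendstoD(1)) auto
    then have "\<forall>\<^sub>F L in sequentially. l < real d / (root L 2 * root L (real L)) ^ d \<and> L \<ge> 1"
      using eventually_ge_at_top[of 1] by eventually_elim auto
    then obtain L where L: "l < real d / (root L 2 * root L (real L)) ^ d" "L \<ge> 1"
      using eventually_happens' sequentially_bot by blast
    define \<kappa> where "\<kappa> = real d / (root L 2 * root L (real L)) ^ d"
    have \<kappa>l: "l < \<kappa>" using L by (simp add: \<kappa>_def)
    then have \<kappa>1: "1 \<le> \<kappa>" using False by simp
    have \<kappa>K: "\<kappa> ^ L \<le> real K" if K: "d ^ L \<le> (L + 1) ^ d * K" for K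
    proof -
      have eq: "\<kappa> ^ L = real d ^ L / (2 * real L) ^ d"
      proof -
        have "((root L 2 * root L (real L)) ^ d) ^ L = ((root L 2 * root L (real L)) ^ L) ^ d"
          by (simp only: power_mult[symmetric] mult.commute)
        also have "(root L 2 * root L (real L)) ^ L = 2 * real L"
          using L(2) by (simp add: power_mult_distrib)
        finally show ?thesis by (simp add: \<kappa>_def power_divide)
      qed
      have "real d ^ L \<le> (real L + 1) ^ d * real K"
        using of_nat_mono[OF K, where ?'a = real] by (simp add: add.commute)
      also have "\<dots> \<le> (2 * real L) ^ d * real K"
        using L(2) by (intro mult_right_mono power_mono) auto
      finally show ?thesis unfolding eq using L(2) by (simp add: divide_le_eq mult.commute)
    qed
    \<comment> \<open>\<open>M\<close> bounds the number of variables that do not contribute to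
      the exponent of \<open>\<kappa>\<close>.\<close>
    define M where "M = k + 2 * L + L * d"
    have low: "\<kappa> / root n (\<kappa> ^ M) \<le> root n (real (c n))" if n: "n \<ge> k + 2 * L * (d + 1) + 1" for n
    proof -
      define t where "t = (n - k) div (2 * L)"
      have "d + 1 \<le> t"
      proof -
        have "(d + 1) * (2 * L) \<le> n - k" using n by (simp add: algebra_simps)
        then show ?thesis unfolding t_def using L(2) by (simp add: less_eq_div_iff_mult_less_eq)
      qed
      have "2 * (t * L) \<le> n - k" unfolding t_def
        using div_times_less_eq_dividend[of "n - k" "2 * L"] by (simp add: algebra_simps)
      then have tn: "k + 2 * (t * L) \<le> n" using n by simp
      obtain K where K: "d ^ L \<le> (L + 1) ^ d * K" "K ^ (2 * t - d) \<le> c n"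
        using lower[OF _ tn] \<open>d + 1 \<le> t\<close> by auto
      have mod: "n - k < 2 * (t * L) + 2 * L"
      proof -
        have "n - k = t * (2 * L) + (n - k) mod (2 * L)" by (simp only: t_def div_mult_mod_eq)
        moreover have "(n - k) mod (2 * L) < 2 * L" using L(2) by (intro mod_less_divisor) simp
        ultimately have "n - k < t * (2 * L) + 2 * L" by linarith
        then show ?thesis by (simp add: mult.left_commute)
      qed
      have exps: "n \<le> L * (2 * t - d) + M"
      proof -
        have "L * (2 * t - d) + L * d = L * (2 * t)"
          using \<open>d + 1 \<le> t\<close> by (simp add: distrib_left[symmetric])
        then have "L * (2 * t - d) + M = 2 * (t * L) + (k + 2 * L)" by (simp add: M_def algebra_simps)
        then show ?thesis using mod by linarith
      qed
      have "\<kappa> ^ n \<le> \<kappa> ^ (L * (2 * t - d) + M)" by (rule power_increasing[OF exps \<kappa>1])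
      also have "\<dots> = (\<kappa> ^ L) ^ (2 * t - d) * \<kappa> ^ M" by (simp add: power_add power_mult)
      also have "\<dots> \<le> real K ^ (2 * t - d) * \<kappa> ^ M"
        using \<kappa>K[OF K(1)] \<kappa>1 by (intro mult_right_mono power_mono) auto
      also have "\<dots> \<le> real (c n) * \<kappa> ^ M"
      proof (rule mult_right_mono)
        show "real K ^ (2 * t - d) \<le> real (c n)" using of_nat_mono[OF K(2), where ?'a = real] by simp
      qed (use \<kappa>1 in auto)
      finally have "root n (\<kappa> ^ n) \<le> root n (real (c n) * \<kappa> ^ M)"
        using n by (intro real_root_le_mono) auto
      then have "\<kappa> \<le> root n (real (c n)) * root n (\<kappa> ^ M)"
        using n \<kappa>1 by (simp add: real_root_mult real_root_power_cancel)
      moreover have "root n (\<kappa> ^ M) > 0" using n \<kappa>1 by (simp add: real_root_gt_zero)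
      ultimately show ?thesis by (simp add: divide_le_eq)
    qed
    have "(\<lambda>n. \<kappa> / root n (\<kappa> ^ M)) \<longlonglongrightarrow> \<kappa> / 1"
      using \<kappa>1 by (intro tendsto_intros LIMSEQ_root_const) auto
    then have "\<forall>\<^sub>F n in sequentially. l < \<kappa> / root n (\<kappa> ^ M)"
      using \<kappa>l by (intro order_tendstoD(1)) auto
    then show ?thesis
      using eventually_ge_at_top[of "k + 2 * L * (d + 1) + 1"]
      by eventually_elim (use low in \<open>force intro: less_le_trans\<close>)
  qed
qed

lemma adapted_basis_exists:
  fixes sH :: "'f::{alg_closed_field, field_char_0} \<Rightarrow> 'h::ring_1 \<Rightarrow> 'h"
    and sA :: "'f \<Rightarrow> 'a::ring \<Rightarrow> 'a"
  assumes action: "generalized_action sH sA act"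
    and H_basis: "finite_dimensional_vector_space sH \<Gamma>"
    and A_findim: "\<exists>E. finite_dimensional_vector_space sA E"
    and J_def: "J = jacobson_radical sA UNIV"
    and J_invariant: "H_invariant act J"
    and A_decomp: "B \<inter> J = {0}" "{b + j | b j. b \<in> B \<and> j \<in> J} = UNIV"
    and B_subalgebra: "is_subalgebra sA B"
    and Bs_ideals: "\<And>i. i \<in> {1..q} \<Longrightarrow> two_sided_ideal sA B (Bs i)"
    and B_decomp: "internal_direct_sum {1..q} Bs B"
    and Bs_simple: "\<And>i. i \<in> {1..q} \<Longrightarrow> H_simple sA act (Bs i) \<and> semisimple_algebra sA (Bs i)"
  shows "\<exists>E Es EJ. closed_structured_action sH sA act \<Gamma> E J q Bs Es EJ"
proof -
  obtain E0 where E0: "finite_dimensional_vector_space sA E0" using A_findim by blast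
  interpret A: fd_algebra sA E0
    using action E0 by (intro fd_algebra.intro) (simp_all add: generalized_action_def)
  have J_sub: "A.subspace J" using A.radical_subspace J_def by simp
  have B_sub: "A.subspace B" using B_subalgebra by (simp add: is_subalgebra_def)
  have Bs_sub: "A.subspace (Bs i)" if "i \<in> {1..q}" for i
    using Bs_simple[OF that] by (simp add: H_simple_def is_subalgebra_def)
  have BsB: "Bs i \<subseteq> B" if "i \<in> {1..q}" for i using Bs_ideals[OF that] by (simp add: two_sided_ideal_def)
  have direct: "v i = 0" if "\<And>i. i \<in> {1..q} \<Longrightarrow> v i \<in> Bs i" "(\<Sum>i\<in>{1..q}. v i) = 0" "i \<in> {1..q}" for v i
    using B_decomp that unfolding internal_direct_sum_def by blast
  have inter: "x = 0" if ik: "i \<in> {1..q}" "k \<in> {1..q}" "i \<noteq> k" and x: "x \<in> Bs i" "x \<in> Bs k" for i k x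
  proof -
    define v where "v j = (if j = i then x else if j = k then - x else 0)" for j
    have "(\<Sum>j\<in>{1..q}. v j) = (\<Sum>j\<in>{i, k}. v j)"
      using ik by (intro sum.mono_neutral_right) (auto simp: v_def)
    also have "\<dots> = 0" using ik(3) by (simp add: v_def)
    finally have "v i = 0"
      using ik x by (intro direct[of v i]) (auto simp: v_def A.subspace_neg Bs_sub A.subspace_0)
    then show ?thesis by (simp add: v_def)
  qed
  have "\<forall>i. \<exists>b. b \<subseteq> Bs i \<and> A.independent b \<and> Bs i \<subseteq> A.span b" using A.basis_exists by metis
  then obtain Es where Es: "\<And>i. Es i \<subseteq> Bs i" "\<And>i. A.independent (Es i)" "\<And>i. Bs i \<subseteq> A.span (Es i)" by metis
  obtain EJ where EJ: "EJ \<subseteq> J" "A.independent EJ" "J \<subseteq> A.span EJ" using A.basis_exists by metis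
  have EJ_span: "A.span EJ = J" by (rule A.span_subspace[OF EJ(1,3) J_sub])
  have Es_span: "A.span (Es i) = Bs i" if "i \<in> {1..q}" for i
    by (rule A.span_subspace[OF Es(1,3) Bs_sub[OF that]])
  have zero_notin: "0 \<notin> S" if "A.independent S" for S using that A.dependent_zero by blast
  have Es_disj: "Es i \<inter> Es k = {}" if "i \<in> {1..q}" "k \<in> {1..q}" "i \<noteq> k" for i k
    using inter[OF that] Es(1) zero_notin[OF Es(2)] by (metis disjoint_iff subsetD)
  have EJ_disj: "EJ \<inter> Es i = {}" if "i \<in> {1..q}" for i
  proof -
    have "e = 0" if "e \<in> EJ" "e \<in> Es i" for e
      using that EJ(1) Es(1) BsB[OF \<open>i \<in> {1..q}\<close>] A_decomp(1) by blast
    then show ?thesis using zero_notin[OF EJ(2)] by blast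
  qed
  define EB where "EB = (\<Union>i\<in>{1..q}. Es i)"
  define E where "E = EB \<union> EJ"
  have fin: "finite (Es i)" "finite EJ" for i using Es(2) EJ(2) A.finiteI_independent by auto
  have finE: "finite E" using fin by (simp add: E_def EB_def)
  have sum_EB: "(\<Sum>e\<in>EB. f e) = (\<Sum>i\<in>{1..q}. \<Sum>e\<in>Es i. f e)" for f :: "'a \<Rightarrow> 'a"
    unfolding EB_def
  proof (rule sum.UNION_disjoint)
    show "\<forall>i\<in>{1..q}. \<forall>j\<in>{1..q}. i \<noteq> j \<longrightarrow> Es i \<inter> Es j = {}" using Es_disj by blast
  qed (use fin in auto)
  have "A.independent E"
  proof (rule A.independent_if_scalars_zero[OF finE])
    fix f x assume z: "(\<Sum>e\<in>E. sA (f e) e) = 0" and x: "x \<in> E"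
    define b j where "b = (\<Sum>e\<in>EB. sA (f e) e)" and "j = (\<Sum>e\<in>EJ. sA (f e) e)"
    define v where "v i = (\<Sum>e\<in>Es i. sA (f e) e)" for i
    have "EB \<inter> EJ = {}" using EJ_disj unfolding EB_def by blast
    then have bj: "b + j = 0"
      using z fin by (simp add: E_def b_def j_def EB_def sum.union_disjoint)
    have vB: "v i \<in> Bs i" if "i \<in> {1..q}" for i
      unfolding v_def using Es(1) Bs_sub[OF that] by (intro A.subspace_sum A.subspace_scale) auto
    have bv: "b = (\<Sum>i\<in>{1..q}. v i)" by (simp add: b_def sum_EB v_def)
    have bB: "b \<in> B" unfolding bv using vB BsB by (intro A.subspace_sum B_sub) blast
    have jJ: "j \<in> J" unfolding j_def using EJ(1) J_sub by (intro A.subspace_sum A.subspace_scale) auto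
    have "b = - j" using bj by (simp add: eq_neg_iff_add_eq_0)
    then have "b \<in> J" using A.subspace_neg[OF J_sub jJ] by simp
    then have b0: "b = 0" using bB A_decomp(1) by blast
    then have j0: "j = 0" using bj by simp
    show "f x = 0"
    proof (cases "x \<in> EJ")
      case True
      then show ?thesis using A.independentD[OF EJ(2) fin(2) order_refl, of f x] j0 by (simp add: j_def)
    next
      case False
      then obtain i where i: "i \<in> {1..q}" "x \<in> Es i" using x by (auto simp: E_def EB_def)
      have "v i = 0" using direct[of v i] vB i(1) b0 bv by simp
      then show ?thesis using A.independentD[OF Es(2) fin(1) order_refl, of f i x] i(2) by (simp add: v_def)
    qed
  qed
  moreover have "A.span E = UNIV"
  proof -
    have "x \<in> A.span E" for x
    proof -
      obtain b j where bj: "x = b + j" "b \<in> B" "j \<in> J" using A_decomp(2) by blast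
      have "j \<in> A.span E" using bj(3) EJ_span A.span_mono[of EJ E] by (auto simp: E_def)
      moreover obtain v where v: "b = (\<Sum>i\<in>{1..q}. v i)" "\<And>i. i \<in> {1..q} \<Longrightarrow> v i \<in> Bs i"
        using bj(2) B_decomp unfolding internal_direct_sum_def by blast
      have "b \<in> A.span E"
        unfolding v(1)
      proof (rule A.span_sum)
        fix i assume i: "i \<in> {1..q}"
        have "Es i \<subseteq> E" using i by (auto simp: E_def EB_def)
        then show "v i \<in> A.span E" using v(2)[OF i] Es_span[OF i] A.span_mono by blast
      qed
      ultimately show ?thesis using bj(1) A.span_add by blast
    qed
    then show ?thesis by blast
  qed
  ultimately have fdE: "finite_dimensional_vector_space sA E"
    using finE A.vector_space_axioms
    by (intro finite_dimensional_vector_space.intro finite_dimensional_vector_space_axioms.intro) auto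
  have "fd_algebra sA E" by (intro fd_algebra.intro A.assoc_algebra_axioms fdE)
  then have fda: "fd_action sH sA act \<Gamma> E" by (intro fd_action.intro action H_basis)
  have orth: "x * y = 0" if ik: "i \<in> {1..q}" "k \<in> {1..q}" "i \<noteq> k" and xy: "x \<in> Bs i" "y \<in> Bs k" for i k x y
  proof (rule inter[OF ik])
    show "x * y \<in> Bs i" using Bs_ideals[OF ik(1)] BsB[OF ik(2)] xy by (auto simp: two_sided_ideal_def)
    show "x * y \<in> Bs k" using Bs_ideals[OF ik(2)] BsB[OF ik(1)] xy by (auto simp: two_sided_ideal_def)
  qed
  have "structured_action sH sA act \<Gamma> E J q Bs Es EJ"
  proof (intro structured_action.intro structured_action_axioms.intro fda)
    show "J = jacobson_radical sA UNIV" "H_invariant act J" by fact+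
    show "E = (\<Union>i\<in>{1..q}. Es i) \<union> EJ" by (simp add: E_def EB_def)
    show "A.span EJ = J" by (rule EJ_span)
  qed (use Es_span Es_disj EJ_disj orth Bs_simple in blast)+
  then have "closed_structured_action sH sA act \<Gamma> E J q Bs Es EJ"
    by (rule closed_structured_action.intro)
  then show ?thesis by blast
qed

theorem mainTheorem9:
  fixes sH :: "'f::{alg_closed_field, field_char_0} \<Rightarrow> 'h::ring_1 \<Rightarrow> 'h"
    and sA :: "'f \<Rightarrow> 'a::ring \<Rightarrow> 'a"
    and act :: "'h \<Rightarrow> 'a \<Rightarrow> 'a"
    and \<Gamma> :: "'h set"
    and B J :: "'a set"
    and Bs :: "nat \<Rightarrow> 'a set"
    and q :: nat
  assumes action: "generalized_action sH sA act"
    and H_basis: "finite_dimensional_vector_space sH \<Gamma>"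
    and A_findim: "\<exists>E. finite_dimensional_vector_space sA E"
    and A_not_nilpotent: "\<not> nilpotent_algebra (UNIV :: 'a set)"
    and J_def: "J = jacobson_radical sA UNIV"
    and J_invariant: "H_invariant act J"
    and B_subalgebra: "is_subalgebra sA B"
    and B_invariant: "H_invariant act B"
    and A_decomp: "B \<inter> J = {0}" "{b + j | b j. b \<in> B \<and> j \<in> J} = UNIV"
    and Bs_ideals: "\<And>i. i \<in> {1..q} \<Longrightarrow> two_sided_ideal sA B (Bs i) \<and> H_invariant act (Bs i)"
    and B_decomp: "internal_direct_sum {1..q} Bs B"
    and Bs_simple: "\<And>i. i \<in> {1..q} \<Longrightarrow> H_simple sA act (Bs i) \<and> semisimple_algebra sA (Bs i)"
  shows "convergent (\<lambda>n. root n (real (H_codim sH sA act \<Gamma> n))) \<and>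
         PIexp_H sH sA act \<Gamma> = real (d_number sA q Bs J)"
proof -
  obtain E Es EJ where "closed_structured_action sH sA act \<Gamma> E J q Bs Es EJ"
    using adapted_basis_exists[OF action H_basis A_findim J_def J_invariant A_decomp B_subalgebra
        conjunct1[OF Bs_ideals] B_decomp Bs_simple] by blast
  then interpret closed_structured_action sH sA act \<Gamma> E J q Bs Es EJ .
  have q: "q \<ge> 1"
  proof (rule ccontr)
    assume "\<not> ?thesis"
    then have "B = {0}" using B_decomp by (simp add: internal_direct_sum_def)
    then have J: "J = UNIV" using A_decomp(2) by auto
    obtain p where p: "\<And>zs :: 'a list. p \<le> length (filter (\<lambda>z. z \<in> J) zs) \<Longrightarrow> nonunital_prod zs = 0"
      using A.radical_nilpotent unfolding J_def by metis
    have "nonunital_prod xs = 0" if "length xs = Suc p" for xs :: "'a list"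
      using p[of xs] that by (simp add: J)
    then have "nilpotent_algebra (UNIV :: 'a set)" unfolding nilpotent_algebra_def by blast
    then show False using A_not_nilpotent by simp
  qed
  have "dA \<ge> 1"
  proof -
    have "[1] \<in> chains" using q Bs_nonzero by (auto simp: chains_def)
    from dA_ge[OF this] have "card (Es 1) \<le> dA" by (simp add: block_basis_def)
    moreover have "card (Es 1) \<noteq> 0"
      using Es_span[of 1] Bs_nonzero[of 1] finite_block_basis[of "{1}"] q by (auto simp: block_basis_def)
    ultimately show ?thesis by simp
  qed
  have upper: "\<exists>C>0. \<forall>n\<ge>1. real (H_codim sH sA act \<Gamma> n) \<le> C * (real dA + x * real (card E)) ^ n"
    if "0 < x" "x \<le> 1" for x
    using codim_upper_bound[OF that] by metis
  obtain k where "\<And>L t n. dA \<le> t \<Longrightarrow> k + 2 * (t * L) \<le> n \<Longrightarrow>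
    \<exists>K. dA ^ L \<le> (L + 1) ^ dA * K \<and> K ^ (2 * t - dA) \<le> H_codim sH sA act \<Gamma> n"
    using codim_lower_bound[OF q] by metis
  from nth_root_limit[OF \<open>dA \<ge> 1\<close> upper this]
  have lim: "(\<lambda>n. root n (real (H_codim sH sA act \<Gamma> n))) \<longlonglongrightarrow> real dA" by blast
  then show ?thesis unfolding PIexp_H_def by (auto intro: convergentI limI)
qed

end
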